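(* Let $(Y,d)$ be a compact geodesic metric space (with more than one point), let $\mu$ be a Borel probability measure on $Y$ such that $(Y,d,\mu)$ is Ahlfors regular, and let $S$ be a finite set of Lipschitz homeomorphisms $s\colon\operatorname{dom}s\to\operatorname{im}s$ between closed subsets of $Y$, closed under inverses. Assume that $\mu(\partial\operatorname{dom}s)=0$ for all $s\in S$, where $\partial$ denotes the topological boundary in $Y$. Let $X$ be any Banach space. Then $S$ has a spectral gap in $L^2(Y,\mu;X)$ if and only if the family of metric spaces $(tY,d_S)_{t>0}=\mathcal{O}_S Y$ (the warped cone) is quasi-isometric to an expander with respect to $X$.
   Context: **Ahlfors regularity.** $(Y,d,\mu)$ is Ahlfors regular if there are constants $c,m>0$ and $C\ge 1$ such that $c r^m\le \mu(B(y,r))\le C c r^m$ for all $y\in Y$ and $0<r\le 2\operatorname{diam} Y$, where $B(y,r)$ is the open ball. **Spectral gap.** $L^2(Y,\mu;X)$ is the space of Bochner-measurable square-integrable $X$-valued functions on $Y$. The set $S$ has a spectral gap in $L^2(Y,\mu;X)$ if there is a constant $\kappa>0$ such that for every $f\in L^2(Y,\mu;X)$ $$\sum_{s\in S}\int_{\operatorname{im}s}\|f(u)-f(s^{-1}(u))\|_X^2\,d\mu(u)\ \ge\ \kappa\iint_{Y^2}\|f(u)-f(v)\|_X^2\,d\mu(u)\,d\mu(v).$$ **Warped cone.** $\mathcal{O}_S Y$ is the family of metric spaces $(tY)_{t>0}$, where $tY$ denotes the set $\{t\}\times Y$ (with points written $ty$, $y\in Y$), equipped with the largest metric $d_S$ such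 that $d_S(tx,ty)\le t\,d(x,y)$ for all $x,y\in Y$ and $d_S(ty,tsy)\le 1$ for all $s\in S$ and $y\in\operatorname{dom}s$ (here $sy=s(y)$). **Quasi-isometry.** A map $f\colon(Y_1,d_1)\to(Y_2,d_2)$ is a quasi-isometry if there are constants $A\ge0$, $C\ge1$, $B>0$ such that $C^{-1}d_1(x,y)-A\le d_2(f(x),f(y))\le C d_1(x,y)+A$ for all $x,y\in Y_1$ and the $B$-neighbourhood of the image of $f$ is all of $Y_2$. Two families of metric spaces with the same index set are quasi-isometric if there are quasi-isometries between the members with the same index, with constants $A,B,C$ independent of the index. Graphs are regarded as metric spaces (on their vertex sets) with the shortest-path metric. **Expander with respect to $X$.** A family $(G_i)_{i\in I}$ of finite graphs with uniformly bounded vertex degrees and unbounded cardinalities is an expander with respect to $X$ if there is a constant $\eta>0$ such that for every $i\in I$ and every function $f\colon G_i\to X$ (defined on vertices) $$\sum_{x\sim y}\|f(x)-f(y)\|_X^2\ \ge\ \frac{\eta}{\# G_i}\sum_{x,y\in G_i}\|f(x)-f(y)\|_X^2,$$ where the sums run over pairs of vertices of $G_i$, $x\sim y$ means that $x$ and $y$ are joined by an edge, and $\# G_i$ is the number of vertices. *)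

theory Defs
  imports
    "HOL-Probability.Probability"
    "Graph_Theory.Pair_Digraph"
    "Graph_Theory.Digraph_Component"
    "Graph_Theory.Shortest_Path"
begin

subsection \<open>The base space\<close>

definition geodesic_set :: "'a::metric_space set \<Rightarrow> bool" where
  "geodesic_set A \<longleftrightarrow>
     (\<forall>x\<in>A. \<forall>y\<in>A. \<exists>\<gamma> :: real \<Rightarrow> 'a.
        \<gamma> ` {0..dist x y} \<subseteq> A \<and> \<gamma> 0 = x \<and> \<gamma> (dist x y) = y \<and>
        (\<forall>a\<in>{0..dist x y}. \<forall>b\<in>{0..dist x y}. dist (\<gamma> a) (\<gamma> b) = \<bar>a - b\<bar>))"

definition ahlfors_regular :: "'y::metric_space measure \<Rightarrow> bool" where
  "ahlfors_regular M \<longleftrightarrow>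
     (\<exists>c m C :: real. c > 0 \<and> m > 0 \<and> C \<ge> 1 \<and>
        (\<forall>y r. 0 < r \<and> r \<le> 2 * diameter (UNIV :: 'y set) \<longrightarrow>
           ennreal (c * r powr m) \<le> emeasure M (ball y r) \<and>
           emeasure M (ball y r) \<le> ennreal (C * c * r powr m)))"


subsection \<open>Partial homeomorphisms\<close>

text \<open>A map between subsets of \<open>Y\<close> is a term of type \<open>'y \<rightharpoonup> 'y\<close>, with domain \<^const>\<open>dom\<close>
  and image \<^const>\<open>ran\<close>, so that equality of such maps includes equality of the domains.\<close>

definition partial_lipschitz_homeo :: "('y::metric_space \<rightharpoonup> 'y) \<Rightarrow> bool" where
  "partial_lipschitz_homeo s \<longleftrightarrow>
     closed (dom s) \<and> closed (ran s) \<and>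
     (\<exists>g. homeomorphism (dom s) (ran s) (\<lambda>x. the (s x)) g) \<and>
     (\<exists>L. lipschitz_on L (dom s) (\<lambda>x. the (s x)))"

definition partial_inv :: "('a \<rightharpoonup> 'b) \<Rightarrow> ('b \<rightharpoonup> 'a)" where
  "partial_inv s = (\<lambda>y. if y \<in> ran s then Some (SOME x. s x = Some y) else None)"


subsection \<open>Spectral gap\<close>

text \<open>The target is an arbitrary Banach space, possibly not separable, so Bochner measurability
  is not the same as membership in \<^const>\<open>borel_measurable\<close>.\<close>

definition bochner_measurable :: "'a measure \<Rightarrow> ('a \<Rightarrow> 'x::banach) \<Rightarrow> bool" where
  "bochner_measurable M f \<longleftrightarrow>
     (\<exists>F :: nat \<Rightarrow> 'a \<Rightarrow> 'x. (\<forall>n. simple_function M (F n)) \<and>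
        (AE x in M. (\<lambda>n. F n x) \<longlonglongrightarrow> f x))"

definition L2_functions :: "'a measure \<Rightarrow> ('a \<Rightarrow> 'x::banach) set" where
  "L2_functions M =
     {f. bochner_measurable M f \<and> (\<integral>\<^sup>+x. ennreal ((norm (f x))\<^sup>2) \<partial>M) < \<infinity>}"

text \<open>A Bochner measurable function need only agree almost everywhere with a Borel function;
  \<^const>\<open>nn_integral\<close>, unlike the real-valued Bochner integral, does not require measurability to be
  invariant under such changes.\<close>

definition has_spectral_gap ::
  "'x::banach itself \<Rightarrow> 'y measure \<Rightarrow> ('y \<rightharpoonup> 'y) set \<Rightarrow> bool" where
  "has_spectral_gap _ M S \<longleftrightarrow>
     (\<exists>\<kappa>::real. \<kappa> > 0 \<and>
        (\<forall>f :: 'y \<Rightarrow> 'x. f \<in> L2_functions M \<longrightarrow>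
           (\<Sum>s\<in>S. \<integral>\<^sup>+u\<in>ran s. ennreal ((norm (f u - f (the (partial_inv s u))))\<^sup>2) \<partial>M)
             \<ge> ennreal \<kappa> * (\<integral>\<^sup>+u. (\<integral>\<^sup>+v. ennreal ((norm (f u - f v))\<^sup>2) \<partial>M) \<partial>M)))"


subsection \<open>The warped cone\<close>

text \<open>The level \<open>tY = {t} \<times> Y\<close> is represented on \<open>Y\<close> itself, \<open>y\<close> standing for the point \<open>ty\<close>.\<close>

definition warped_admissible ::
  "('y::metric_space \<rightharpoonup> 'y) set \<Rightarrow> real \<Rightarrow> ('y \<Rightarrow> 'y \<Rightarrow> real) \<Rightarrow> bool" where
  "warped_admissible S t \<rho> \<longleftrightarrow>
     Metric_space UNIV \<rho> \<and>
     (\<forall>x y. \<rho> x y \<le> t * dist x y) \<and>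
     (\<forall>s\<in>S. \<forall>y\<in>dom s. \<rho> y (the (s y)) \<le> 1)"

definition warped_dist :: "('y::metric_space \<rightharpoonup> 'y) set \<Rightarrow> real \<Rightarrow> 'y \<Rightarrow> 'y \<Rightarrow> real" where
  "warped_dist S t = (GREATEST \<rho>. warped_admissible S t \<rho>)"

definition warped_cone :: "('y::metric_space \<rightharpoonup> 'y) set \<Rightarrow> real \<Rightarrow> 'y metric" where
  "warped_cone S t = metric (UNIV, warped_dist S t)"

lemma warped_dist_greatest:
  fixes S :: "('y::metric_space \<rightharpoonup> 'y) set"
  assumes t: "t > 0"
  shows "warped_admissible S t (warped_dist S t)"
    and "\<And>\<rho>. warped_admissible S t \<rho> \<Longrightarrow> \<rho> \<le> warped_dist S t"
proof -
  let ?A = "Collect (warped_admissible S t)"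
  define \<delta> :: "'y \<Rightarrow> 'y \<Rightarrow> real" where "\<delta> x y = min (t * dist x y) 1" for x y
  have tri: "\<delta> x z \<le> \<delta> x y + \<delta> y z" for x y z
  proof -
    have "t * dist x z \<le> t * dist x y + t * dist y z"
      using t dist_triangle[of x z y] by (simp flip: distrib_left)
    moreover have "0 \<le> t * dist x y" "0 \<le> t * dist y z" using t by auto
    ultimately show ?thesis unfolding \<delta>_def by linarith
  qed
  have "Metric_space UNIV \<delta>"
  proof
    show "0 \<le> \<delta> x y" and "\<delta> x y = \<delta> y x" and "\<delta> x y = 0 \<longleftrightarrow> x = y" for x y
      using t by (auto simp: \<delta>_def dist_commute min_def)
  qed (rule tri)
  then have \<delta>: "\<delta> \<in> ?A"
    by (auto simp: warped_admissible_def \<delta>_def)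
  define D where "D x y = (SUP \<rho>\<in>?A. \<rho> x y)" for x y
  have bdd: "bdd_above ((\<lambda>\<rho>. \<rho> x y) ` ?A)" for x y
    by (rule bdd_aboveI[of _ "t * dist x y"]) (auto simp: warped_admissible_def)
  have upper: "\<rho> x y \<le> D x y" if "\<rho> \<in> ?A" for \<rho> x y
    unfolding D_def using bdd that by (rule cSUP_upper2) auto
  have least: "D x y \<le> b" if "\<And>\<rho>. \<rho> \<in> ?A \<Longrightarrow> \<rho> x y \<le> b" for x y b
    unfolding D_def using \<delta> that by (intro cSUP_least) auto
  have le: "D x y \<le> t * dist x y" for x y
    by (rule least) (auto simp: warped_admissible_def)
  have ge: "\<delta> x y \<le> D x y" for x y
    using \<delta> by (rule upper)
  have "Metric_space UNIV D"
  proof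
    show "0 \<le> D x y" for x y
    proof -
      have "0 \<le> \<delta> x y" using t by (simp add: \<delta>_def)
      then show ?thesis using ge by (rule order_trans)
    qed
    show "D x y = D y x" for x y
    proof -
      have "\<rho> x y = \<rho> y x" if "\<rho> \<in> ?A" for \<rho>
        using that by (intro Metric_space.commute[of UNIV]) (simp add: warped_admissible_def)
      then show ?thesis
        unfolding D_def by (intro SUP_cong refl)
    qed
    show "D x y = 0 \<longleftrightarrow> x = y" for x y
    proof
      assume "D x y = 0"
      then have "t * dist x y \<le> 0"
        using ge[of x y] by (auto simp: \<delta>_def min_def split: if_splits)
      then show "x = y"
        using t by (simp add: mult_le_0_iff)
    next
      assume "x = y"
      then show "D x y = 0"
        using le[of x y] ge[of x y] by (simp add: \<delta>_def)
    qed
    show "D x z \<le> D x y + D y z" for x y z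
    proof (rule least)
      fix \<rho> assume \<rho>: "\<rho> \<in> ?A"
      then have "\<rho> x z \<le> \<rho> x y + \<rho> y z"
        by (intro Metric_space.triangle[of UNIV]) (simp_all add: warped_admissible_def)
      then show "\<rho> x z \<le> D x y + D y z"
        using upper[OF \<rho>, of x y] upper[OF \<rho>, of y z] by linarith
    qed
  qed
  moreover have "D y (the (s y)) \<le> 1" if "s \<in> S" "y \<in> dom s" for s y
    by (rule least) (use that in \<open>auto simp: warped_admissible_def\<close>)
  ultimately have D: "warped_admissible S t D"
    using le by (simp add: warped_admissible_def)
  have max: "\<rho> \<le> D" if "warped_admissible S t \<rho>" for \<rho>
    using upper that by (auto simp: le_fun_def)
  have eq: "warped_dist S t = D"
    unfolding warped_dist_def using D max by (rule Greatest_equality)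
  show "warped_admissible S t (warped_dist S t)"
    unfolding eq by (rule D)
  show "\<rho> \<le> warped_dist S t" if "warped_admissible S t \<rho>" for \<rho>
    unfolding eq using that by (rule max)
qed


subsection \<open>Quasi-isometries\<close>

definition quasi_isometry ::
  "real \<Rightarrow> real \<Rightarrow> real \<Rightarrow> 'a metric \<Rightarrow> 'b metric \<Rightarrow> ('a \<Rightarrow> 'b) \<Rightarrow> bool" where
  "quasi_isometry A B C m1 m2 f \<longleftrightarrow>
     f ` mspace m1 \<subseteq> mspace m2 \<and>
     (\<forall>x\<in>mspace m1. \<forall>y\<in>mspace m1.
        mdist m1 x y / C - A \<le> mdist m2 (f x) (f y) \<and>
        mdist m2 (f x) (f y) \<le> C * mdist m1 x y + A) \<and>
     (\<forall>z\<in>mspace m2. \<exists>x\<in>mspace m1. mdist m2 (f x) z < B)"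

definition quasi_isometric_families ::
  "'i set \<Rightarrow> ('i \<Rightarrow> 'a metric) \<Rightarrow> ('i \<Rightarrow> 'b metric) \<Rightarrow> bool" where
  "quasi_isometric_families I m1 m2 \<longleftrightarrow>
     (\<exists>A B C. A \<ge> 0 \<and> B > 0 \<and> C \<ge> 1 \<and> (\<forall>i\<in>I. \<exists>f. quasi_isometry A B C (m1 i) (m2 i) f))"


subsection \<open>Graphs and expanders\<close>

text \<open>A finite graph is a \<^locale>\<open>pair_graph\<close>: every edge is a pair of opposite arcs, and there are
  no loops. The type \<^typ>\<open>'x metric\<close> has finite distances only, so \<open>graph_metric G\<close> is meaningful
  only for connected \<open>G\<close>.\<close>

definition graph_metric :: "'v pair_pre_digraph \<Rightarrow> 'v metric" where
  "graph_metric G =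
     metric (pverts G, \<lambda>u v. real_of_ereal (wf_digraph.\<mu> (with_proj G) (\<lambda>_. 1) u v))"

lemma Metric_space_graph_dist:
  assumes "pair_graph G" and conn: "Digraph_Component.connected (with_proj G)"
  shows "Metric_space (pverts G) (\<lambda>u v. real_of_ereal (wf_digraph.\<mu> (with_proj G) (\<lambda>_. 1) u v))"
proof -
  interpret pair_graph G by fact
  let ?\<mu> = "\<mu> (\<lambda>_. 1)"
  have reach: "u \<rightarrow>\<^sup>*\<^bsub>with_proj G\<^esub> v" if "u \<in> pverts G" "v \<in> pverts G" for u v
  proof -
    have "u \<rightarrow>\<^sup>*\<^bsub>with_proj (mk_symmetric (with_proj G))\<^esub> v"
      using conn that by (auto simp: Digraph_Component.connected_def strongly_connected_def)
    then show ?thesis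
      by (simp only: reachable_mk_symmetric_eq[OF pair_sym_arcs])
  qed
  have cost: "awalk_cost (\<lambda>_. 1) p = real (length p)" for p :: "('a \<times> 'a) list"
    by (induction p) auto
  have le: "?\<mu> u v \<le> ereal (length p)" if "awalk u p v" for u v p
    using min_cost_le_walk_cost[OF that, of "\<lambda>_. 1"] by (simp add: cost)
  have nonneg: "0 \<le> ?\<mu> u v" for u v
    unfolding \<mu>_def by (rule INF_greatest) (simp add: cost)
  have attained: "\<exists>p. awalk u p v \<and> ?\<mu> u v = ereal (length p)"
    if uv: "u \<in> pverts G" "v \<in> pverts G" for u v
  proof -
    obtain p where "apath u p v" "?\<mu> u v = awalk_cost (\<lambda>_. 1) p"
      using no_neg_cyc_reach_imp_path[OF reach[OF uv], of "\<lambda>_. 1"] by (auto simp: cost)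
    then show ?thesis by (auto simp: cost apath_def)
  qed
  have length_rev_path: "length (rev_path p) = length p" for p :: "('a \<times> 'a) list"
    by (induction p) auto
  have sym_le: "?\<mu> u v \<le> ?\<mu> v u" for u v
  proof -
    have "?\<mu> u v \<le> ereal (awalk_cost (\<lambda>_. 1) p)" if "awalk v p u" for p
      using le[of u "rev_path p" v] that by (simp add: cost length_rev_path)
    then show ?thesis
      unfolding \<mu>_def[of _ v u] by (intro INF_greatest) simp
  qed
  show ?thesis
  proof
    fix u v
    show "0 \<le> real_of_ereal (?\<mu> u v)"
      using nonneg by (rule real_of_ereal_pos)
    show "real_of_ereal (?\<mu> u v) = real_of_ereal (?\<mu> v u)"
      by (rule arg_cong[where f = real_of_ereal], rule order_antisym) (rule sym_le)+
  next
    fix u v assume uv: "u \<in> pverts G" "v \<in> pverts G"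
    obtain p where p: "awalk u p v" "?\<mu> u v = ereal (length p)"
      using attained[OF uv] by (elim exE conjE)
    show "real_of_ereal (?\<mu> u v) = 0 \<longleftrightarrow> u = v"
    proof
      assume "real_of_ereal (?\<mu> u v) = 0"
      then have "p = []" by (simp only: p(2) real_of_ereal.simps of_nat_eq_0_iff length_0_conv)
      with p(1) show "u = v" by (simp only: awalk_Nil_iff)
    next
      assume "u = v"
      then have "?\<mu> u v \<le> ereal 0"
        using le[of u "[]" v] uv by (simp add: awalk_Nil_iff)
      then have "real (length p) \<le> 0"
        by (simp only: p(2) ereal_less_eq)
      then show "real_of_ereal (?\<mu> u v) = 0"
        by (simp add: p(2))
    qed
  next
    fix u v w assume uvw: "u \<in> pverts G" "v \<in> pverts G" "w \<in> pverts G"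
    obtain p where p: "awalk u p v" "?\<mu> u v = ereal (length p)"
      using attained[OF uvw(1,2)] by (elim exE conjE)
    obtain q where q: "awalk v q w" "?\<mu> v w = ereal (length q)"
      using attained[OF uvw(2,3)] by (elim exE conjE)
    obtain r where r: "awalk u r w" "?\<mu> u w = ereal (length r)"
      using attained[OF uvw(1,3)] by (elim exE conjE)
    have "?\<mu> u w \<le> ereal (length (p @ q))"
      by (rule le) (rule awalk_appendI[OF p(1) q(1)])
    then have "real (length r) \<le> real (length p) + real (length q)"
      by (simp only: r(2) ereal_less_eq length_append of_nat_add)
    then show "real_of_ereal (?\<mu> u w) \<le> real_of_ereal (?\<mu> u v) + real_of_ereal (?\<mu> v w)"
      by (simp only: p(2) q(2) r(2) real_of_ereal.simps)
  qed
qed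

text \<open>Both sums run over ordered pairs of vertices; counting unordered pairs instead would only
  change \<open>\<eta>\<close> by a factor.\<close>

definition expander_wrt ::
  "'x::banach itself \<Rightarrow> 'i set \<Rightarrow> ('i \<Rightarrow> 'v pair_pre_digraph) \<Rightarrow> bool" where
  "expander_wrt _ I G \<longleftrightarrow>
     (\<forall>i\<in>I. pair_graph (G i)) \<and>
     (\<exists>k. \<forall>i\<in>I. \<forall>v\<in>pverts (G i). out_degree (with_proj (G i)) v \<le> k) \<and>
     (\<forall>N. \<exists>i\<in>I. card (pverts (G i)) > N) \<and>
     (\<exists>\<eta>::real. \<eta> > 0 \<and>
        (\<forall>i\<in>I. \<forall>f :: 'v \<Rightarrow> 'x.
           (\<Sum>(x, y)\<in>parcs (G i). (norm (f x - f y))\<^sup>2)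
             \<ge> \<eta> / card (pverts (G i)) *
               (\<Sum>x\<in>pverts (G i). \<Sum>y\<in>pverts (G i). (norm (f x - f y))\<^sup>2)))"

end

theory Submission
  imports Defs
begin

text \<open>A level \<open>tY\<close> of the warped cone is replaced by a graph whose vertices are the points of a
  maximal \<open>1/t\<close>-separated subset of \<open>Y\<close>. The points of \<open>Y\<close> are distributed to the nearest net point,
  and two vertices are joined when their cells contain points at distance at most \<open>1/t\<close>, or a point
  and its image under some \<open>s \<in> S\<close>.

  The geometry of these graphs does not depend on \<open>X\<close>. Ahlfors regularity makes the number of net
  points in a ball of radius comparable to \<open>1/t\<close> bounded, hence the degrees are bounded
  (\<open>degree_net_graph\<close>), and gives all cells the same measure up to a constant factor
  (\<open>measure_cell_bounds\<close>). The nearest-point map is a quasi-isometry from \<open>tY\<close>, with constants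
  independent of \<open>t\<close> (\<open>quasi_isometry_net_graph\<close>); the upper bound for graph distances exploits the
  maximality of the warped metric through Lipschitz test functions
  (\<open>coarse_metric_le_warped_dist\<close>).

  From the spectral gap to expanders: apply the gap to functions that are constant on the cells. The
  double integral is then comparable to a double sum over the vertices, and such a function changes
  between \<open>u\<close> and \<open>s u\<close> only across an edge (\<open>net_graph_poincare_of_gap\<close>).

  From expanders to the spectral gap: a Poincare inequality passes between quasi-isometric graphs of
  bounded degree (\<open>poincare_transfer\<close>), so all the net graphs satisfy one with a common constant.
  Sample a Lipschitz function \<open>h\<close> at the net points and let \<open>t\<close> tend to infinity. Edges between nearby
  cells contribute \<open>O(t\<^sup>-\<^sup>2)\<close>. An edge created by \<open>s\<close> is compared with \<open>h u - h (s u)\<close> for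
  every \<open>u\<close> in the cell, unless the cell straddles the boundary of \<open>dom s\<close>; then the cell lies in
  a neighbourhood of this boundary that shrinks to a null set (\<open>arc_difference_le_majorant\<close>). Lipschitz functions
  are dense in \<open>L\<^sup>2\<close>, and the jump energy is continuous there because bi-Lipschitz maps change an
  Ahlfors regular measure by a bounded factor only (\<open>measure_partial_vimage_le\<close>). This yields the
  gap for all square-integrable functions (\<open>variance_le_jump_energy\<close>).\<close>

section \<open>Poincare inequalities on graphs of bounded degree\<close>

definition dirichlet_energy :: "('v \<times> 'v) set \<Rightarrow> ('v \<Rightarrow> 'x::real_normed_vector) \<Rightarrow> real" where
  "dirichlet_energy E f = (\<Sum>(x, y)\<in>E. (norm (f x - f y))\<^sup>2)"

definition total_variance :: "'v set \<Rightarrow> ('v \<Rightarrow> 'x::real_normed_vector) \<Rightarrow> real" where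
  "total_variance V f = (\<Sum>x\<in>V. \<Sum>y\<in>V. (norm (f x - f y))\<^sup>2)"

text \<open>The union with the identity lets walks stop early, so that these are the vertices reached in at
  most \<open>R\<close> steps.\<close>

definition walk_ball :: "('v \<times> 'v) set \<Rightarrow> nat \<Rightarrow> 'v \<Rightarrow> 'v set" where
  "walk_ball E R x = ((E \<union> Id) ^^ R) `` {x}"

lemma power2_norm_diff_le:
  fixes a b c :: "'x::real_normed_vector"
  shows "(norm (a - c))\<^sup>2 \<le> 2 * (norm (a - b))\<^sup>2 + 2 * (norm (b - c))\<^sup>2"
proof -
  have "norm (a - c) \<le> norm (a - b) + norm (b - c)"
    using norm_triangle_ineq[of "a - b" "b - c"] by simp
  then have "(norm (a - c))\<^sup>2 \<le> (norm (a - b) + norm (b - c))\<^sup>2"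
    by (intro power_mono) auto
  also have "\<dots> \<le> 2 * (norm (a - b))\<^sup>2 + 2 * (norm (b - c))\<^sup>2"
    using sum_squares_bound[of "norm (a - b)" "norm (b - c)"] by (simp add: power2_sum)
  finally show ?thesis .
qed

lemma power2_norm_diff_le3:
  fixes a b c d :: "'x::real_normed_vector"
  shows "(norm (a - d))\<^sup>2 \<le> 4 * (norm (a - b))\<^sup>2 + 4 * (norm (b - c))\<^sup>2 + 4 * (norm (c - d))\<^sup>2"
  using power2_norm_diff_le[of a d b] power2_norm_diff_le[of b d c] by (smt (verit) zero_le_power2)

lemma dirichlet_energy_nonneg: "0 \<le> dirichlet_energy E f"
  unfolding dirichlet_energy_def by (intro sum_nonneg) auto

lemma sum_fibres_le:
  fixes g :: "'b \<Rightarrow> real"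
  assumes fin: "finite A" "finite B"
    and maps: "\<And>a. a \<in> A \<Longrightarrow> h a \<in> B"
    and fibre: "\<And>b. b \<in> B \<Longrightarrow> card {a \<in> A. h a = b} \<le> N"
    and nonneg: "\<And>b. b \<in> B \<Longrightarrow> 0 \<le> g b"
  shows "(\<Sum>a\<in>A. g (h a)) \<le> real N * (\<Sum>b\<in>B. g b)"
proof -
  have "(\<Sum>a\<in>A. g (h a)) = (\<Sum>b\<in>B. \<Sum>a\<in>{a \<in> A. h a = b}. g (h a))"
    by (rule sum.group[symmetric]) (use fin maps in auto)
  also have "\<dots> = (\<Sum>b\<in>B. real (card {a \<in> A. h a = b}) * g b)"
    by (intro sum.cong refl) simp
  also have "\<dots> \<le> (\<Sum>b\<in>B. real N * g b)"
    by (intro sum_mono mult_right_mono) (use fibre nonneg in auto)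
  finally show ?thesis by (simp add: sum_distrib_left)
qed

lemma card_pair_fibre:
  assumes A: "A \<subseteq> P \<times> P" "finite P" and fibre: "\<And>q. q \<in> Q \<Longrightarrow> card {p \<in> P. l p = q} \<le> N"
    and b: "b \<in> Q \<times> Q"
  shows "card {a \<in> A. map_prod l l a = b} \<le> N * N"
proof -
  have "{a \<in> A. map_prod l l a = b} \<subseteq> {p \<in> P. l p = fst b} \<times> {p \<in> P. l p = snd b}"
    using A(1) by auto
  then have "card {a \<in> A. map_prod l l a = b} \<le> card ({p \<in> P. l p = fst b} \<times> {p \<in> P. l p = snd b})"
    using A(2) by (intro card_mono) auto
  also have "\<dots> \<le> N * N"
    unfolding card_cartesian_product using fibre b by (intro mult_mono) auto
  finally show ?thesis .
qed

lemma walk_ball_0 [simp]: "walk_ball E 0 x = {x}"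
  by (auto simp: walk_ball_def)

lemma walk_ball_1: "walk_ball E (Suc 0) x = insert x (E `` {x})"
  by (auto simp: walk_ball_def)

lemma walk_ball_Suc: "walk_ball E (Suc R) x = (\<Union>w\<in>walk_ball E R x. insert w (E `` {w}))"
  by (auto simp: walk_ball_def)

lemma walk_ball_sym:
  assumes "sym E" "y \<in> walk_ball E R x"
  shows "x \<in> walk_ball E R y"
proof -
  have "sym ((E \<union> Id) ^^ R)"
  proof (induction R)
    case 0
    show ?case by (simp add: sym_Id)
  next
    case (Suc R)
    have "sym (E \<union> Id)" using assms(1) by (simp add: sym_Un sym_Id)
    with Suc show ?case
      unfolding sym_conv_converse_eq relpow.simps converse_relcomp by (simp only: relpow_commute)
  qed
  then show ?thesis
    using assms(2) by (auto simp: walk_ball_def sym_def)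
qed

lemma walk_ball_subset:
  assumes "E \<subseteq> V \<times> V" "x \<in> V"
  shows "walk_ball E R x \<subseteq> V"
  using assms by (induction R) (auto simp: walk_ball_Suc)

lemma card_walk_ball:
  assumes fin: "finite E" and deg: "\<And>x. card (E `` {x}) \<le> k"
  shows "finite (walk_ball E R x)" and "card (walk_ball E R x) \<le> Suc k ^ R"
proof -
  have "finite (walk_ball E R x) \<and> card (walk_ball E R x) \<le> Suc k ^ R"
  proof (induction R)
    case 0
    then show ?case by simp
  next
    case (Suc R)
    have nb: "finite (insert w (E `` {w}))" "card (insert w (E `` {w})) \<le> Suc k" for w
      using fin deg[of w] by (auto simp: card_insert_if finite_Image intro: le_SucI)
    have "card (walk_ball E (Suc R) x) \<le> (\<Sum>w\<in>walk_ball E R x. card (insert w (E `` {w})))"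
      unfolding walk_ball_Suc using Suc by (intro card_UN_le) auto
    also have "\<dots> \<le> card (walk_ball E R x) * Suc k"
      using sum_bounded_above[of "walk_ball E R x", OF nb(2)] by (simp add: mult.commute)
    also have "\<dots> \<le> Suc k ^ R * Suc k"
      using Suc by (intro mult_right_mono) auto
    finally show ?case
      using Suc nb by (auto simp: walk_ball_Suc mult.commute)
  qed
  then show "finite (walk_ball E R x)" "card (walk_ball E R x) \<le> Suc k ^ R" by auto
qed

lemma walk_ball_relpow:
  assumes "(x, y) \<in> E ^^ j" "j \<le> R"
  shows "y \<in> walk_ball E R x"
proof -
  have "(x, y) \<in> (E \<union> Id) ^^ j"
    using assms(1) by (induction j arbitrary: y) auto
  moreover have "(y, y) \<in> (E \<union> Id) ^^ i" for i
    by (induction i) auto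
  ultimately have "(x, y) \<in> (E \<union> Id) ^^ (j + (R - j))"
    unfolding relpow_add by blast
  then show ?thesis using assms(2) by (simp add: walk_ball_def)
qed

lemma walk_ball_imp_relpow:
  assumes "y \<in> walk_ball E R x"
  shows "\<exists>j\<le>R. (x, y) \<in> E ^^ j"
  using assms
proof (induction R arbitrary: y)
  case 0
  then show ?case by auto
next
  case (Suc R)
  then obtain w where w: "w \<in> walk_ball E R x" "y = w \<or> (w, y) \<in> E"
    by (auto simp: walk_ball_Suc)
  from Suc.IH[OF w(1)] obtain j where "j \<le> R" "(x, w) \<in> E ^^ j" by auto
  then show ?case
    using w(2) by (metis le_SucI relpow_Suc_I Suc_le_mono)
qed

text \<open>Induction on \<open>R\<close>: the last step of a walk splits the difference of the values at its end points in
  two. A pair counted in the first half is extended in at most \<open>Suc k\<close> ways, and by symmetry of \<open>E\<close> the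
  last step is shared by at most as many walks as there are vertices in a ball.\<close>

lemma sum_walk_ball_energy:
  fixes f :: "'v \<Rightarrow> 'x::real_normed_vector"
  assumes V: "finite V" "E \<subseteq> V \<times> V" and sym: "sym E"
    and deg: "\<And>x. card (E `` {x}) \<le> k"
  shows "(\<Sum>x\<in>V. \<Sum>y\<in>walk_ball E R x. (norm (f x - f y))\<^sup>2)
    \<le> real (R * (2 * Suc k) ^ R) * dirichlet_energy E f"
proof (induction R)
  case 0
  then show ?case by simp
next
  case (Suc R)
  have finE: "finite E" using V by (meson finite_SigmaI finite_subset)
  note ball = card_walk_ball[OF finE deg]
  let ?B = "walk_ball E R" and ?N = "\<lambda>w. insert w (E `` {w})"
  let ?d = "\<lambda>x y. (norm (f x - f y))\<^sup>2"
  have nb: "finite (?N w)" "card (?N w) \<le> Suc k" for w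
    using finE deg[of w] by (auto simp: card_insert_if finite_Image intro: le_SucI)
  have edges: "(\<Sum>w\<in>V. \<Sum>y\<in>?N w. ?d w y) = dirichlet_energy E f"
  proof -
    have "(\<Sum>y\<in>?N w. ?d w y) = (\<Sum>y\<in>E `` {w}. ?d w y)" for w
      by (rule sum.mono_neutral_right) (use nb in auto)
    moreover have "(\<Sum>w\<in>V. \<Sum>y\<in>E `` {w}. ?d w y) = (\<Sum>(w, y)\<in>(SIGMA w:V. E `` {w}). ?d w y)"
      by (rule sum.Sigma) (use V finE in \<open>auto simp: finite_Image\<close>)
    moreover have "(SIGMA w:V. E `` {w}) = E" using V by auto
    ultimately show ?thesis by (simp add: dirichlet_energy_def)
  qed
  have "(\<Sum>x\<in>V. \<Sum>y\<in>walk_ball E (Suc R) x. ?d x y) \<le> (\<Sum>x\<in>V. \<Sum>w\<in>?B x. \<Sum>y\<in>?N w. ?d x y)"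
    unfolding walk_ball_Suc
  proof (rule sum_mono)
    fix x
    have "(\<Sum>y\<in>\<Union> (?N ` ?B x). ?d x y) \<le> (\<Sum>(w, y)\<in>(SIGMA w:?B x. ?N w). ?d x y)"
      by (rule sum_le_included[where i = snd]) (use ball nb in \<open>auto simp: finite_Image\<close>)
    also have "\<dots> = (\<Sum>w\<in>?B x. \<Sum>y\<in>?N w. ?d x y)"
      by (rule sum.Sigma[symmetric]) (use ball nb in auto)
    finally show "(\<Sum>y\<in>\<Union> (?N ` ?B x). ?d x y) \<le> (\<Sum>w\<in>?B x. \<Sum>y\<in>?N w. ?d x y)" .
  qed
  also have "\<dots> \<le> (\<Sum>x\<in>V. \<Sum>w\<in>?B x. \<Sum>y\<in>?N w. 2 * ?d x w + 2 * ?d w y)"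
    by (intro sum_mono power2_norm_diff_le)
  also have "\<dots> = (\<Sum>x\<in>V. \<Sum>w\<in>?B x. 2 * real (card (?N w)) * ?d x w)
      + 2 * (\<Sum>x\<in>V. \<Sum>w\<in>?B x. \<Sum>y\<in>?N w. ?d w y)"
    by (simp add: sum.distrib sum_distrib_left mult_ac)
  also have "\<dots> \<le> 2 * real (Suc k) * (\<Sum>x\<in>V. \<Sum>w\<in>?B x. ?d x w)
      + 2 * (real (Suc k ^ R) * dirichlet_energy E f)"
  proof (intro add_mono mult_left_mono)
    have "(\<Sum>x\<in>V. \<Sum>w\<in>?B x. 2 * real (card (?N w)) * ?d x w)
        \<le> (\<Sum>x\<in>V. \<Sum>w\<in>?B x. 2 * real (Suc k) * ?d x w)"
      using nb(2) by (intro sum_mono mult_right_mono mult_left_mono) (auto simp del: of_nat_Suc)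
    then show "(\<Sum>x\<in>V. \<Sum>w\<in>?B x. 2 * real (card (?N w)) * ?d x w)
        \<le> 2 * real (Suc k) * (\<Sum>x\<in>V. \<Sum>w\<in>?B x. ?d x w)"
      by (simp add: sum_distrib_left)
  next
    let ?g = "\<lambda>w. \<Sum>y\<in>?N w. ?d w y"
    have "(\<Sum>x\<in>V. \<Sum>w\<in>?B x. ?g w) = (\<Sum>x\<in>V. \<Sum>w\<in>{w \<in> V. w \<in> ?B x}. ?g w)"
      using walk_ball_subset[OF V(2)] by (intro sum.cong refl) auto
    also have "\<dots> = (\<Sum>w\<in>V. \<Sum>x\<in>{x \<in> V. w \<in> ?B x}. ?g w)"
      by (rule sum.swap_restrict) (use V in auto)
    also have "\<dots> \<le> (\<Sum>w\<in>V. real (Suc k ^ R) * ?g w)"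
    proof (rule sum_mono)
      fix w
      have "{x \<in> V. w \<in> ?B x} \<subseteq> ?B w" using walk_ball_sym[OF sym] by auto
      then have "card {x \<in> V. w \<in> ?B x} \<le> Suc k ^ R"
        using card_mono[OF ball(1)] ball(2) le_trans by blast
      moreover have "0 \<le> ?g w" by (intro sum_nonneg) auto
      ultimately show "(\<Sum>x\<in>{x \<in> V. w \<in> ?B x}. ?g w) \<le> real (Suc k ^ R) * ?g w"
        by (simp del: of_nat_power add: mult_right_mono)
    qed
    also have "\<dots> = real (Suc k ^ R) * dirichlet_energy E f"
      by (simp only: sum_distrib_left[symmetric] edges)
    finally show "(\<Sum>x\<in>V. \<Sum>w\<in>?B x. ?g w) \<le> real (Suc k ^ R) * dirichlet_energy E f" .
  qed simp
  also have "\<dots> \<le> 2 * real (Suc k) * (real (R * (2 * Suc k) ^ R) * dirichlet_energy E f)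
      + (2 * real (Suc k)) ^ Suc R * dirichlet_energy E f"
  proof (intro add_mono mult_left_mono Suc.IH)
    have "2 * real (Suc k ^ R) \<le> (2 * real (Suc k)) ^ Suc R"
    proof -
      have "real (Suc k) ^ R \<le> (2 * real (Suc k)) ^ R" by (intro power_mono) auto
      moreover have "2 \<le> 2 * real (Suc k)" by simp
      ultimately have "2 * real (Suc k) ^ R \<le> (2 * real (Suc k)) * (2 * real (Suc k)) ^ R"
        by (intro mult_mono) auto
      then show ?thesis by simp
    qed
    then show "2 * (real (Suc k ^ R) * dirichlet_energy E f)
        \<le> (2 * real (Suc k)) ^ Suc R * dirichlet_energy E f"
      using mult_right_mono[OF _ dirichlet_energy_nonneg[of E f]] by (metis mult.assoc)
  qed simp
  also have "\<dots> = real (Suc R * (2 * Suc k) ^ Suc R) * dirichlet_energy E f"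
    by (simp add: algebra_simps)
  finally show ?case .
qed

text \<open>The function \<open>g \<circ> \<psi>\<close> has energy bounded by that of \<open>g\<close>, since arcs of \<open>E'\<close> become short walks and
  boundedly many of them become the same pair. Conversely \<open>g\<close> and \<open>g \<circ> \<psi> \<circ> \<phi>\<close> differ at each vertex
  by the difference of \<open>g\<close> along a short walk, so their variances agree up to the energy of \<open>g\<close>. The hypotheses are the traces
  of a quasi-isometry \<open>\<phi>\<close> with quasi-inverse \<open>\<psi>\<close> that this argument uses.\<close>

lemma poincare_transfer:
  fixes g :: "'v \<Rightarrow> 'x::real_normed_vector" and \<phi> :: "'v \<Rightarrow> 'w" and \<psi> :: "'w \<Rightarrow> 'v"
  assumes V: "finite V" "E \<subseteq> V \<times> V" "sym E" and deg: "\<And>x. card (E `` {x}) \<le> k"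
    and W: "finite W" "E' \<subseteq> W \<times> W"
    and \<phi>: "\<And>v. v \<in> V \<Longrightarrow> \<phi> v \<in> W" "\<And>w. w \<in> W \<Longrightarrow> card {v \<in> V. \<phi> v = w} \<le> N"
    and \<psi>: "\<And>w. w \<in> W \<Longrightarrow> \<psi> w \<in> V" "\<And>v. v \<in> V \<Longrightarrow> card {w \<in> W. \<psi> w = v} \<le> N"
    and arcs: "\<And>w w'. (w, w') \<in> E' \<Longrightarrow> \<psi> w' \<in> walk_ball E R (\<psi> w)"
    and inverse: "\<And>v. v \<in> V \<Longrightarrow> \<psi> (\<phi> v) \<in> walk_ball E R v"
    and \<eta>: "0 < \<eta>" and poincare:
      "\<eta> / card W * total_variance W (g \<circ> \<psi>) \<le> dirichlet_energy E' (g \<circ> \<psi>)"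
  defines "K \<equiv> real (R * (2 * Suc k) ^ R)"
  shows "total_variance V g \<le> (8 * K + 4 * real N ^ 5 * K / \<eta>) * card V * dirichlet_energy E g"
proof (cases "W = {}")
  case True
  then have "V = {}" using \<phi>(1) by auto
  then show ?thesis by (simp add: total_variance_def)
next
  case False
  let ?d = "\<lambda>x y. (norm (g x - g y))\<^sup>2" and ?D = "dirichlet_energy E g"
  have finE: "finite E" "finite E'" using V W by (meson finite_SigmaI finite_subset)+
  note ball = card_walk_ball[OF finE(1) deg] and energy = sum_walk_ball_energy[OF V deg, where R = R and f = g]
  have D: "0 \<le> ?D" by (rule dirichlet_energy_nonneg)
  have step1: "(\<Sum>v\<in>V. ?d v (\<psi> (\<phi> v))) \<le> K * ?D"
  proof -
    have "(\<Sum>v\<in>V. ?d v (\<psi> (\<phi> v))) \<le> (\<Sum>v\<in>V. \<Sum>y\<in>walk_ball E R v. ?d v y)"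
      using inverse ball(1) by (intro sum_mono member_le_sum) auto
    with energy show ?thesis by (simp add: K_def)
  qed
  have step2: "dirichlet_energy E' (g \<circ> \<psi>) \<le> real (N * N) * (K * ?D)"
  proof -
    let ?P = "SIGMA v:V. walk_ball E R v"
    have P: "finite ?P" "?P \<subseteq> V \<times> V"
      using V ball(1) walk_ball_subset[OF V(2)] by (auto, blast)
    have "dirichlet_energy E' (g \<circ> \<psi>) = (\<Sum>a\<in>E'. (\<lambda>(x, y). ?d x y) (map_prod \<psi> \<psi> a))"
      by (simp add: dirichlet_energy_def case_prod_unfold)
    also have "\<dots> \<le> real (N * N) * (\<Sum>(x, y)\<in>?P. ?d x y)"
    proof (rule sum_fibres_le)
      show "card {a \<in> E'. map_prod \<psi> \<psi> a = b} \<le> N * N" if "b \<in> ?P" for b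
        by (rule card_pair_fibre[where P = W and Q = V]) (use W \<psi> P that in auto)
      show "map_prod \<psi> \<psi> a \<in> ?P" if "a \<in> E'" for a
        using that W \<psi>(1) arcs by (cases a) auto
    qed (use finE P in auto)
    also have "(\<Sum>(x, y)\<in>?P. ?d x y) = (\<Sum>x\<in>V. \<Sum>y\<in>walk_ball E R x. ?d x y)"
      by (rule sum.Sigma[symmetric]) (use V ball in auto)
    also have "real (N * N) * \<dots> \<le> real (N * N) * (K * ?D)"
      using energy by (intro mult_left_mono) (auto simp: K_def)
    finally show ?thesis .
  qed
  have step3: "(\<Sum>v\<in>V. \<Sum>w\<in>V. ?d (\<psi> (\<phi> v)) (\<psi> (\<phi> w))) \<le> real (N * N) * total_variance W (g \<circ> \<psi>)"
  proof -
    have "(\<Sum>v\<in>V. \<Sum>w\<in>V. ?d (\<psi> (\<phi> v)) (\<psi> (\<phi> w)))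
        = (\<Sum>a\<in>V \<times> V. (\<lambda>(x, y). ?d (\<psi> x) (\<psi> y)) (map_prod \<phi> \<phi> a))"
      by (simp add: sum.cartesian_product case_prod_unfold)
    also have "\<dots> \<le> real (N * N) * (\<Sum>(x, y)\<in>W \<times> W. ?d (\<psi> x) (\<psi> y))"
    proof (rule sum_fibres_le)
      show "card {a \<in> V \<times> V. map_prod \<phi> \<phi> a = b} \<le> N * N" if "b \<in> W \<times> W" for b
        by (rule card_pair_fibre[where P = V and Q = W]) (use V \<phi> that in auto)
    qed (use V W \<phi> in auto)
    finally show ?thesis by (simp add: total_variance_def sum.cartesian_product)
  qed
  have cW: "0 < card W" using False W by (simp add: card_gt_0_iff)
  have "card W \<le> N * card V"
  proof -
    have "(\<Sum>w\<in>W. (1::real)) \<le> real N * (\<Sum>v\<in>V. 1)"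
      by (rule sum_fibres_le[where h = \<psi>]) (use V W \<psi> in auto)
    then show ?thesis by (simp flip: of_nat_mult)
  qed
  then have cWV: "real (card W) \<le> real N * real (card V)" by (simp flip: of_nat_mult)
  have "total_variance W (g \<circ> \<psi>) \<le> card W / \<eta> * dirichlet_energy E' (g \<circ> \<psi>)"
    using poincare \<eta> cW by (simp add: field_simps)
  also have "\<dots> \<le> (real N * real (card V)) / \<eta> * (real (N * N) * (K * ?D))"
    using cWV step2 \<eta> by (intro mult_mono divide_right_mono) (auto simp: dirichlet_energy_nonneg)
  finally have "real (N * N) * total_variance W (g \<circ> \<psi>)
      \<le> real (N * N) * ((real N * real (card V)) / \<eta> * (real (N * N) * (K * ?D)))"
    by (intro mult_left_mono) auto
  with step3 have step4: "(\<Sum>v\<in>V. \<Sum>w\<in>V. ?d (\<psi> (\<phi> v)) (\<psi> (\<phi> w))) \<le> real N ^ 5 * K / \<eta> * card V * ?D"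
    by (simp add: eval_nat_numeral mult_ac)
  have "total_variance V g \<le> (\<Sum>v\<in>V. \<Sum>w\<in>V. 2 * ?d v (\<psi> (\<phi> v))
      + 4 * ?d (\<psi> (\<phi> v)) (\<psi> (\<phi> w)) + 4 * ?d w (\<psi> (\<phi> w)))"
    unfolding total_variance_def
  proof (intro sum_mono)
    fix v w
    show "?d v w \<le> 2 * ?d v (\<psi> (\<phi> v)) + 4 * ?d (\<psi> (\<phi> v)) (\<psi> (\<phi> w)) + 4 * ?d w (\<psi> (\<phi> w))"
      using power2_norm_diff_le[of "g v" "g w" "g (\<psi> (\<phi> v))"]
        power2_norm_diff_le[of "g (\<psi> (\<phi> v))" "g w" "g (\<psi> (\<phi> w))"]
      by (simp add: norm_minus_commute)
  qed
  also have "\<dots> = card V * (2 * (\<Sum>v\<in>V. ?d v (\<psi> (\<phi> v)))) + 4 * (\<Sum>v\<in>V. \<Sum>w\<in>V. ?d (\<psi> (\<phi> v)) (\<psi> (\<phi> w)))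
      + card V * (4 * (\<Sum>v\<in>V. ?d v (\<psi> (\<phi> v))))"
    by (simp add: sum.distrib sum_distrib_left sum_distrib_right mult_ac)
  also have "\<dots> \<le> card V * (2 * (K * ?D)) + 4 * (real N ^ 5 * K / \<eta> * card V * ?D)
      + card V * (4 * (K * ?D))"
    using step1 step4 by (intro add_mono mult_left_mono) auto
  also have "\<dots> \<le> (8 * K + 4 * real N ^ 5 * K / \<eta>) * card V * ?D"
  proof -
    have "0 \<le> K * card V * ?D" using D by (simp add: K_def)
    then show ?thesis by (simp add: algebra_simps)
  qed
  finally show ?thesis .
qed

section \<open>Shortest paths as relational powers\<close>

lemma graph_metric_simps:
  assumes "pair_graph G" "Digraph_Component.connected (with_proj G)"
  shows "mspace (graph_metric G) = pverts G"
    and "mdist (graph_metric G) u v = real_of_ereal (wf_digraph.\<mu> (with_proj G) (\<lambda>_. 1) u v)"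
  unfolding graph_metric_def
  using Metric_space_graph_dist[OF assms]
  by (simp_all add: Metric_space.mspace_metric Metric_space.mdist_metric)

lemma (in pair_wf_digraph) awalk_imp_relpow:
  "awalk u p v \<Longrightarrow> (u, v) \<in> parcs G ^^ length p"
proof (induction p arbitrary: u)
  case Nil
  then show ?case by (simp add: awalk_Nil_iff)
next
  case (Cons e p)
  then have "(u, snd e) \<in> parcs G" "(snd e, v) \<in> parcs G ^^ length p"
    by (auto simp: awalk_Cons_iff)
  then show ?case using relpow_Suc_I2 by fastforce
qed

lemma (in pair_wf_digraph) relpow_imp_awalk:
  "(u, v) \<in> parcs G ^^ k \<Longrightarrow> u \<in> pverts G \<Longrightarrow> \<exists>p. awalk u p v \<and> length p = k"
proof (induction k arbitrary: u)
  case 0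
  then show ?case by (auto simp: awalk_Nil_iff)
next
  case (Suc k)
  obtain w where w: "(u, w) \<in> parcs G" "(w, v) \<in> parcs G ^^ k"
    using Suc.prems(1) by (meson relpow_Suc_D2)
  with Suc.IH[of w] in_arcsD2 obtain p where "awalk w p v" "length p = k" by blast
  then have "awalk u ((u, w) # p) v" using w in_arcsD1 by (auto simp: awalk_Cons_iff)
  then show ?case using \<open>length p = k\<close> by (intro exI[of _ "(u, w) # p"]) auto
qed

text \<open>Connectedness ensures that a shortest walk exists, so that the infimum defining the distance is
  attained by a natural number.\<close>

lemma graph_dist_walk:
  assumes G: "pair_graph G" "Digraph_Component.connected (with_proj G)"
    and uv: "u \<in> pverts G" "v \<in> pverts G"
  shows "\<exists>k. (u, v) \<in> parcs G ^^ k \<and> mdist (graph_metric G) u v = real k"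
    and "(u, v) \<in> parcs G ^^ k \<Longrightarrow> mdist (graph_metric G) u v \<le> real k"
proof -
  interpret pair_graph G by fact
  have cost: "awalk_cost (\<lambda>_. 1) p = real (length p)" for p :: "('a \<times> 'a) list"
    by (induction p) auto
  have "u \<rightarrow>\<^sup>*\<^bsub>with_proj (mk_symmetric (with_proj G))\<^esub> v"
    using G(2) uv by (auto simp: Digraph_Component.connected_def strongly_connected_def)
  then have "u \<rightarrow>\<^sup>*\<^bsub>with_proj G\<^esub> v"
    by (simp only: reachable_mk_symmetric_eq[OF pair_sym_arcs])
  from no_neg_cyc_reach_imp_path[OF this, of "\<lambda>_. 1"]
  obtain p where p: "awalk u p v" "\<mu> (\<lambda>_. 1) u v = ereal (length p)"
    by (auto simp: cost apath_def)
  then show "\<exists>k. (u, v) \<in> parcs G ^^ k \<and> mdist (graph_metric G) u v = real k"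
    using awalk_imp_relpow[OF p(1)] by (auto simp: graph_metric_simps[OF G])
  assume "(u, v) \<in> parcs G ^^ k"
  then obtain q where "awalk u q v" "length q = k"
    using relpow_imp_awalk uv by blast
  then have "\<mu> (\<lambda>_. 1) u v \<le> ereal k"
    using min_cost_le_walk_cost[of u q v "\<lambda>_. 1"] by (simp add: cost)
  then show "mdist (graph_metric G) u v \<le> real k"
    using p(2) by (simp add: graph_metric_simps[OF G])
qed

lemma walk_ball_of_mdist:
  assumes "pair_graph H" "Digraph_Component.connected (with_proj H)"
    and "u \<in> pverts H" "v \<in> pverts H" "mdist (graph_metric H) u v \<le> b"
  shows "v \<in> walk_ball (parcs H) (nat \<lceil>b\<rceil>) u"
proof -
  obtain k where k: "(u, v) \<in> parcs H ^^ k" "mdist (graph_metric H) u v = real k"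
    using graph_dist_walk(1)[OF assms(1-4)] by auto
  then have "k \<le> nat \<lceil>b\<rceil>" using assms(5) by linarith
  with k(1) show ?thesis by (rule walk_ball_relpow)
qed

lemma connectedI_relpow:
  assumes "pair_graph G" "pverts G \<noteq> {}"
    and "\<And>u v. u \<in> pverts G \<Longrightarrow> v \<in> pverts G \<Longrightarrow> \<exists>k. (u, v) \<in> parcs G ^^ k"
  shows "Digraph_Component.connected (with_proj G)"
proof -
  interpret pair_graph G by fact
  have "u \<rightarrow>\<^sup>*\<^bsub>with_proj G\<^esub> v" if "u \<in> pverts G" "v \<in> pverts G" for u v
    using assms(3)[OF that] relpow_imp_awalk that(1) by (metis reachable_awalk)
  then show ?thesis
    using assms(2) unfolding Digraph_Component.connected_def strongly_connected_def
    by (auto simp: reachable_mk_symmetric_eq[OF pair_sym_arcs])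
qed

lemma out_degree_with_proj:
  "out_degree (with_proj G) v = card (parcs G `` {v})"
proof -
  have "out_arcs (with_proj G) v = Pair v ` (parcs G `` {v})"
    by (auto simp: out_arcs_def)
  then show ?thesis by (simp add: out_degree_def card_image inj_on_def)
qed

lemma expander_wrt_altdef:
  "expander_wrt TYPE('x::banach) I G \<longleftrightarrow>
     (\<forall>i\<in>I. pair_graph (G i)) \<and>
     (\<exists>k. \<forall>i\<in>I. \<forall>v\<in>pverts (G i). card (parcs (G i) `` {v}) \<le> k) \<and>
     (\<forall>N. \<exists>i\<in>I. card (pverts (G i)) > N) \<and>
     (\<exists>\<eta>::real. \<eta> > 0 \<and>
        (\<forall>i\<in>I. \<forall>f :: 'v \<Rightarrow> 'x.
           \<eta> / card (pverts (G i)) * total_variance (pverts (G i)) f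
             \<le> dirichlet_energy (parcs (G i)) f))"
  by (simp add: expander_wrt_def out_degree_with_proj total_variance_def dirichlet_energy_def)

section \<open>Finite nets and nearest points\<close>

text \<open>The points are enumerated because their indices serve as vertices of graphs on \<^typ>\<open>nat\<close>.\<close>

definition separated_net :: "'y::metric_space set \<Rightarrow> real \<Rightarrow> (nat \<Rightarrow> 'y) \<Rightarrow> nat \<Rightarrow> bool" where
  "separated_net K r z n \<longleftrightarrow>
     (\<forall>i<n. z i \<in> K) \<and>
     (\<forall>i<n. \<forall>j<n. i \<noteq> j \<longrightarrow> r \<le> dist (z i) (z j)) \<and>
     (\<forall>y\<in>K. \<exists>i<n. dist y (z i) < r)"

text \<open>A separated set of largest cardinality cannot be enlarged, so it is a net. The cardinalities
  are bounded because a ball of radius \<open>r/2\<close> contains at most one of the points.\<close>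

lemma separated_net_exists:
  fixes K :: "'y::metric_space set"
  assumes K: "compact K" and r: "0 < r"
  shows "\<exists>z n. separated_net K r z n"
proof -
  define sep where "sep T \<longleftrightarrow> T \<subseteq> K \<and> (\<forall>x\<in>T. \<forall>y\<in>T. x \<noteq> y \<longrightarrow> r \<le> dist x y)" for T
  obtain F where F: "finite F" "K \<subseteq> (\<Union>x\<in>F. ball x (r/2))"
    using K r unfolding compact_eq_totally_bounded by (meson half_gt_zero)
  have bound: "finite T \<and> card T \<le> card F" if T: "sep T" for T
  proof -
    have "\<exists>c\<in>F. dist c x < r/2" if "x \<in> T" for x
    proof -
      have "x \<in> (\<Union>c\<in>F. ball c (r/2))" using F(2) T that unfolding sep_def by blast
      then show ?thesis by simp
    qed
    then obtain c where c: "\<And>x. x \<in> T \<Longrightarrow> c x \<in> F \<and> dist (c x) x < r/2" by metis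
    have "inj_on c T"
    proof (rule inj_onI, rule ccontr)
      fix x y assume xy: "x \<in> T" "y \<in> T" "c x = c y" "x \<noteq> y"
      then have "dist x y < r/2 + r/2"
        using c[of x] c[of y] dist_triangle3[of x y "c x"] by simp
      then show False using T xy by (force simp: sep_def)
    qed
    moreover have "c ` T \<subseteq> F" using c by auto
    ultimately show ?thesis
      using F(1) by (meson card_inj_on_le inj_on_finite)
  qed
  have "sep {}" by (simp add: sep_def)
  then obtain T where T: "sep T" and max: "\<And>T'. sep T' \<Longrightarrow> card T' \<le> card T"
    using ex_has_greatest_nat[of sep "{}" card "Suc (card F)"] bound by (auto simp: less_Suc_eq_le)
  have cover: "\<exists>x\<in>T. dist y x < r" if y: "y \<in> K" for y
  proof (rule ccontr)
    assume no: "\<not> (\<exists>x\<in>T. dist y x < r)"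
    then have "y \<notin> T" using r by force
    moreover have "sep (insert y T)"
      using T no y by (auto simp: sep_def dist_commute not_less)
    ultimately show False
      using max[of "insert y T"] bound[OF T] by simp
  qed
  obtain z where z: "bij_betw z {0..<card T} T"
    using bound[OF T] ex_bij_betw_nat_finite by blast
  then have zT: "z i \<in> T" if "i < card T" for i
    using that by (auto simp: bij_betw_def)
  have "separated_net K r z (card T)"
    unfolding separated_net_def
  proof (intro conjI allI impI ballI)
    fix i assume "i < card T" then show "z i \<in> K" using zT T by (auto simp: sep_def)
  next
    fix i j assume "i < card T" "j < card T" "i \<noteq> j"
    then have "z i \<noteq> z j" using z by (auto simp: bij_betw_def dest: inj_onD)
    then show "r \<le> dist (z i) (z j)" using zT T \<open>i < card T\<close> \<open>j < card T\<close> by (auto simp: sep_def)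
  next
    fix y assume "y \<in> K"
    then show "\<exists>i<card T. dist y (z i) < r"
      using cover z by (metis atLeastLessThan_iff bij_betw_iff_bijections)
  qed
  then show ?thesis by blast
qed

lemma separated_balls_disjoint:
  assumes "separated_net K r z n"
  shows "disjoint_family_on (\<lambda>i. ball (z i) (r/2)) {..<n}"
  unfolding disjoint_family_on_def
proof (intro ballI impI, rule ccontr)
  fix i j assume ij: "i \<in> {..<n}" "j \<in> {..<n}" "i \<noteq> j"
    and "ball (z i) (r/2) \<inter> ball (z j) (r/2) \<noteq> {}"
  then obtain y where y: "dist (z i) y < r/2" "dist (z j) y < r/2" by auto
  have "dist (z i) (z j) < r" using y dist_triangle2[of "z i" "z j" y] by simp
  moreover have "r \<le> dist (z i) (z j)" using assms ij unfolding separated_net_def by blast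
  ultimately show False by simp
qed

text \<open>Ties are broken by the least index, which keeps the fibres Borel sets.\<close>

definition nearest :: "(nat \<Rightarrow> 'y::metric_space) \<Rightarrow> nat \<Rightarrow> 'y \<Rightarrow> nat" where
  "nearest z n y = (LEAST i. i < n \<and> (\<forall>j<n. dist y (z i) \<le> dist y (z j)))"

lemma nearest_properties:
  fixes z :: "nat \<Rightarrow> 'y::metric_space"
  assumes "separated_net UNIV r z n"
  shows "nearest z n y < n"
    and "dist y (z (nearest z n y)) < r"
    and "i < n \<Longrightarrow> dist y (z i) < r/2 \<Longrightarrow> nearest z n y = i"
proof -
  obtain k where k: "k < n" "dist y (z k) < r"
    using assms unfolding separated_net_def by blast
  then have "\<exists>i\<in>{..<n}. \<forall>j\<in>{..<n}. dist y (z i) \<le> dist y (z j)"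
    using ex_is_arg_min_if_finite[of "{..<n}" "\<lambda>i. dist y (z i)"]
    by (auto simp: is_arg_min_linorder)
  then have ex: "\<exists>i. i < n \<and> (\<forall>j<n. dist y (z i) \<le> dist y (z j))" by auto
  from LeastI_ex[OF this, folded nearest_def]
  have near: "nearest z n y < n" "\<And>j. j < n \<Longrightarrow> dist y (z (nearest z n y)) \<le> dist y (z j)"
    by auto
  show "nearest z n y < n" by (rule near)
  show "dist y (z (nearest z n y)) < r" using near(2)[OF k(1)] k(2) by simp
  assume i: "i < n" "dist y (z i) < r/2"
  show "nearest z n y = i"
  proof (rule ccontr)
    assume "nearest z n y \<noteq> i"
    then have "r \<le> dist (z (nearest z n y)) (z i)"
      using assms near(1) i(1) by (auto simp: separated_net_def)
    also have "\<dots> \<le> dist y (z (nearest z n y)) + dist y (z i)"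
      by (rule dist_triangle3)
    also have "\<dots> < r" using near(2)[OF i(1)] i(2) by simp
    finally show False by simp
  qed
qed

lemma nearest_measurable:
  fixes z :: "nat \<Rightarrow> 'y::metric_space"
  assumes "sets M = sets borel" "separated_net UNIV r z n"
  shows "nearest z n \<in> measurable M (count_space UNIV)"
proof -
  have "{y. dist y (z i) \<le> dist y (z j)} \<in> sets borel" for i j
    by (intro borel_closed closed_Collect_le continuous_intros)
  then have [measurable]: "Measurable.pred borel (\<lambda>y. dist y (z i) \<le> dist y (z j))" for i j
    by (simp add: pred_def)
  have "nearest z n \<in> measurable borel (count_space UNIV)"
    unfolding nearest_def[abs_def] by measurable
  then show ?thesis using assms(1) by (simp cong: measurable_cong_sets)
qed

section \<open>The warped metric\<close>

lemma geodesic_chain: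
  fixes x y :: "'y::metric_space"
  assumes geod: "geodesic_set (UNIV :: 'y set)" and r: "0 < r"
  shows "\<exists>N. real N \<le> dist x y / r + 1 \<and> (x, y) \<in> {(u, v). dist u v \<le> r} ^^ N"
proof -
  define N where "N = nat \<lceil>dist x y / r\<rceil>"
  obtain \<gamma> where \<gamma>: "\<gamma> 0 = x" "\<gamma> (dist x y) = y"
    "\<And>a b. a \<in> {0..dist x y} \<Longrightarrow> b \<in> {0..dist x y} \<Longrightarrow> dist (\<gamma> a) (\<gamma> b) = \<bar>a - b\<bar>"
    using geod unfolding geodesic_set_def by (metis UNIV_I)
  define p where "p k = \<gamma> (min (real k * r) (dist x y))" for k
  have "(x, p k) \<in> {(u, v). dist u v \<le> r} ^^ k" for k
  proof (induction k)
    case 0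
    then show ?case using \<gamma>(1) by (simp add: p_def)
  next
    case (Suc k)
    have "dist (p k) (p (Suc k)) = \<bar>min (real k * r) (dist x y) - min (real (Suc k) * r) (dist x y)\<bar>"
      unfolding p_def using r by (intro \<gamma>(3)) auto
    also have "\<dots> \<le> r" using r by (simp add: algebra_simps min_def)
    finally show ?case using Suc by auto
  qed
  moreover have "p N = y"
  proof -
    have "dist x y / r \<le> real N" unfolding N_def by (rule real_nat_ceiling_ge)
    then have "dist x y \<le> real N * r" using r by (simp add: field_simps)
    then show ?thesis using \<gamma>(2) by (simp add: p_def min_def)
  qed
  ultimately have "(x, y) \<in> {(u, v). dist u v \<le> r} ^^ N" by metis
  moreover have "real N \<le> dist x y / r + 1" using r by (simp add: N_def of_nat_ceiling)
  ultimately show ?thesis by blast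
qed

lemma warped_dist_metric:
  assumes "t > 0"
  shows "Metric_space UNIV (warped_dist S t)"
    and "warped_dist S t x y \<le> t * dist x y"
    and "s \<in> S \<Longrightarrow> s y = Some y' \<Longrightarrow> warped_dist S t y y' \<le> 1"
  using warped_dist_greatest(1)[OF assms, of S] by (force simp: warped_admissible_def dom_def)+

lemma warped_cone_simps:
  assumes "t > 0"
  shows "mspace (warped_cone S t) = UNIV" "mdist (warped_cone S t) = warped_dist S t"
  unfolding warped_cone_def using warped_dist_metric(1)[OF assms, of S]
  by (simp_all add: Metric_space.mspace_metric Metric_space.mdist_metric)

text \<open>The function \<open>\<bar>h x - h y\<bar>\<close> is admissible except that it may vanish for \<open>x \<noteq> y\<close>; its maximum with a
  truncation of \<open>t * dist x y\<close> is a metric that is still admissible.\<close>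

lemma test_function_le_warped_dist:
  fixes h :: "'y::metric_space \<Rightarrow> real" and S :: "('y \<rightharpoonup> 'y) set"
  assumes t: "t > 0"
    and lip: "\<And>x y. \<bar>h x - h y\<bar> \<le> t * dist x y"
    and jump: "\<And>s y y'. s \<in> S \<Longrightarrow> s y = Some y' \<Longrightarrow> \<bar>h y - h y'\<bar> \<le> 1"
  shows "\<bar>h x - h y\<bar> \<le> warped_dist S t x y"
proof -
  define \<rho> where "\<rho> x y = max \<bar>h x - h y\<bar> (min (t * dist x y) 1)" for x y
  have "Metric_space UNIV \<rho>"
  proof
    fix x y z
    show "0 \<le> \<rho> x y" "\<rho> x y = \<rho> y x" by (auto simp: \<rho>_def dist_commute abs_minus_commute)
    show "\<rho> x y = 0 \<longleftrightarrow> x = y"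
    proof
      assume "\<rho> x y = 0"
      then have "min (t * dist x y) 1 \<le> 0" by (simp add: \<rho>_def)
      then show "x = y" using t by (auto simp: min_def mult_le_0_iff split: if_splits)
    qed (simp add: \<rho>_def)
    have "t * dist x z \<le> t * dist x y + t * dist y z"
      using t dist_triangle[of x z y] by (simp flip: distrib_left)
    moreover have "0 \<le> t * dist x y" "0 \<le> t * dist y z" using t by auto
    ultimately show "\<rho> x z \<le> \<rho> x y + \<rho> y z" unfolding \<rho>_def by linarith
  qed
  then have "warped_admissible S t \<rho>"
    using lip jump by (auto simp: warped_admissible_def \<rho>_def)
  then have "\<rho> x y \<le> warped_dist S t x y"
    using warped_dist_greatest(2)[OF t, of S \<rho>] by (simp add: le_fun_def)
  then show ?thesis by (simp add: \<rho>_def)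
qed

text \<open>The metric \<open>e\<close> need not be small when \<open>dist x y\<close> is small, so it is not admissible itself. For fixed \<open>x\<close>
  the infimal convolution \<open>h\<close> of \<open>e x\<close> with \<open>t * dist\<close> is Lipschitz and stays within \<open>1\<close> of \<open>e x\<close>.
  Therefore it jumps by at most \<open>2\<close> along the maps in \<open>S\<close>, and \<open>h / 2\<close> is a test function.\<close>

lemma coarse_metric_le_warped_dist:
  fixes e :: "'y::metric_space \<Rightarrow> 'y \<Rightarrow> real" and S :: "('y \<rightharpoonup> 'y) set"
  assumes t: "t > 0"
    and nonneg: "\<And>x y. 0 \<le> e x y" and refl: "\<And>x. e x x = 0"
    and tri: "\<And>x y z. e x z \<le> e x y + e y z"
    and scale: "\<And>x y. e x y \<le> t * dist x y + 1"
    and jump: "\<And>s y y'. s \<in> S \<Longrightarrow> s y = Some y' \<Longrightarrow> e y y' \<le> 1 \<and> e y' y \<le> 1"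
  shows "e x y \<le> 2 * warped_dist S t x y + 1"
proof -
  define h where "h y = (INF u. e x u + t * dist y u)" for y
  have bdd: "bdd_below (range (\<lambda>u. e x u + t * dist y u))" for y
    using nonneg t by (intro bdd_belowI[of _ 0]) auto
  have upper: "h y \<le> e x u + t * dist y u" for y u
    unfolding h_def using bdd by (rule cINF_lower) simp
  have lower: "b \<le> h y" if "\<And>u. b \<le> e x u + t * dist y u" for b y
    unfolding h_def using that by (intro cINF_greatest) auto
  have h_le: "h y \<le> e x y" for y using upper[of y y] by simp
  have h_ge: "e x y - 1 \<le> h y" for y
  proof (rule lower)
    fix u show "e x y - 1 \<le> e x u + t * dist y u"
      using tri[of x y u] scale[of u y] by (simp add: dist_commute)
  qed
  have lip: "h y - h y' \<le> t * dist y y'" for y y'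
  proof -
    have "h y - t * dist y y' \<le> h y'"
    proof (rule lower)
      fix u
      have "t * dist y u \<le> t * dist y y' + t * dist y' u"
        using t dist_triangle[of y u y'] by (simp flip: distrib_left)
      then show "h y - t * dist y y' \<le> e x u + t * dist y' u" using upper[of y u] by simp
    qed
    then show ?thesis by simp
  qed
  have "\<bar>h x / 2 - h y / 2\<bar> \<le> warped_dist S t x y"
  proof (rule test_function_le_warped_dist[OF t])
    fix y y' :: 'y
    have "0 \<le> t * dist y y'" using t by simp
    then show "\<bar>h y / 2 - h y' / 2\<bar> \<le> t * dist y y'"
      using lip[of y y'] lip[of y' y] unfolding dist_commute[of y' y] by linarith
  next
    fix s y y' assume "s \<in> S" "s y = Some y'"
    then have "e y y' \<le> 1" "e y' y \<le> 1" using jump by auto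
    then show "\<bar>h y / 2 - h y' / 2\<bar> \<le> 1"
      using h_le[of y] h_ge[of y] h_le[of y'] h_ge[of y'] tri[of x y y'] tri[of x y' y] by linarith
  qed
  moreover have "h x \<le> 0" using h_le[of x] refl by simp
  ultimately show ?thesis using h_ge[of y] by linarith
qed

section \<open>Ahlfors regular measures and Lipschitz maps\<close>

lemma closed_neighbourhood_measure:
  fixes M :: "'y::metric_space measure"
  assumes M: "finite_measure M" "sets M = sets borel" and F: "closed F" and \<epsilon>: "0 < \<epsilon>"
  shows "\<exists>\<delta>>0. measure M ((\<Union>x\<in>F. ball x \<delta>) - F) < \<epsilon>"
proof -
  interpret finite_measure M by (rule M)
  define A where "A k = (\<Union>x\<in>F. ball x (1 / Suc k)) - F" for k
  have "A k \<in> sets borel" for k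
    unfolding A_def using F by (intro sets.Diff borel_open borel_closed open_UN) auto
  then have "range A \<subseteq> sets M" using M(2) by auto
  moreover have "decseq A"
  proof (rule decseq_SucI)
    fix k
    have "1 / real (Suc (Suc k)) \<le> 1 / real (Suc k)" by (intro divide_left_mono) auto
    then have "ball x (1 / real (Suc (Suc k))) \<subseteq> ball x (1 / real (Suc k))" for x :: 'y
      by (rule subset_ball)
    then show "A (Suc k) \<subseteq> A k" unfolding A_def by blast
  qed
  ultimately have "(\<lambda>k. measure M (A k)) \<longlonglongrightarrow> measure M (\<Inter>k. A k)"
    by (rule finite_Lim_measure_decseq)
  moreover have "(\<Inter>k. A k) = {}"
  proof (rule ccontr)
    assume "(\<Inter>k. A k) \<noteq> {}"
    then obtain y where y: "\<And>k. y \<in> A k" by auto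
    have "y \<in> closure F"
      unfolding closure_approachable
    proof (intro allI impI)
      fix e :: real assume "0 < e"
      then obtain k where "1 / Suc k < e" by (metis nat_approx_posE)
      then show "\<exists>x\<in>F. dist x y < e" using y[of k] by (force simp: A_def)
    qed
    then show False using F y[of 0] by (simp add: A_def)
  qed
  ultimately have "eventually (\<lambda>k. measure M (A k) < \<epsilon>) sequentially"
    using \<epsilon> by (intro order_tendstoD) auto
  then obtain k where "measure M (A k) < \<epsilon>" by (auto simp: eventually_sequentially)
  then show ?thesis unfolding A_def by (intro exI[of _ "1 / Suc k"]) auto
qed

text \<open>The sets with this property form a \<open>\<sigma>\<close>-algebra. It contains the open sets because the neighbourhoods
  of the closed complement shrink to this complement.\<close>

lemma borel_sandwich:
  fixes M :: "'y::metric_space measure"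
  assumes M: "finite_measure M" "sets M = sets borel" and A: "A \<in> sets borel" and \<epsilon>: "0 < \<epsilon>"
  shows "\<exists>K U. closed K \<and> open U \<and> K \<subseteq> A \<and> A \<subseteq> U \<and> measure M (U - K) < \<epsilon>"
proof -
  interpret finite_measure M by (rule M)
  have "A \<in> sigma_sets UNIV {S. open S}"
    using A by (simp add: borel_def)
  then show ?thesis
    using \<epsilon>
  proof (induction arbitrary: \<epsilon>)
    case (Basic A)
    then have "closed (- A)" by auto
    from closed_neighbourhood_measure[OF M this Basic.prems]
    obtain \<delta> where "\<delta> > 0" and \<delta>: "measure M ((\<Union>x\<in>-A. ball x \<delta>) - (- A)) < \<epsilon>" by auto
    let ?N = "\<Union>x\<in>-A. ball x \<delta>"
    have "- A \<subseteq> ?N" using \<open>\<delta> > 0\<close> by auto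
    moreover have "A - - ?N = ?N - - A" by auto
    moreover have "closed (- ?N)" by (auto intro!: open_UN)
    ultimately show ?case
      using Basic \<delta> by (intro exI[of _ "- ?N"] exI[of _ A]) auto
  next
    case Empty
    then show ?case by (intro exI[of _ "{}"]) auto
  next
    case (Compl A)
    from Compl.IH[OF Compl.prems] obtain K U where KU:
      "closed K" "open U" "K \<subseteq> A" "A \<subseteq> U" "measure M (U - K) < \<epsilon>" by auto
    moreover have "- K - - U = U - K" by auto
    ultimately show ?case by (intro exI[of _ "- U"] exI[of _ "- K"]) auto
  next
    case (Union A)
    have "\<exists>K U. closed K \<and> open U \<and> K \<subseteq> A i \<and> A i \<subseteq> U \<and> measure M (U - K) < \<epsilon> / 4 * (1/2) ^ i" for i
      by (rule Union.IH) (use Union.prems in auto)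
    then obtain K U where KU: "\<And>i. closed (K i)" "\<And>i. open (U i)" "\<And>i. K i \<subseteq> A i" "\<And>i. A i \<subseteq> U i"
      "\<And>i. measure M (U i - K i) < \<epsilon> / 4 * (1/2) ^ i"
      by metis
    have [measurable]: "K i \<in> sets M" "U i \<in> sets M" for i
      using KU(1,2) M(2) by auto
    let ?U = "\<Union>i. U i"
    define B where "B n = ?U - (\<Union>i<n. K i)" for n
    have sum: "(\<lambda>i. \<epsilon> / 4 * (1/2) ^ i) sums (\<epsilon> / 4 * (1 / (1 - 1/2)))"
      by (intro sums_mult geometric_sums) auto
    have smb: "summable (\<lambda>i. measure M (U i - K i))"
      by (rule summable_comparison_test_ev[OF _ sums_summable[OF sum]])
        (use KU(5) in \<open>auto intro!: always_eventually less_imp_le\<close>)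
    have "(\<Inter>n. B n) \<subseteq> (\<Union>i. U i - K i)" unfolding B_def by auto
    then have "measure M (\<Inter>n. B n) \<le> measure M (\<Union>i. U i - K i)"
      by (intro finite_measure_mono) auto
    also have "\<dots> \<le> (\<Sum>i. measure M (U i - K i))"
      using smb by (intro finite_measure_subadditive_countably) auto
    also have "\<dots> \<le> (\<Sum>i. \<epsilon> / 4 * (1/2) ^ i)"
      by (intro suminf_le smb sums_summable[OF sum] less_imp_le KU(5))
    also have "\<dots> < \<epsilon>" using sums_unique[OF sum] Union.prems by simp
    finally have lt: "measure M (\<Inter>n. B n) < \<epsilon>" .
    have "range B \<subseteq> sets M" unfolding B_def by auto
    moreover have "decseq B" unfolding B_def by (intro decseq_SucI) auto
    ultimately have "(\<lambda>n. measure M (B n)) \<longlonglongrightarrow> measure M (\<Inter>n. B n)"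
      by (rule finite_Lim_measure_decseq)
    then have "eventually (\<lambda>n. measure M (B n) < \<epsilon>) sequentially"
      using lt by (rule order_tendstoD)
    then obtain n where n: "measure M (B n) < \<epsilon>" by (auto simp: eventually_sequentially)
    have "closed (\<Union>i<n. K i)" "open ?U" using KU(1,2) by (auto intro!: closed_UN)
    moreover have "(\<Union>i<n. K i) \<subseteq> (\<Union>i. A i)" "(\<Union>i. A i) \<subseteq> ?U" using KU(3,4) by blast+
    ultimately show ?case using n unfolding B_def by blast
  qed
qed

text \<open>The upper bound is stated for all radii: a ball whose radius exceeds the diameter is the whole space, for which the bound holds already.\<close>

locale ahlfors_space = prob_space M for M :: "'y::metric_space measure" +
  fixes c m C :: real
  assumes compact_space: "compact (UNIV :: 'y set)"
    and nontrivial: "\<exists>x y :: 'y. x \<noteq> y"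
    and sets_M [measurable_cong]: "sets M = sets borel"
    and constants: "0 < c" "0 < m" "1 \<le> C"
    and ball_lower: "0 < r \<Longrightarrow> r \<le> 2 * diameter (UNIV :: 'y set) \<Longrightarrow> c * r powr m \<le> measure M (ball y r)"
    and ball_upper: "0 < r \<Longrightarrow> measure M (ball y r) \<le> C * c * r powr m"
begin

lemma space_M [simp]: "space M = UNIV"
  using sets_M by (metis sets_eq_imp_space_eq space_borel)

lemma closed_imp_compact: "closed (K :: 'y set) \<Longrightarrow> compact K"
  using compact_Int_closed[OF compact_space, of K] by simp

lemma dist_le_diameter: "dist (x :: 'y) y \<le> diameter (UNIV :: 'y set)"
  by (intro diameter_bounded_bound compact_imp_bounded compact_space) auto

lemma diameter_pos: "0 < diameter (UNIV :: 'y set)"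
proof -
  obtain x y :: 'y where "x \<noteq> y" using nontrivial by auto
  then have "0 < dist x y" by simp
  then show ?thesis using dist_le_diameter[of x y] by linarith
qed

text \<open>For a fine net of \<open>K\<close>, the balls of radius \<open>r/2\<close> at its points are disjoint and lie in an open set that is
  hardly larger than \<open>K\<close>. The image of \<open>K\<close> is covered by as many balls of radius \<open>L * r\<close>, and regularity compares the
  measures of the two kinds of balls.\<close>

lemma measure_lipschitz_image_compact:
  assumes K: "compact K" and g: "L-lipschitz_on K g" and L: "0 < L"
  shows "measure M (g ` K) \<le> C * (2 * L) powr m * measure M K"
proof (rule field_le_epsilon)
  fix e :: real assume e: "0 < e"
  let ?A = "C * (2 * L) powr m"
  have A: "0 < ?A" using constants L by simp
  have K_sets: "K \<in> sets borel" using K by (intro borel_closed compact_imp_closed)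
  have fin: "finite_measure M" by (rule finite_measure_axioms)
  obtain K0 U where U: "K0 \<subseteq> K" "closed K0" "open U" "K \<subseteq> U" "measure M (U - K0) < e / ?A"
    using borel_sandwich[OF fin sets_M K_sets, of "e / ?A"] e A by auto
  have [measurable]: "K \<in> sets M" "U \<in> sets M" "K0 \<in> sets M" using U K_sets sets_M by auto
  have "measure M U \<le> measure M (K \<union> (U - K0))"
    using U by (intro finite_measure_mono) auto
  also have "\<dots> \<le> measure M K + measure M (U - K0)"
    by (intro measure_Un_le) auto
  finally have mU: "measure M U \<le> measure M K + e / ?A" using U(5) by simp
  obtain \<delta> where \<delta>: "0 < \<delta>" "(\<Union>x\<in>K. ball x \<delta>) \<subseteq> U"
    using compact_subset_open_imp_ball_epsilon_subset[OF K U(3,4)] by metis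
  define r where "r = min \<delta> (diameter (UNIV :: 'y set))"
  have r: "0 < r" "r \<le> \<delta>" "r \<le> diameter (UNIV :: 'y set)" using \<delta> diameter_pos by (auto simp: r_def)
  obtain z n where net: "separated_net K r z n" using separated_net_exists[OF K r(1)] by auto
  note disj = separated_balls_disjoint[OF net]
  have "n * (c * (r/2) powr m) \<le> (\<Sum>i<n. measure M (ball (z i) (r/2)))"
    using sum_mono[of "{..<n}" "\<lambda>i. c * (r/2) powr m" "\<lambda>i. measure M (ball (z i) (r/2))"]
      ball_lower[of "r/2"] r diameter_pos by simp
  also have "\<dots> = measure M (\<Union>i<n. ball (z i) (r/2))"
    by (rule finite_measure_finite_Union[symmetric]) (simp_all add: disj sets_M image_subset_iff)
  also have "\<dots> \<le> measure M U"
  proof (rule finite_measure_mono)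
    have "ball (z i) (r/2) \<subseteq> U" if "i < n" for i
    proof -
      have "z i \<in> K" using net that by (auto simp: separated_net_def)
      moreover have "ball (z i) (r/2) \<subseteq> ball (z i) \<delta>" using r by (intro subset_ball) auto
      ultimately show ?thesis using \<delta>(2) by blast
    qed
    then show "(\<Union>i<n. ball (z i) (r/2)) \<subseteq> U" by auto
  qed simp
  finally have lower: "n * (c * (r/2) powr m) \<le> measure M U" .
  have "g ` K \<subseteq> (\<Union>i<n. ball (g (z i)) (L * r))"
  proof
    fix u assume "u \<in> g ` K"
    then obtain y where y: "y \<in> K" "u = g y" by auto
    then obtain i where i: "i < n" "dist y (z i) < r" "z i \<in> K" using net unfolding separated_net_def by blast
    have "dist (g (z i)) (g y) \<le> L * dist (z i) y" using g y i by (auto simp: lipschitz_on_def)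
    also have "\<dots> < L * r" using i L by (simp add: dist_commute)
    finally show "u \<in> (\<Union>i<n. ball (g (z i)) (L * r))" using y i by auto
  qed
  then have "measure M (g ` K) \<le> measure M (\<Union>i<n. ball (g (z i)) (L * r))"
    by (intro finite_measure_mono) (auto simp: sets_M)
  also have "\<dots> \<le> (\<Sum>i<n. measure M (ball (g (z i)) (L * r)))"
    by (intro finite_measure_subadditive_finite) (auto simp: sets_M)
  also have "\<dots> \<le> n * (C * c * (L * r) powr m)"
    using sum_mono[of "{..<n}" "\<lambda>i. measure M (ball (g (z i)) (L * r))" "\<lambda>i. C * c * (L * r) powr m"]
      ball_upper[of "L * r"] r L by simp
  also have "\<dots> = ?A * (n * (c * (r/2) powr m))"
  proof -
    have "(L * r) powr m = (2 * L) powr m * (r/2) powr m"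
      using r L by (simp flip: powr_mult)
    then show ?thesis by simp
  qed
  also have "\<dots> \<le> ?A * (measure M K + e / ?A)"
    using lower mU A by (intro mult_left_mono) auto
  also have "\<dots> = ?A * measure M K + e"
    using less_imp_neq[OF A] by (subst distrib_left) (simp del: mult_eq_0_iff)
  finally show "measure M (g ` K) \<le> ?A * measure M K + e" .
qed

lemma partial_map_measurable:
  fixes f :: "'y \<Rightarrow> 'y"
  assumes "continuous_on A f"
  shows "f \<in> measurable (restrict_space M A) M"
proof -
  have "f \<in> borel_measurable (restrict_space borel A)"
    using assms by (rule borel_measurable_continuous_on_restrict)
  then show ?thesis
    using sets_M by (simp cong: measurable_cong_sets sets_restrict_space_cong)
qed

lemma sets_partial_vimage:
  assumes A: "closed A" and f: "continuous_on A f" and B: "B \<in> sets borel"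
  shows "{x \<in> A. f x \<in> B} \<in> sets borel"
proof -
  have "f \<in> borel_measurable (restrict_space borel A)"
    using f by (rule borel_measurable_continuous_on_restrict)
  from measurable_sets[OF this B] have "f -` B \<inter> A \<in> sets (restrict_space borel A)"
    by (simp add: space_restrict_space)
  then have "f -` B \<inter> A \<in> sets borel"
    using A by (subst (asm) sets_restrict_space_iff) auto
  moreover have "f -` B \<inter> A = {x \<in> A. f x \<in> B}" by auto
  ultimately show ?thesis by simp
qed

text \<open>Up to \<open>e\<close> the set on the left is a compact set \<open>K\<close>, and \<open>K\<close> is the image of the compact
  set \<open>f ` K \<subseteq> B\<close> under the Lipschitz map \<open>g\<close>.\<close>

lemma measure_partial_vimage_le:
  fixes f g :: "'y \<Rightarrow> 'y"
  assumes A: "closed A" and f: "continuous_on A f" and inv: "\<And>x. x \<in> A \<Longrightarrow> g (f x) = x"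
    and g: "L-lipschitz_on (f ` A) g" and L: "0 < L" and B: "B \<in> sets borel"
  shows "measure M {x \<in> A. f x \<in> B} \<le> C * (2 * L) powr m * measure M B"
proof (rule field_le_epsilon)
  fix e :: real assume e: "0 < e"
  let ?E = "{x \<in> A. f x \<in> B}"
  have E: "?E \<in> sets borel" by (rule sets_partial_vimage[OF A f B])
  have fin: "finite_measure M" by (rule finite_measure_axioms)
  obtain K U where K: "closed K" "open U" "K \<subseteq> ?E" "?E \<subseteq> U" "measure M (U - K) < e"
    using borel_sandwich[OF fin sets_M E e] by blast
  have [measurable]: "K \<in> sets M" "U \<in> sets M" using K sets_M by auto
  have "measure M ?E \<le> measure M (K \<union> (U - K))"
    using K by (intro finite_measure_mono) auto
  also have "\<dots> \<le> measure M K + measure M (U - K)"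
    by (intro measure_Un_le) auto
  finally have 1: "measure M ?E \<le> measure M K + e" using K(5) by simp
  have "compact (f ` K)"
    using K f by (intro compact_continuous_image closed_imp_compact) (auto intro: continuous_on_subset)
  moreover have "L-lipschitz_on (f ` K) g"
    by (rule lipschitz_on_subset[OF g]) (use K in auto)
  ultimately have "measure M (g ` f ` K) \<le> C * (2 * L) powr m * measure M (f ` K)"
    using L by (rule measure_lipschitz_image_compact)
  moreover have "g ` f ` K = K" using K inv by force
  moreover have "measure M (f ` K) \<le> measure M B"
    using K B sets_M by (intro finite_measure_mono) auto
  moreover have "0 \<le> C * (2 * L) powr m" using constants by simp
  ultimately have "measure M K \<le> C * (2 * L) powr m * measure M B"
    by (smt (verit) mult_left_mono)
  with 1 show "measure M ?E \<le> C * (2 * L) powr m * measure M B + e" by simp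
qed

lemma nn_integral_partial_vimage_le:
  fixes f g :: "'y \<Rightarrow> 'y" and h :: "'y \<Rightarrow> ennreal"
  assumes A: "closed A" and f: "continuous_on A f" and inv: "\<And>x. x \<in> A \<Longrightarrow> g (f x) = x"
    and g: "L-lipschitz_on (f ` A) g" and L: "0 < L" and h: "h \<in> borel_measurable M"
  shows "(\<integral>\<^sup>+x\<in>A. h (f x) \<partial>M) \<le> ennreal (C * (2 * L) powr m) * (\<integral>\<^sup>+x. h x \<partial>M)"
proof -
  let ?K = "C * (2 * L) powr m"
  have K: "0 \<le> ?K" using constants by simp
  have A_sets: "A \<in> sets M" using A sets_M by simp
  note f_meas = partial_map_measurable[OF f]
  let ?N = "distr (restrict_space M A) M f"
  have "(\<integral>\<^sup>+x\<in>A. h (f x) \<partial>M) = (\<integral>\<^sup>+x. h (f x) \<partial>restrict_space M A)"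
    using A_sets by (simp add: nn_integral_restrict_space)
  also have "\<dots> = (\<integral>\<^sup>+x. h x \<partial>?N)"
    using f_meas h by (simp add: nn_integral_distr)
  also have "\<dots> \<le> (\<integral>\<^sup>+x. h x \<partial>scale_measure (ennreal ?K) M)"
  proof (rule nn_integral_mono_measure)
    have "emeasure ?N \<le> emeasure (scale_measure (ennreal ?K) M)"
    proof (rule le_funI)
      fix B
      have "emeasure ?N B \<le> ennreal ?K * emeasure M B"
      proof (cases "B \<in> sets M")
        case True
        then have "emeasure ?N B = emeasure (restrict_space M A) (f -` B \<inter> A)"
          using f_meas by (simp add: emeasure_distr space_restrict_space)
        also have "\<dots> = emeasure M (f -` B \<inter> A)"
          using A_sets by (intro emeasure_restrict_space) auto
        also have "f -` B \<inter> A = {x \<in> A. f x \<in> B}" by auto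
        also have "emeasure M {x \<in> A. f x \<in> B} \<le> ennreal ?K * emeasure M B"
          using measure_partial_vimage_le[OF A f inv g L, of B] True K sets_M
          by (simp add: emeasure_eq_measure ennreal_mult[symmetric] del: times_divide_eq_left)
        finally show ?thesis .
      next
        case False
        then show ?thesis by (simp add: emeasure_notin_sets)
      qed
      then show "emeasure ?N B \<le> emeasure (scale_measure (ennreal ?K) M) B"
        by (simp only: emeasure_scale_measure)
    qed
    from less_eq_measure.intros(3)[OF _ _ this]
    show "?N \<le> scale_measure (ennreal ?K) M"
      by (simp only: space_distr space_scale_measure sets_distr sets_scale_measure)
  qed simp
  also have "\<dots> = ennreal ?K * (\<integral>\<^sup>+x. h x \<partial>M)"
    using h by (rule nn_integral_scale_measure)
  finally show ?thesis .
qed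

end

section \<open>Square-integrable vector-valued functions\<close>

lemma ennreal_le_add_mult:
  fixes x :: real
  assumes "x \<le> p * a + q * b" "0 \<le> p" "0 \<le> q" "0 \<le> a" "0 \<le> b"
  shows "ennreal x \<le> ennreal p * ennreal a + ennreal q * ennreal b"
  using assms by (simp add: ennreal_leI flip: ennreal_mult ennreal_plus)

lemma ennreal_mult_add:
  assumes "0 \<le> p" "0 \<le> q" "0 \<le> a" "0 \<le> b"
  shows "ennreal p * ennreal a + ennreal q * ennreal b = ennreal (p * a + q * b)"
  using assms by (simp add: ennreal_mult)

lemma nn_integral_add_cmult:
  assumes "f \<in> borel_measurable M" "g \<in> borel_measurable M"
  shows "(\<integral>\<^sup>+x. p * f x + q * g x \<partial>M) = p * (\<integral>\<^sup>+x. f x \<partial>M) + q * (\<integral>\<^sup>+x. g x \<partial>M)"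
  using assms by (simp add: nn_integral_add nn_integral_cmult)

text \<open>Bochner measurability with convergence everywhere. Without separability of the target, differences of Borel functions
  need not be Borel; limits of simple functions avoid this, and they can be
  composed with maps that are merely measurable.\<close>

definition strongly_measurable :: "'a measure \<Rightarrow> ('a \<Rightarrow> 'x::real_normed_vector) \<Rightarrow> bool" where
  "strongly_measurable M f \<longleftrightarrow>
     (\<exists>F. (\<forall>n::nat. simple_function M (F n)) \<and> (\<forall>x\<in>space M. (\<lambda>n. F n x) \<longlonglongrightarrow> f x))"

lemma strongly_measurable_simple: "simple_function M f \<Longrightarrow> strongly_measurable M f"
  unfolding strongly_measurable_def by (intro exI[of _ "\<lambda>_. f"]) auto

lemma strongly_measurable_diff:
  assumes "strongly_measurable M f" "strongly_measurable M g"
  shows "strongly_measurable M (\<lambda>x. f x - g x)"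
proof -
  obtain F G where "\<And>n. simple_function M (F n)" "\<And>n. simple_function M (G n)"
    "\<And>x. x \<in> space M \<Longrightarrow> (\<lambda>n. F n x) \<longlonglongrightarrow> f x" "\<And>x. x \<in> space M \<Longrightarrow> (\<lambda>n. G n x) \<longlonglongrightarrow> g x"
    using assms unfolding strongly_measurable_def by metis
  then show ?thesis
    unfolding strongly_measurable_def
    by (intro exI[of _ "\<lambda>n x. F n x - G n x"])
      (auto intro: tendsto_diff simple_function_compose2[where h = "(-)"])
qed

lemma strongly_measurable_norm:
  assumes "strongly_measurable M f"
  shows "(\<lambda>x. norm (f x)) \<in> borel_measurable M"
proof -
  obtain F where F: "\<And>n. simple_function M (F n)"
    "\<And>x. x \<in> space M \<Longrightarrow> (\<lambda>n. F n x) \<longlonglongrightarrow> f x"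
    using assms unfolding strongly_measurable_def by metis
  show ?thesis
  proof (rule borel_measurable_LIMSEQ_real)
    show "(\<lambda>x. norm (F n x)) \<in> borel_measurable M" for n
      using simple_function_compose1[OF F(1), of norm n] by (rule borel_measurable_simple_function)
    show "(\<lambda>n. norm (F n x)) \<longlonglongrightarrow> norm (f x)" if "x \<in> space M" for x
      using F(2)[OF that] by (rule tendsto_norm)
  qed
qed

lemma strongly_measurable_compose:
  assumes "strongly_measurable M f" "T \<in> measurable N M"
  shows "strongly_measurable N (\<lambda>x. f (T x))"
proof -
  obtain F where F: "\<And>n. simple_function M (F n)"
    "\<And>x. x \<in> space M \<Longrightarrow> (\<lambda>n. F n x) \<longlonglongrightarrow> f x"
    using assms(1) unfolding strongly_measurable_def by metis
  show ?thesis
    unfolding strongly_measurable_def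
    using F simple_function_comp[OF assms(2) F(1)] measurable_space[OF assms(2)]
    by (intro exI[of _ "\<lambda>n x. F n (T x)"]) auto
qed

lemma bochner_measurable_imp_strongly_measurable:
  fixes f :: "'a \<Rightarrow> 'x::banach"
  assumes "bochner_measurable M f"
  shows "\<exists>g. strongly_measurable M g \<and> (AE x in M. f x = g x)"
proof -
  obtain F where F: "\<And>n::nat. simple_function M (F n)"
    and lim: "AE x in M. (\<lambda>n. F n x) \<longlonglongrightarrow> f x"
    using assms unfolding bochner_measurable_def by auto
  obtain N where N: "{x \<in> space M. \<not> (\<lambda>n. F n x) \<longlonglongrightarrow> f x} \<subseteq> N" "emeasure M N = 0" "N \<in> sets M"
    using lim by (rule AE_E)
  have "strongly_measurable M (\<lambda>x. if x \<in> N then 0 else f x)"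
    unfolding strongly_measurable_def
  proof (intro exI[of _ "\<lambda>n x. if x \<in> N then 0 else F n x"] conjI allI ballI)
    show "simple_function M (\<lambda>x. if x \<in> N then 0 else F n x)" for n
      using N(3) F by (intro simple_function_If_set) auto
    show "(\<lambda>n. if x \<in> N then 0 else F n x) \<longlonglongrightarrow> (if x \<in> N then 0 else f x)" if "x \<in> space M" for x
      using N(1) that by auto
  qed
  moreover have "AE x in M. f x = (if x \<in> N then 0 else f x)"
    using AE_not_in[of N M] N by (auto simp: null_sets_def elim!: eventually_mono)
  ultimately show ?thesis by blast
qed

text \<open>Cutting off the approximants where their norm exceeds \<open>2 * norm (f x)\<close> keeps them simple and convergent
  and makes \<open>3 * norm (f x)\<close> a dominating function.\<close>

lemma simple_function_L2_dense:
  fixes f :: "'a \<Rightarrow> 'x::real_normed_vector"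
  assumes f: "strongly_measurable M f" and fin: "(\<integral>\<^sup>+x. ennreal ((norm (f x))\<^sup>2) \<partial>M) < \<infinity>"
    and \<epsilon>: "0 < \<epsilon>"
  shows "\<exists>g. simple_function M g \<and> (\<integral>\<^sup>+x. ennreal ((norm (f x - g x))\<^sup>2) \<partial>M) < \<epsilon>"
proof -
  obtain F where F: "\<And>n. simple_function M (F n)"
    and lim: "\<And>x. x \<in> space M \<Longrightarrow> (\<lambda>n. F n x) \<longlonglongrightarrow> f x"
    using f unfolding strongly_measurable_def by metis
  note [measurable] = strongly_measurable_norm[OF f]
  have [measurable]: "(\<lambda>x. norm (F n x)) \<in> borel_measurable M" for n
    by (intro strongly_measurable_norm strongly_measurable_simple F)
  define G where "G n x = (if norm (F n x) \<le> 2 * norm (f x) then F n x else 0)" for n x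
  have G: "simple_function M (G n)" for n
    unfolding G_def by (intro simple_function_If F simple_function_const) measurable
  have bound: "norm (f x - G n x) \<le> 3 * norm (f x)" for n x
    using norm_triangle_ineq4[of "f x" "F n x"] by (auto simp: G_def)
  have G_lim: "(\<lambda>n. G n x) \<longlonglongrightarrow> f x" if x: "x \<in> space M" for x
  proof (cases "f x = 0")
    case True
    then have "G n x = 0" for n by (simp add: G_def)
    then show ?thesis using True by simp
  next
    case False
    have "(\<lambda>n. norm (F n x)) \<longlonglongrightarrow> norm (f x)"
      using lim[OF x] by (rule tendsto_norm)
    then have "eventually (\<lambda>n. norm (F n x) < 2 * norm (f x)) sequentially"
      using False by (intro order_tendstoD) auto
    then have "eventually (\<lambda>n. G n x = F n x) sequentially"
      by eventually_elim (simp add: G_def)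
    then show ?thesis using lim[OF x] by (simp add: tendsto_cong)
  qed
  have "(\<lambda>n. \<integral>\<^sup>+x. ennreal ((norm (f x - G n x))\<^sup>2) \<partial>M) \<longlonglongrightarrow> (\<integral>\<^sup>+x. 0 \<partial>M)"
  proof (rule nn_integral_dominated_convergence[where w = "\<lambda>x. ennreal 9 * ennreal ((norm (f x))\<^sup>2)"])
    have "(\<lambda>x. norm (f x - G n x)) \<in> borel_measurable M" for n
      by (intro strongly_measurable_norm strongly_measurable_diff f strongly_measurable_simple G)
    then show "(\<lambda>x. ennreal ((norm (f x - G n x))\<^sup>2)) \<in> borel_measurable M" for n
      by measurable
    show "AE x in M. ennreal ((norm (f x - G n x))\<^sup>2) \<le> ennreal 9 * ennreal ((norm (f x))\<^sup>2)" for n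
    proof (rule AE_I2)
      fix x
      have "(norm (f x - G n x))\<^sup>2 \<le> (3 * norm (f x))\<^sup>2" by (intro power_mono bound) auto
      then have "ennreal ((norm (f x - G n x))\<^sup>2) \<le> ennreal (9 * (norm (f x))\<^sup>2)"
        by (intro ennreal_leI) (simp add: power_mult_distrib)
      also have "\<dots> = ennreal 9 * ennreal ((norm (f x))\<^sup>2)" by (rule ennreal_mult) auto
      finally show "ennreal ((norm (f x - G n x))\<^sup>2) \<le> ennreal 9 * ennreal ((norm (f x))\<^sup>2)" .
    qed
    show "(\<integral>\<^sup>+x. ennreal 9 * ennreal ((norm (f x))\<^sup>2) \<partial>M) < \<infinity>"
      using fin by (simp add: nn_integral_cmult ennreal_mult_less_top)
    show "AE x in M. (\<lambda>n. ennreal ((norm (f x - G n x))\<^sup>2)) \<longlonglongrightarrow> 0"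
    proof (rule AE_I2)
      fix x assume "x \<in> space M"
      from tendsto_diff[OF tendsto_const G_lim[OF this], of "f x"]
      have "(\<lambda>n. (norm (f x - G n x))\<^sup>2) \<longlonglongrightarrow> (norm (f x - f x))\<^sup>2"
        by (intro tendsto_power tendsto_norm) simp
      then show "(\<lambda>n. ennreal ((norm (f x - G n x))\<^sup>2)) \<longlonglongrightarrow> 0"
        using tendsto_ennrealI by fastforce
    qed
  qed simp_all
  then have "eventually (\<lambda>n. (\<integral>\<^sup>+x. ennreal ((norm (f x - G n x))\<^sup>2) \<partial>M) < \<epsilon>) sequentially"
    using \<epsilon> by (intro order_tendstoD) auto
  then show ?thesis using G by (auto simp: eventually_sequentially)
qed

context ahlfors_space
begin

lemma simple_function_nearest:
  assumes "separated_net UNIV r z n"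
  shows "simple_function M (nearest z n)"
proof -
  have "range (nearest z n) \<subseteq> {..<n}" using nearest_properties(1)[OF assms] by auto
  then have "finite (range (nearest z n))" by (rule finite_subset) simp
  then show ?thesis
    using measurable_sets[OF nearest_measurable[OF sets_M assms]]
    by (auto simp: simple_function_def)
qed

lemma strongly_measurable_lipschitz:
  fixes f :: "'y \<Rightarrow> 'x::real_normed_vector"
  assumes f: "\<Lambda>-lipschitz_on UNIV f"
  shows "strongly_measurable M f"
proof -
  have "\<exists>z n. separated_net (UNIV :: 'y set) (1 / Suc k) z n" for k
    using separated_net_exists[OF compact_space, of "1 / Suc k"] by simp
  then obtain z n where net: "\<And>k. separated_net (UNIV::'y set) (1 / Suc k) (z k) (n k)" by metis
  show ?thesis
    unfolding strongly_measurable_def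
  proof (intro exI[of _ "\<lambda>k y. f (z k (nearest (z k) (n k) y))"] conjI allI ballI)
    show "simple_function M (\<lambda>y. f (z k (nearest (z k) (n k) y)))" for k
      using simple_function_compose1[OF simple_function_nearest[OF net[of k]], of "\<lambda>i. f (z k i)"] by simp
    fix y
    have "dist (f (z k (nearest (z k) (n k) y))) (f y) \<le> \<Lambda> * (1 / Suc k)" for k
    proof -
      have "dist (f (z k (nearest (z k) (n k) y))) (f y) \<le> \<Lambda> * dist (z k (nearest (z k) (n k) y)) y"
        using f by (auto simp: lipschitz_on_def)
      also have "\<dots> \<le> \<Lambda> * (1 / Suc k)"
        using nearest_properties(2)[OF net[of k], of y] lipschitz_on_nonneg[OF f]
        by (intro mult_left_mono) (auto simp: dist_commute intro: less_imp_le)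
      finally show ?thesis .
    qed
    then have "eventually (\<lambda>k. norm (dist (f (z k (nearest (z k) (n k) y))) (f y)) \<le> \<Lambda> * (1 / Suc k)) sequentially"
      by (intro always_eventually allI) (simp only: real_norm_def abs_of_nonneg[OF zero_le_dist])
    moreover have "(\<lambda>k. \<Lambda> * (1 / real (Suc k))) \<longlonglongrightarrow> 0"
      using tendsto_mult[OF tendsto_const LIMSEQ_Suc[OF lim_1_over_n], of \<Lambda>] by simp
    ultimately have "(\<lambda>k. dist (f (z k (nearest (z k) (n k) y))) (f y)) \<longlonglongrightarrow> 0"
      by (rule Lim_null_comparison)
    then show "(\<lambda>k. f (z k (nearest (z k) (n k) y))) \<longlonglongrightarrow> f y"
      by (rule iffD2[OF tendsto_dist_iff])
  qed
qed

lemma lipschitz_urysohn: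
  fixes K U :: "'y set"
  assumes K: "closed K" and U: "open U" "K \<subseteq> U"
  shows "\<exists>(\<phi> :: 'y \<Rightarrow> real) \<Lambda>. \<Lambda>-lipschitz_on UNIV \<phi> \<and> (\<forall>y. 0 \<le> \<phi> y \<and> \<phi> y \<le> 1) \<and>
    (\<forall>y\<in>K. \<phi> y = 1) \<and> (\<forall>y. y \<notin> U \<longrightarrow> \<phi> y = 0)"
proof (cases "K = {}")
  case True
  then show ?thesis
    by (intro exI[of _ "\<lambda>_. 0"] exI[of _ 0]) (auto simp: lipschitz_on_def)
next
  case False
  obtain \<delta> where \<delta>: "0 < \<delta>" "(\<Union>x\<in>K. ball x \<delta>) \<subseteq> U"
    using compact_subset_open_imp_ball_epsilon_subset[OF closed_imp_compact[OF K] U] by metis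
  define \<phi> where "\<phi> y = max 0 (1 - infdist y K / \<delta>)" for y
  have "(1 / \<delta>)-lipschitz_on UNIV \<phi>"
  proof (rule lipschitz_onI)
    fix x y :: 'y
    have "\<bar>infdist x K - infdist y K\<bar> / \<delta> \<le> dist x y / \<delta>"
      using \<delta> by (intro divide_right_mono infdist_triangle_abs) auto
    then have "\<bar>infdist x K / \<delta> - infdist y K / \<delta>\<bar> \<le> 1 / \<delta> * dist x y"
      using \<delta> by (simp add: abs_divide flip: diff_divide_distrib)
    then show "dist (\<phi> x) (\<phi> y) \<le> 1 / \<delta> * dist x y"
      unfolding \<phi>_def dist_real_def by linarith
  qed (use \<delta> in simp)
  moreover have "\<phi> y = 0" if "y \<notin> U" for y
  proof -
    have "\<delta> \<le> dist y x" if "x \<in> K" for x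
      using \<open>y \<notin> U\<close> \<delta>(2) that by (force simp: dist_commute not_less)
    then have "\<delta> \<le> infdist y K"
      using False by (simp add: infdist_notempty cINF_greatest)
    then show ?thesis using \<delta> by (simp add: \<phi>_def field_simps)
  qed
  ultimately show ?thesis
    using \<delta> by (intro exI[of _ \<phi>] exI[of _ "1 / \<delta>"]) (auto simp: \<phi>_def infdist_nonneg)
qed

text \<open>Every level set of \<open>g\<close> lies between a closed and an open set of nearly equal measure. Replacing its indicator by
  a Lipschitz cut-off causes errors of bounded size on the differences of these sets only.\<close>

lemma lipschitz_approximates_simple:
  fixes g :: "'y \<Rightarrow> 'x::real_normed_vector"
  assumes g: "simple_function M g" and \<epsilon>: "0 < \<epsilon>"
  shows "\<exists>h \<Lambda>. \<Lambda>-lipschitz_on UNIV h \<and> (\<integral>\<^sup>+x. ennreal ((norm (g x - h x))\<^sup>2) \<partial>M) < ennreal \<epsilon>"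
proof -
  let ?R = "range g" and ?A = "\<lambda>v. g -` {v}"
  have R: "finite ?R" and A: "?A v \<in> sets borel" for v
  proof -
    show "finite ?R" using g by (simp add: simple_function_def)
    show "?A v \<in> sets borel"
    proof (cases "v \<in> ?R")
      case True
      then show ?thesis using g sets_M by (auto simp: simple_function_def)
    next
      case False
      then have "?A v = {}" by auto
      then show ?thesis by simp
    qed
  qed
  have fin: "finite_measure M" by (rule finite_measure_axioms)
  define B where "B = (\<Sum>v\<in>?R. norm v)"
  have B: "0 \<le> B" unfolding B_def by (intro sum_nonneg) auto
  define d where "d = \<epsilon> / ((B\<^sup>2 + 1) * card ?R)"
  have cR: "0 < card ?R" using R by (simp add: card_gt_0_iff)
  have B1: "0 < B\<^sup>2 + 1" by (simp add: add_nonneg_pos)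
  have d: "0 < d" using \<epsilon> cR B1 by (simp add: d_def)
  have "\<exists>K U. closed K \<and> open U \<and> K \<subseteq> ?A v \<and> ?A v \<subseteq> U \<and> measure M (U - K) < d" for v
    by (rule borel_sandwich[OF fin sets_M A d])
  then obtain K U where KU: "\<And>v. closed (K v)" "\<And>v. open (U v)" "\<And>v. K v \<subseteq> ?A v" "\<And>v. ?A v \<subseteq> U v"
    "\<And>v. measure M (U v - K v) < d" by metis
  have "\<exists>(\<phi> :: 'y \<Rightarrow> real) \<Lambda>. \<Lambda>-lipschitz_on UNIV \<phi> \<and> (\<forall>y. 0 \<le> \<phi> y \<and> \<phi> y \<le> 1) \<and>
    (\<forall>y\<in>K v. \<phi> y = 1) \<and> (\<forall>y. y \<notin> U v \<longrightarrow> \<phi> y = 0)" for v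
    using KU by (intro lipschitz_urysohn) blast+
  then obtain \<phi> \<Lambda> where \<phi>: "\<And>v. (\<Lambda> v)-lipschitz_on UNIV (\<phi> v :: 'y \<Rightarrow> real)"
    "\<And>v y. 0 \<le> \<phi> v y" "\<And>v y. \<phi> v y \<le> 1" "\<And>v y. y \<in> K v \<Longrightarrow> \<phi> v y = 1" "\<And>v y. y \<notin> U v \<Longrightarrow> \<phi> v y = 0"
    by metis
  define h where "h y = (\<Sum>v\<in>?R. \<phi> v y *\<^sub>R v)" for y
  have lip: "(\<Sum>v\<in>?R. \<Lambda> v * norm v)-lipschitz_on UNIV h"
  proof (rule lipschitz_onI)
    fix x y :: 'y
    have "dist (h x) (h y) = norm (\<Sum>v\<in>?R. (\<phi> v x - \<phi> v y) *\<^sub>R v)"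
      by (simp add: h_def dist_norm sum_subtractf scaleR_diff_left)
    also have "\<dots> \<le> (\<Sum>v\<in>?R. \<bar>\<phi> v x - \<phi> v y\<bar> * norm v)"
      by (rule order_trans[OF norm_sum]) simp
    also have "\<dots> \<le> (\<Sum>v\<in>?R. (\<Lambda> v * dist x y) * norm v)"
      using \<phi>(1) by (intro sum_mono mult_right_mono) (auto simp: lipschitz_on_def dist_real_def)
    finally show "dist (h x) (h y) \<le> (\<Sum>v\<in>?R. \<Lambda> v * norm v) * dist x y"
      by (simp add: sum_distrib_left sum_distrib_right mult_ac)
  next
    show "0 \<le> (\<Sum>v\<in>?R. \<Lambda> v * norm v)"
      using \<phi>(1) lipschitz_on_nonneg by (intro sum_nonneg mult_nonneg_nonneg) auto
  qed
  let ?E = "\<Union>v\<in>?R. U v - K v"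
  have E[measurable]: "?E \<in> sets M"
    using R KU(1,2) sets_M by (intro sets.finite_UN sets.Diff) auto
  have pointwise: "(norm (g y - h y))\<^sup>2 \<le> B\<^sup>2 * indicator ?E y" for y
  proof -
    have gy: "g y = (\<Sum>v\<in>?R. indicator (?A v) y *\<^sub>R v)"
      using R by (subst sum.remove[of _ "g y"]) (auto intro!: sum.neutral simp: indicator_def)
    have eq: "g y - h y = (\<Sum>v\<in>?R. (indicator (?A v) y - \<phi> v y) *\<^sub>R v)"
      by (subst gy) (simp only: h_def sum_subtractf scaleR_diff_left)
    show ?thesis
    proof (cases "y \<in> ?E")
      case True
      have "norm (g y - h y) \<le> (\<Sum>v\<in>?R. \<bar>indicator (?A v) y - \<phi> v y\<bar> * norm v)"
        unfolding eq by (rule order_trans[OF norm_sum]) simp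
      also have "\<dots> \<le> (\<Sum>v\<in>?R. 1 * norm v)"
      proof (intro sum_mono mult_right_mono)
        show "\<bar>indicator (?A v) y - \<phi> v y\<bar> \<le> 1" for v
          using \<phi>(2)[of v y] \<phi>(3)[of v y] by (auto simp: indicator_def)
      qed simp
      finally have "(norm (g y - h y))\<^sup>2 \<le> B\<^sup>2" by (intro power_mono) (auto simp: B_def)
      then show ?thesis using True by simp
    next
      case False
      have "indicator (?A v) y = \<phi> v y" if "v \<in> ?R" for v
      proof (cases "y \<in> K v")
        case True
        then show ?thesis using KU(3) \<phi>(4) by (metis indicator_simps(1) subsetD)
      next
        case F: False
        then have "y \<notin> U v" using False that by auto
        then show ?thesis using KU(4) \<phi>(5) by (metis indicator_simps(2) subsetD)
      qed
      then show ?thesis unfolding eq by simp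
    qed
  qed
  have "(\<integral>\<^sup>+y. ennreal ((norm (g y - h y))\<^sup>2) \<partial>M) \<le> (\<integral>\<^sup>+y. ennreal (B\<^sup>2) * indicator ?E y \<partial>M)"
  proof (rule nn_integral_mono)
    fix y
    have "ennreal ((norm (g y - h y))\<^sup>2) \<le> ennreal (B\<^sup>2 * indicator ?E y)"
      by (intro ennreal_leI pointwise)
    then show "ennreal ((norm (g y - h y))\<^sup>2) \<le> ennreal (B\<^sup>2) * indicator ?E y"
      by (simp add: ennreal_mult ennreal_indicator)
  qed
  also have "\<dots> = ennreal (B\<^sup>2 * measure M ?E)"
    using E by (simp add: nn_integral_cmult_indicator emeasure_eq_measure ennreal_mult)
  also have "\<dots> < ennreal \<epsilon>"
  proof (rule ennreal_lessI[OF \<epsilon>])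
    have "measure M ?E \<le> (\<Sum>v\<in>?R. measure M (U v - K v))"
      using R KU(1,2) sets_M by (intro finite_measure_subadditive_finite) auto
    also have "\<dots> \<le> (\<Sum>v\<in>?R. d)" using KU(5) by (intro sum_mono less_imp_le)
    finally have "B\<^sup>2 * measure M ?E \<le> B\<^sup>2 * (card ?R * d)" by (intro mult_left_mono) auto
    also have "\<dots> < (B\<^sup>2 + 1) * (card ?R * d)" using cR d by (intro mult_strict_right_mono) auto
    also have "\<dots> = \<epsilon>" using cR B1 by (simp add: d_def)
    finally show "B\<^sup>2 * measure M ?E < \<epsilon>" .
  qed
  finally show ?thesis using lip by blast
qed

lemma lipschitz_L2_dense:
  fixes f :: "'y \<Rightarrow> 'x::real_normed_vector"
  assumes f: "strongly_measurable M f" and fin: "(\<integral>\<^sup>+x. ennreal ((norm (f x))\<^sup>2) \<partial>M) < \<infinity>"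
    and \<epsilon>: "0 < \<epsilon>"
  shows "\<exists>h \<Lambda>. \<Lambda>-lipschitz_on UNIV h \<and> (\<integral>\<^sup>+x. ennreal ((norm (f x - h x))\<^sup>2) \<partial>M) < ennreal \<epsilon>"
proof -
  obtain g where g: "simple_function M g" "(\<integral>\<^sup>+x. ennreal ((norm (f x - g x))\<^sup>2) \<partial>M) < ennreal (\<epsilon> / 4)"
    using simple_function_L2_dense[OF f fin, of "ennreal (\<epsilon> / 4)"] \<epsilon> by auto
  obtain h \<Lambda> where h: "\<Lambda>-lipschitz_on UNIV h" "(\<integral>\<^sup>+x. ennreal ((norm (g x - h x))\<^sup>2) \<partial>M) < ennreal (\<epsilon> / 4)"
    using lipschitz_approximates_simple[OF g(1), of "\<epsilon> / 4"] \<epsilon> by auto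
  have [measurable]: "(\<lambda>x. norm (f x - g x)) \<in> borel_measurable M" "(\<lambda>x. norm (g x - h x)) \<in> borel_measurable M"
    by (intro strongly_measurable_norm strongly_measurable_diff f
        strongly_measurable_simple[OF g(1)] strongly_measurable_lipschitz[OF h(1)])+
  have "(\<integral>\<^sup>+x. ennreal ((norm (f x - h x))\<^sup>2) \<partial>M)
      \<le> (\<integral>\<^sup>+x. ennreal 2 * ennreal ((norm (f x - g x))\<^sup>2) + ennreal 2 * ennreal ((norm (g x - h x))\<^sup>2) \<partial>M)"
    by (intro nn_integral_mono ennreal_le_add_mult power2_norm_diff_le) auto
  also have "\<dots> = ennreal 2 * (\<integral>\<^sup>+x. ennreal ((norm (f x - g x))\<^sup>2) \<partial>M)
      + ennreal 2 * (\<integral>\<^sup>+x. ennreal ((norm (g x - h x))\<^sup>2) \<partial>M)"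
    by (rule nn_integral_add_cmult) simp_all
  also have "\<dots> < ennreal 2 * ennreal (\<epsilon> / 4) + ennreal 2 * ennreal (\<epsilon> / 4)"
    using g(2) h(2) by (intro add_strict_mono ennreal_mult_strict_left_mono) auto
  also have "\<dots> = ennreal \<epsilon>"
    using \<epsilon> by (subst ennreal_mult_add) auto
  finally show ?thesis using h(1) by blast
qed

end

section \<open>Graphs approximating a level of the warped cone\<close>

locale warped_system = ahlfors_space M c m C
  for M :: "'y::metric_space measure" and c m C +
  fixes S :: "('y \<rightharpoonup> 'y) set" and L :: real
  assumes geodesic: "geodesic_set (UNIV :: 'y set)"
    and finite_S: "finite S"
    and L_ge_1: "1 \<le> L"
    and S_closed: "s \<in> S \<Longrightarrow> closed (dom s)"
    and S_lipschitz: "s \<in> S \<Longrightarrow> L-lipschitz_on (dom s) (\<lambda>x. the (s x))"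
    and S_inj: "s \<in> S \<Longrightarrow> s x = Some y \<Longrightarrow> s x' = Some y \<Longrightarrow> x = x'"
    and S_inv: "s \<in> S \<Longrightarrow> partial_inv s \<in> S"
    and S_frontier: "s \<in> S \<Longrightarrow> measure M (frontier (dom s)) = 0"
begin

definition degree_bound :: nat where
  "degree_bound = Suc (card S) * nat \<lceil>C * (2 * (2 * L + 4)) powr m\<rceil>"

definition cell_ratio :: real where "cell_ratio = C * 2 powr m"

lemma cell_ratio_ge_1: "1 \<le> cell_ratio"
  using constants ge_one_powr_ge_zero[of 2 m] mult_mono[of 1 C 1 "2 powr m"] by (simp add: cell_ratio_def)

lemma S_dist_le:
  assumes "s \<in> S" "s x = Some y" "s x' = Some y'"
  shows "dist y y' \<le> L * dist x x'"
  using S_lipschitz[OF assms(1)] assms(2,3) by (force simp: lipschitz_on_def)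

lemma partial_inv_eq:
  assumes "s \<in> S"
  shows "partial_inv s y = Some x \<longleftrightarrow> s x = Some y"
proof
  assume "partial_inv s y = Some x"
  then have "y \<in> ran s" "x = (SOME x. s x = Some y)"
    by (auto simp: partial_inv_def split: if_splits)
  then show "s x = Some y" unfolding ran_def by (auto intro: someI)
next
  assume x: "s x = Some y"
  then have "s (SOME x. s x = Some y) = Some y" by (rule someI)
  then have "(SOME x. s x = Some y) = x" using x S_inj[OF assms] by blast
  then show "partial_inv s y = Some x" using x by (auto simp: partial_inv_def ran_def)
qed

lemma dom_partial_inv: "dom (partial_inv s) = ran s"
  by (auto simp: partial_inv_def dom_def)

lemma partial_inv_involutive:
  assumes "s \<in> S"
  shows "partial_inv (partial_inv s) = s"
proof
  fix x
  have "partial_inv (partial_inv s) x = Some y \<longleftrightarrow> s x = Some y" for y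
    using partial_inv_eq[OF S_inv[OF assms]] partial_inv_eq[OF assms] by simp
  then show "partial_inv (partial_inv s) x = s x" by (metis not_None_eq)
qed

end

text \<open>The level \<open>tY\<close> is studied through a net of scale \<open>r = 1 / t\<close>.\<close>

locale warped_net = warped_system M c m C S L
  for M :: "'y::metric_space measure" and c m C and S :: "('y \<rightharpoonup> 'y) set" and L +
  fixes z :: "nat \<Rightarrow> 'y" and n :: nat and r :: real
  assumes r_pos: "0 < r" and net: "separated_net UNIV r z n"
begin

abbreviation p :: "'y \<Rightarrow> nat" where "p \<equiv> nearest z n"

definition linked :: "'y \<Rightarrow> 'y \<Rightarrow> bool" where
  "linked y y' \<longleftrightarrow> dist y y' \<le> r \<or> (\<exists>s\<in>S. s y = Some y')"

definition net_graph :: "nat pair_pre_digraph" where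
  "net_graph = \<lparr>pverts = {..<n}, parcs = {(p y, p y') | y y'. p y \<noteq> p y' \<and> linked y y'}\<rparr>"

lemmas p_less = nearest_properties(1)[OF net]
lemmas p_close = nearest_properties(2)[OF net]

lemma p_net_point: "i < n \<Longrightarrow> p (z i) = i"
  using nearest_properties(3)[OF net, of i "z i"] r_pos by simp

lemma linked_sym: "linked y y' \<Longrightarrow> linked y' y"
  unfolding linked_def using partial_inv_eq S_inv by (metis dist_commute)

lemma pverts_net_graph [simp]: "pverts net_graph = {..<n}"
  by (simp add: net_graph_def)

lemma parcs_net_graph:
  "(i, j) \<in> parcs net_graph \<longleftrightarrow> i \<noteq> j \<and> (\<exists>y y'. p y = i \<and> p y' = j \<and> linked y y')"
  by (auto simp: net_graph_def)

lemma parcs_net_graph_subset: "parcs net_graph \<subseteq> {..<n} \<times> {..<n}"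
  using p_less by (auto simp: net_graph_def)

lemma sym_net_graph: "sym (parcs net_graph)"
  using linked_sym by (auto simp: sym_def parcs_net_graph)

lemma finite_parcs_net_graph: "finite (parcs net_graph)"
  by (rule finite_subset[OF parcs_net_graph_subset]) simp

lemma pair_graph_net_graph: "pair_graph net_graph"
proof
  show "fst e \<in> pverts net_graph" "snd e \<in> pverts net_graph" if "e \<in> parcs net_graph" for e
    using subsetD[OF parcs_net_graph_subset that] by auto
  show "fst e \<noteq> snd e" if "e \<in> parcs net_graph" for e
    using that parcs_net_graph[of "fst e" "snd e"] by simp
  show "finite (pverts net_graph)" "finite (parcs net_graph)"
    by (simp_all add: finite_parcs_net_graph)
  show "Digraph.symmetric (with_proj net_graph)"
    using sym_net_graph by (simp add: symmetric_def)
qed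

lemma n_pos: "0 < n"
  using p_less[of undefined] by simp

lemma linked_walk_ball: "linked y y' \<Longrightarrow> p y' \<in> walk_ball (parcs net_graph) (Suc 0) (p y)"
  by (auto simp: walk_ball_1 parcs_net_graph)

lemma walk_of_dist:
  "\<exists>k. real k \<le> dist x y / r + 1 \<and> (p x, p y) \<in> parcs net_graph ^^ k"
proof -
  obtain N where N: "real N \<le> dist x y / r + 1" "(x, y) \<in> {(u, v). dist u v \<le> r} ^^ N"
    using geodesic_chain[OF geodesic r_pos] by blast
  have "p y \<in> walk_ball (parcs net_graph) N (p x)"
    using N(2)
  proof (induction N arbitrary: y)
    case (Suc N)
    then obtain w where "p w \<in> walk_ball (parcs net_graph) N (p x)" "dist w y \<le> r" by auto
    then show ?case
      using linked_walk_ball[of w y] by (auto simp: walk_ball_Suc linked_def)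
  qed simp
  then obtain j where "j \<le> N" "(p x, p y) \<in> parcs net_graph ^^ j"
    using walk_ball_imp_relpow by metis
  then show ?thesis using N(1) by (intro exI[of _ j]) auto
qed

lemma connected_net_graph: "Digraph_Component.connected (with_proj net_graph)"
proof (rule connectedI_relpow[OF pair_graph_net_graph])
  show "pverts net_graph \<noteq> {}" using n_pos by auto
  show "\<exists>k. (i, j) \<in> parcs net_graph ^^ k" if "i \<in> pverts net_graph" "j \<in> pverts net_graph" for i j
    using walk_of_dist[of "z i" "z j"] that by (auto simp: p_net_point)
qed

lemmas net_graph_dist_walk = graph_dist_walk[OF pair_graph_net_graph connected_net_graph]

abbreviation gdist :: "nat \<Rightarrow> nat \<Rightarrow> real" where "gdist \<equiv> mdist (graph_metric net_graph)"

lemma gdist_le_warped_dist: "gdist (p x) (p y) \<le> 2 * warped_dist S (1/r) x y + 1"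
proof (rule coarse_metric_le_warped_dist)
  interpret G: Metric_space "pverts net_graph" gdist
    using graph_metric_simps(1)[OF pair_graph_net_graph connected_net_graph]
    by (metis Metric_space_mspace_mdist)
  have p: "p y \<in> pverts net_graph" for y using p_less by simp
  show "0 < 1 / r" using r_pos by simp
  show "0 \<le> gdist (p x) (p y)" for x y by simp
  show "gdist (p x) (p x) = 0" for x using G.zero p by blast
  show "gdist (p x) (p y) \<le> gdist (p x) (p w) + gdist (p w) (p y)" for x y w
    by (intro G.triangle p)
  show "gdist (p x) (p y) \<le> 1 / r * dist x y + 1" for x y
  proof -
    obtain k where "real k \<le> dist x y / r + 1" "(p x, p y) \<in> parcs net_graph ^^ k"
      using walk_of_dist by blast
    then show ?thesis using net_graph_dist_walk(2)[OF p p] by fastforce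
  qed
  have linked: "gdist (p y) (p y') \<le> 1" if l: "linked y y'" for y y'
  proof -
    obtain j where "j \<le> 1" "(p y, p y') \<in> parcs net_graph ^^ j"
      using walk_ball_imp_relpow[OF linked_walk_ball[OF l]] by auto
    then show ?thesis using net_graph_dist_walk(2)[OF p p, of y y' j] by simp
  qed
  show "gdist (p y) (p y') \<le> 1 \<and> gdist (p y') (p y) \<le> 1" if "s \<in> S" "s y = Some y'" for s y y'
  proof -
    have "linked y y'" using that by (auto simp: linked_def)
    then show ?thesis using linked linked_sym by blast
  qed
qed

lemma warped_dist_net_point: "warped_dist S (1/r) y (z (p y)) \<le> 1"
proof -
  have "warped_dist S (1/r) y (z (p y)) \<le> 1 / r * dist y (z (p y))"
    using r_pos by (intro warped_dist_metric(2)) auto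
  also have "\<dots> \<le> 1 / r * r" using p_close r_pos by (intro mult_left_mono less_imp_le) auto
  finally show ?thesis using r_pos by simp
qed

text \<open>Net points joined by an arc are at warped distance at most \<open>3\<close>: move within the first cell, along the
  link, and within the second cell.\<close>

lemma warped_dist_le_gdist: "warped_dist S (1/r) x y \<le> 3 * gdist (p x) (p y) + 2"
proof -
  have t: "0 < 1 / r" using r_pos by simp
  interpret W: Metric_space UNIV "warped_dist S (1/r)" by (rule warped_dist_metric(1)[OF t])
  note close = warped_dist_net_point
  have arc: "warped_dist S (1/r) (z i) (z j) \<le> 3" if "(i, j) \<in> parcs net_graph" for i j
  proof -
    obtain u v where uv: "p u = i" "p v = j" "linked u v" using \<open>(i, j) \<in> _\<close> by (auto simp: parcs_net_graph)
    have "warped_dist S (1/r) u v \<le> 1"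
    proof (cases "dist u v \<le> r")
      case True
      have "warped_dist S (1/r) u v \<le> 1 / r * dist u v" by (rule warped_dist_metric(2)[OF t])
      also have "\<dots> \<le> 1 / r * r" using True r_pos by (intro mult_left_mono) auto
      finally show ?thesis using r_pos by simp
    next
      case False
      then show ?thesis using uv(3) warped_dist_metric(3)[OF t] by (auto simp: linked_def)
    qed
    then show ?thesis
      using close[of u] close[of v] W.triangle[of "z i" u "z j"] W.triangle[of u v "z j"]
        W.commute[of "z i" u] uv by simp
  qed
  have walk: "warped_dist S (1/r) (z i) (z j) \<le> 3 * real k" if "(i, j) \<in> parcs net_graph ^^ k" for i j k
    using that
  proof (induction k arbitrary: j)
    case (Suc k)
    then obtain l where l: "(i, l) \<in> parcs net_graph ^^ k" "(l, j) \<in> parcs net_graph" by auto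
    show ?case using Suc.IH[OF l(1)] arc[OF l(2)] W.triangle[of "z i" "z l" "z j"] by simp
  qed simp
  obtain k where k: "(p x, p y) \<in> parcs net_graph ^^ k" "gdist (p x) (p y) = real k"
    using net_graph_dist_walk(1)[of "p x" "p y"] p_less by auto
  show ?thesis
    using walk[OF k(1)] close[of x] close[of y] W.triangle[of x "z (p x)" y]
      W.triangle[of "z (p x)" "z (p y)" y] W.commute[of y "z (p y)"] k(2) by simp
qed

lemma quasi_isometry_net_graph:
  "quasi_isometry 2 1 3 (warped_cone S (1/r)) (graph_metric net_graph) p"
proof -
  have t: "0 < 1 / r" using r_pos by simp
  have pos: "0 \<le> warped_dist S (1/r) x y" for x y
    using Metric_space.nonneg[OF warped_dist_metric(1)[OF t]] .
  interpret G: Metric_space "pverts net_graph" gdist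
    using graph_metric_simps(1)[OF pair_graph_net_graph connected_net_graph]
    by (metis Metric_space_mspace_mdist)
  show ?thesis
    unfolding quasi_isometry_def warped_cone_simps[OF t]
      graph_metric_simps(1)[OF pair_graph_net_graph connected_net_graph]
  proof (intro conjI ballI)
    show "p ` UNIV \<subseteq> pverts net_graph" using p_less by auto
    fix x y
    show "warped_dist S (1/r) x y / 3 - 2 \<le> gdist (p x) (p y)"
      using warped_dist_le_gdist[of x y] by simp
    show "gdist (p x) (p y) \<le> 3 * warped_dist S (1/r) x y + 2"
      using gdist_le_warped_dist[of x y] pos[of x y] by simp
  next
    fix i assume i: "i \<in> pverts net_graph"
    then have "gdist (p (z i)) i = 0" using p_net_point G.zero by simp
    then show "\<exists>x\<in>UNIV. gdist (p x) i < 1" by (intro bexI[of _ "z i"]) auto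
  qed
qed

lemma one_point_net:
  assumes "diameter (UNIV :: 'y set) < r"
  shows "n = 1"
proof (rule ccontr)
  assume "n \<noteq> 1"
  then have "0 < n" "1 < n" using n_pos by auto
  then have "r \<le> dist (z 0) (z 1)" using net unfolding separated_net_def by force
  then show False using dist_le_diameter[of "z 0" "z 1"] assms by simp
qed

text \<open>The balls of radius \<open>r/2\<close> at the points are disjoint and lie in a ball of radius \<open>(\<kappa> + 1) * r\<close>. The lower
  volume bound does not reach scales far beyond the diameter; there the net is a single point.\<close>

lemma card_net_points_le:
  assumes \<kappa>: "0 \<le> \<kappa>"
  shows "real (card {j. j < n \<and> dist (z j) w \<le> \<kappa> * r}) \<le> C * (2 * (\<kappa> + 1)) powr m"
    (is "real (card ?J) \<le> ?B")
proof (cases "diameter (UNIV :: 'y set) < r")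
  case True
  have "card ?J \<le> card {..<n}" by (intro card_mono) auto
  then have "real (card ?J) \<le> 1" using one_point_net[OF True] by simp
  also have "1 \<le> ?B"
    using constants \<kappa> ge_one_powr_ge_zero[of "2 * (\<kappa> + 1)" m] mult_mono[of 1 C 1 "(2 * (\<kappa> + 1)) powr m"] by simp
  finally show ?thesis .
next
  case False
  have fin: "finite ?J" by simp
  have "card ?J * (c * (r/2) powr m) \<le> (\<Sum>j\<in>?J. measure M (ball (z j) (r/2)))"
    using sum_mono[of ?J "\<lambda>j. c * (r/2) powr m" "\<lambda>j. measure M (ball (z j) (r/2))"]
      ball_lower[of "r/2"] r_pos False by simp
  also have "\<dots> = measure M (\<Union>j\<in>?J. ball (z j) (r/2))"
  proof (rule finite_measure_finite_Union[symmetric, OF fin])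
    show "disjoint_family_on (\<lambda>j. ball (z j) (r/2)) ?J"
      by (rule disjoint_family_on_mono[OF _ separated_balls_disjoint[OF net]]) auto
  qed (simp add: sets_M image_subset_iff)
  also have "\<dots> \<le> measure M (ball w ((\<kappa> + 1) * r))"
  proof (rule finite_measure_mono)
    show "(\<Union>j\<in>?J. ball (z j) (r/2)) \<subseteq> ball w ((\<kappa> + 1) * r)"
    proof clarify
      fix j y assume j: "dist (z j) w \<le> \<kappa> * r" "y \<in> ball (z j) (r/2)"
      have "dist w y \<le> dist (z j) w + dist (z j) y" by (rule dist_triangle3)
      also have "\<dots> < \<kappa> * r + r" using j r_pos by simp
      finally show "y \<in> ball w ((\<kappa> + 1) * r)" by (simp add: distrib_right)
    qed
  qed (simp add: sets_M)
  also have "\<dots> \<le> C * c * ((\<kappa> + 1) * r) powr m"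
    using \<kappa> r_pos by (intro ball_upper) auto
  also have "((\<kappa> + 1) * r) powr m = (2 * (\<kappa> + 1)) powr m * (r/2) powr m"
  proof -
    have "(\<kappa> + 1) * r = (2 * (\<kappa> + 1)) * (r/2)" by simp
    then show ?thesis using r_pos \<kappa> by (simp only: powr_mult)
  qed
  finally have "(c * (r/2) powr m) * card ?J \<le> (c * (r/2) powr m) * ?B" by (simp add: mult_ac)
  then show ?thesis using constants r_pos by (simp add: mult_le_cancel_left_pos)
qed

text \<open>A link of the first kind leads to a cell near \<open>z i\<close>. A link given by \<open>s\<close> leads to a cell near \<open>s y0\<close>,
  where \<open>y0\<close> is any point of the \<open>i\<close>-th cell in \<open>dom s\<close>, because \<open>s\<close> is Lipschitz. In both cases only boundedly
  many net points qualify.\<close>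

lemma degree_net_graph: "card (parcs net_graph `` {i}) \<le> degree_bound"
proof -
  let ?N = "nat \<lceil>C * (2 * (2 * L + 4)) powr m\<rceil>"
  let ?J = "\<lambda>w. {j. j < n \<and> dist (z j) w \<le> (2 * L + 3) * r}"
  have J: "finite (?J w)" "card (?J w) \<le> ?N" for w
  proof -
    have "real (card (?J w)) \<le> C * (2 * ((2 * L + 3) + 1)) powr m"
      using L_ge_1 by (intro card_net_points_le) simp
    also have "(2 * L + 3) + 1 = 2 * L + 4" by simp
    also have "C * (2 * (2 * L + 4)) powr m \<le> real ?N" by (rule real_nat_ceiling_ge)
    finally have "real (card (?J w)) \<le> real ?N" .
    then have "card (?J w) \<le> ?N" by (simp only: of_nat_le_iff)
    then show "card (?J w) \<le> ?N" .
  qed simp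
  define A where "A s = {p y' | y y'. p y = i \<and> s y = Some y'}" for s
  have A: "finite (A s) \<and> card (A s) \<le> ?N" if s: "s \<in> S" for s
  proof (cases "A s = {}")
    case False
    then obtain y0 w where y0: "p y0 = i" "s y0 = Some w" by (auto simp: A_def)
    have "A s \<subseteq> ?J w"
      unfolding A_def
    proof clarify
      fix y y' assume y: "i = p y" "s y = Some y'"
      have "dist y y0 \<le> 2 * r"
        using p_close[of y] p_close[of y0] y(1) y0(1) dist_triangle2[of y y0 "z i"] by simp
      then have "L * dist y y0 \<le> L * (2 * r)" using L_ge_1 by (intro mult_left_mono) auto
      then have "dist y' w \<le> L * (2 * r)" using S_dist_le[OF s y(2) y0(2)] by simp
      then have "dist (z (p y')) w \<le> r + L * (2 * r)"
        using p_close[of y'] dist_triangle3[of "z (p y')" w y'] by simp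
      also have "\<dots> \<le> (2 * L + 3) * r" using r_pos by (simp add: algebra_simps)
      finally show "p y' < n \<and> dist (z (p y')) w \<le> (2 * L + 3) * r" using p_less by simp
    qed
    then show ?thesis using J[of w] by (meson card_mono finite_subset le_trans)
  qed simp
  have sub: "parcs net_graph `` {i} \<subseteq> ?J (z i) \<union> (\<Union>s\<in>S. A s)"
  proof
    fix j assume "j \<in> parcs net_graph `` {i}"
    then obtain y y' where y: "p y = i" "p y' = j" "linked y y'" by (auto simp: parcs_net_graph)
    show "j \<in> ?J (z i) \<union> (\<Union>s\<in>S. A s)"
    proof (cases "dist y y' \<le> r")
      case True
      have "dist (z j) (z i) \<le> dist y' (z j) + (dist y y' + dist y (z i))"
        using dist_triangle3[of "z j" "z i" y'] dist_triangle3[of y' "z i" y] by simp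
      also have "\<dots> \<le> 3 * r" using True p_close[of y] p_close[of y'] y by simp
      also have "\<dots> \<le> (2 * L + 3) * r" using L_ge_1 r_pos by (intro mult_right_mono) auto
      finally show ?thesis using y p_less by auto
    next
      case False
      then show ?thesis using y by (auto simp: linked_def A_def)
    qed
  qed
  have "card (parcs net_graph `` {i}) \<le> card (?J (z i) \<union> (\<Union>s\<in>S. A s))"
    by (rule card_mono[OF _ sub]) (use J A finite_S in auto)
  also have "\<dots> \<le> card (?J (z i)) + card (\<Union>s\<in>S. A s)" by (rule card_Un_le)
  also have "\<dots> \<le> ?N + (\<Sum>s\<in>S. card (A s))"
    using J(2) card_UN_le[OF finite_S, of A] by (rule add_mono)
  also have "\<dots> \<le> ?N + (\<Sum>s\<in>S. ?N)" using A by (intro add_left_mono sum_mono) auto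
  finally show ?thesis by (simp add: degree_bound_def)
qed

definition cell :: "nat \<Rightarrow> 'y set" where "cell i = {y. p y = i}"

lemma cell_sets [measurable]: "cell i \<in> sets M"
proof -
  have "p -` {i} \<inter> space M \<in> sets M"
    using measurable_sets[OF nearest_measurable[OF sets_M net], of "{i}"] by simp
  then show ?thesis by (simp add: cell_def vimage_def)
qed

lemma sum_indicator_cell: "(\<Sum>i<n. a i * indicator (cell i) y) = (a (p y) :: 'b::semiring_1)"
  using p_less[of y] by (subst sum.remove[of _ "p y"]) (auto intro!: sum.neutral simp: cell_def indicator_def)

lemma sum_measure_cell: "(\<Sum>i<n. measure M (cell i)) = 1"
proof -
  have "(\<Sum>i<n. measure M (cell i)) = measure M (\<Union>i<n. cell i)"
    by (rule finite_measure_finite_Union[symmetric])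
      (auto simp: disjoint_family_on_def cell_def intro: cell_sets[unfolded cell_def])
  also have "(\<Union>i<n. cell i) = space M" using p_less by (auto simp: cell_def)
  finally show ?thesis by (simp only: prob_space)
qed

lemma measure_cell_upper: "measure M (cell i) \<le> C * c * r powr m"
proof -
  have "measure M (cell i) \<le> measure M (ball (z i) r)"
    using p_close by (intro finite_measure_mono) (auto simp: cell_def dist_commute sets_M)
  also have "\<dots> \<le> C * c * r powr m" by (rule ball_upper[OF r_pos])
  finally show ?thesis .
qed

lemma measure_cell_lower:
  assumes "i < n" "r \<le> diameter (UNIV :: 'y set)"
  shows "c * (r/2) powr m \<le> measure M (cell i)"
proof -
  have "c * (r/2) powr m \<le> measure M (ball (z i) (r/2))"
    using assms r_pos by (intro ball_lower) auto
  also have "\<dots> \<le> measure M (cell i)"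
    using nearest_properties(3)[OF net assms(1)] cell_sets
    by (intro finite_measure_mono) (auto simp: cell_def dist_commute)
  finally show ?thesis .
qed

lemma card_net_lower: "1 \<le> n * (C * c * r powr m)"
  using sum_mono[of "{..<n}" "\<lambda>i. measure M (cell i)" "\<lambda>_. C * c * r powr m"]
    measure_cell_upper sum_measure_cell by simp

text \<open>Every cell lies in a ball of radius \<open>r\<close> and contains one of radius \<open>r/2\<close>, so the measures of two cells differ by
  a factor of at most \<open>cell_ratio\<close>; their sum is \<open>1\<close>.\<close>

lemma measure_cell_bounds:
  assumes i: "i < n"
  shows "1 / (cell_ratio * n) \<le> measure M (cell i)" and "measure M (cell i) \<le> cell_ratio / n"
proof -
  have "1 / (cell_ratio * n) \<le> measure M (cell i) \<and> measure M (cell i) \<le> cell_ratio / n"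
  proof (cases "diameter (UNIV :: 'y set) < r")
    case True
    then have n: "n = 1" by (rule one_point_net)
    then have "measure M (cell i) = 1" using sum_measure_cell i by simp
    then show ?thesis using cell_ratio_ge_1 n by simp
  next
    case False
    let ?a = "c * (r/2) powr m"
    have qa: "C * c * r powr m = cell_ratio * ?a"
    proof -
      have "r powr m = 2 powr m * (r/2) powr m" using r_pos by (simp flip: powr_mult)
      then show ?thesis by (simp add: cell_ratio_def)
    qed
    have lower: "?a \<le> measure M (cell j)" if "j < n" for j
      using measure_cell_lower that False by simp
    have n: "0 < real n" "0 < cell_ratio" using n_pos cell_ratio_ge_1 by auto
    have "n * ?a \<le> 1"
      using sum_mono[of "{..<n}" "\<lambda>_. ?a" "\<lambda>i. measure M (cell i)"] lower sum_measure_cell by simp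
    then have "?a \<le> 1 / n" using n by (simp add: field_simps)
    then have "cell_ratio * ?a \<le> cell_ratio * (1 / n)" using n by (intro mult_left_mono) auto
    moreover have "1 / (cell_ratio * n) \<le> ?a"
      using card_net_lower n unfolding qa by (simp add: field_simps)
    ultimately show ?thesis
      using lower[OF i] measure_cell_upper[of i] qa by simp
  qed
  then show "1 / (cell_ratio * n) \<le> measure M (cell i)" "measure M (cell i) \<le> cell_ratio / n" by auto
qed

end

section \<open>From a spectral gap to expanders\<close>

definition variance_integral :: "'a measure \<Rightarrow> ('a \<Rightarrow> 'x::real_normed_vector) \<Rightarrow> ennreal" where
  "variance_integral M f = (\<integral>\<^sup>+u. (\<integral>\<^sup>+v. ennreal ((norm (f u - f v))\<^sup>2) \<partial>M) \<partial>M)"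

context warped_system
begin

definition jump_energy :: "('y \<Rightarrow> 'x::real_normed_vector) \<Rightarrow> ennreal" where
  "jump_energy f = (\<Sum>s\<in>S. \<integral>\<^sup>+u\<in>dom s. ennreal ((norm (f u - f (the (s u))))\<^sup>2) \<partial>M)"

text \<open>Inversion permutes \<open>S\<close> and exchanges images with domains.\<close>

lemma jump_energy_altdef:
  "(\<Sum>s\<in>S. \<integral>\<^sup>+u\<in>ran s. ennreal ((norm (f u - f (the (partial_inv s u))))\<^sup>2) \<partial>M) = jump_energy f"
proof -
  have "bij_betw partial_inv S S"
    by (rule bij_betw_byWitness[where f' = partial_inv]) (auto simp: partial_inv_involutive S_inv)
  from sum.reindex_bij_betw[OF this,
      of "\<lambda>s. \<integral>\<^sup>+u\<in>dom s. ennreal ((norm (f u - f (the (s u))))\<^sup>2) \<partial>M"]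
  show ?thesis by (simp add: jump_energy_def dom_partial_inv)
qed

lemma has_spectral_gap_altdef:
  "has_spectral_gap TYPE('x::banach) M S \<longleftrightarrow>
    (\<exists>\<kappa>>0. \<forall>f :: 'y \<Rightarrow> 'x. f \<in> L2_functions M \<longrightarrow>
      ennreal \<kappa> * variance_integral M f \<le> jump_energy f)"
  by (simp add: has_spectral_gap_def jump_energy_altdef variance_integral_def)

end

context warped_net
begin

lemma nn_integral_step:
  fixes a :: "nat \<Rightarrow> real"
  assumes a: "\<And>i. i < n \<Longrightarrow> 0 \<le> a i"
  shows "(\<integral>\<^sup>+u. ennreal (a (p u)) \<partial>M) = ennreal (\<Sum>i<n. measure M (cell i) * a i)"
proof -
  have "(\<integral>\<^sup>+u. ennreal (a (p u)) \<partial>M) = (\<integral>\<^sup>+u. (\<Sum>i<n. ennreal (a i) * indicator (cell i) u) \<partial>M)"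
    by (simp only: sum_indicator_cell)
  also have "\<dots> = (\<Sum>i<n. \<integral>\<^sup>+u. ennreal (a i) * indicator (cell i) u \<partial>M)"
    by (intro nn_integral_sum borel_measurable_times_ennreal borel_measurable_const borel_measurable_indicator cell_sets)
  also have "\<dots> = (\<Sum>i<n. ennreal (a i) * emeasure M (cell i))"
    by (intro sum.cong refl nn_integral_cmult_indicator cell_sets)
  also have "\<dots> = (\<Sum>i<n. ennreal (measure M (cell i) * a i))"
    using a by (intro sum.cong refl) (simp add: emeasure_eq_measure ennreal_mult mult.commute)
  also have "\<dots> = ennreal (\<Sum>i<n. measure M (cell i) * a i)"
    using a by (intro sum_ennreal) auto
  finally show ?thesis .
qed

lemma variance_integral_step:
  fixes f :: "nat \<Rightarrow> 'x::real_normed_vector"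
  shows "variance_integral M (f \<circ> p) =
    ennreal (\<Sum>i<n. \<Sum>j<n. measure M (cell i) * measure M (cell j) * (norm (f i - f j))\<^sup>2)"
proof -
  have "variance_integral M (f \<circ> p) =
      (\<integral>\<^sup>+u. ennreal (\<Sum>j<n. measure M (cell j) * (norm (f (p u) - f j))\<^sup>2) \<partial>M)"
    unfolding variance_integral_def
    by (intro nn_integral_cong) (simp add: nn_integral_step[of "\<lambda>j. (norm (f (p _) - f j))\<^sup>2"])
  also have "\<dots> = ennreal (\<Sum>i<n. measure M (cell i) * (\<Sum>j<n. measure M (cell j) * (norm (f i - f j))\<^sup>2))"
    by (rule nn_integral_step[of "\<lambda>i. \<Sum>j<n. measure M (cell j) * (norm (f i - f j))\<^sup>2"]) (auto intro!: sum_nonneg)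
  finally show ?thesis by (simp add: sum_distrib_left mult.assoc)
qed

lemma step_function_L2:
  fixes f :: "nat \<Rightarrow> 'x::banach"
  shows "f \<circ> p \<in> L2_functions M"
proof -
  have simple: "simple_function M (f \<circ> p)"
    by (rule simple_function_compose[OF simple_function_nearest[OF net]])
  have "bochner_measurable M (f \<circ> p)"
    unfolding bochner_measurable_def using simple by (intro exI[of _ "\<lambda>_. f \<circ> p"]) auto
  moreover have "(\<integral>\<^sup>+u. ennreal ((norm ((f \<circ> p) u))\<^sup>2) \<partial>M) < \<infinity>"
    using nn_integral_step[of "\<lambda>i. (norm (f i))\<^sup>2"] by (simp add: o_def)
  ultimately show ?thesis by (simp add: L2_functions_def)
qed

lemma dirichlet_energy_eq_sum:
  "dirichlet_energy (parcs net_graph) f = (\<Sum>i<n. \<Sum>j\<in>parcs net_graph `` {i}. (norm (f i - f j))\<^sup>2)"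
proof -
  have "(\<Sum>i<n. \<Sum>j\<in>parcs net_graph `` {i}. (norm (f i - f j))\<^sup>2)
      = (\<Sum>(i, j)\<in>(SIGMA i:{..<n}. parcs net_graph `` {i}). (norm (f i - f j))\<^sup>2)"
    by (rule sum.Sigma) (simp_all add: finite_Image finite_parcs_net_graph)
  also have "(SIGMA i:{..<n}. parcs net_graph `` {i}) = parcs net_graph"
    using parcs_net_graph_subset by auto
  finally show ?thesis by (simp add: dirichlet_energy_def)
qed

text \<open>If \<open>s u = Some w\<close>, then \<open>p u\<close> and \<open>p w\<close> are equal or joined by an arc. So the integrand at \<open>u\<close> is
  bounded by the energy of the arcs at \<open>p u\<close>.\<close>

lemma jump_energy_step:
  fixes f :: "nat \<Rightarrow> 'x::real_normed_vector"
  shows "jump_energy (f \<circ> p) \<le> ennreal (card S * (cell_ratio / n) * dirichlet_energy (parcs net_graph) f)"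
proof -
  let ?E = "parcs net_graph"
  define a where "a i = (\<Sum>j\<in>?E `` {i}. (norm (f i - f j))\<^sup>2)" for i
  have a: "0 \<le> a i" for i unfolding a_def by (intro sum_nonneg) auto
  have "(\<integral>\<^sup>+u\<in>dom s. ennreal ((norm ((f \<circ> p) u - (f \<circ> p) (the (s u))))\<^sup>2) \<partial>M)
      \<le> (\<integral>\<^sup>+u. ennreal (a (p u)) \<partial>M)" if s: "s \<in> S" for s
  proof (rule nn_integral_mono)
    fix u
    have "(norm (f (p u) - f (p w)))\<^sup>2 \<le> a (p u)" if "s u = Some w" for w
    proof (cases "p u = p w")
      case False
      then have "p w \<in> ?E `` {p u}" using that s by (auto simp: parcs_net_graph linked_def)
      then show ?thesis
        unfolding a_def by (intro member_le_sum) (auto simp: finite_Image finite_parcs_net_graph)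
    qed (simp add: a)
    then show "ennreal ((norm ((f \<circ> p) u - (f \<circ> p) (the (s u))))\<^sup>2) * indicator (dom s) u \<le> ennreal (a (p u))"
      by (auto simp: indicator_def intro!: ennreal_leI)
  qed
  then have "jump_energy (f \<circ> p) \<le> (\<Sum>s\<in>S. \<integral>\<^sup>+u. ennreal (a (p u)) \<partial>M)"
    unfolding jump_energy_def by (rule sum_mono)
  also have "\<dots> = ennreal (card S) * ennreal (\<Sum>i<n. measure M (cell i) * a i)"
    using a by (simp add: nn_integral_step ennreal_of_nat_eq_real_of_nat)
  also have "\<dots> \<le> ennreal (card S) * ennreal (\<Sum>i<n. (cell_ratio / n) * a i)"
    using a measure_cell_bounds(2) by (intro mult_left_mono ennreal_leI sum_mono mult_right_mono) auto
  also have "(\<Sum>i<n. (cell_ratio / n) * a i) = cell_ratio / n * dirichlet_energy ?E f"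
    by (simp add: dirichlet_energy_eq_sum a_def sum_distrib_left)
  also have "ennreal (card S) * ennreal (cell_ratio / n * dirichlet_energy ?E f)
      = ennreal (card S * (cell_ratio / n) * dirichlet_energy ?E f)"
    using cell_ratio_ge_1 dirichlet_energy_nonneg[of ?E f] by (subst ennreal_mult[symmetric]) (auto simp: mult.assoc)
  finally show ?thesis .
qed

lemma net_graph_poincare_of_gap:
  fixes f :: "nat \<Rightarrow> 'x::banach"
  assumes \<kappa>: "0 < \<kappa>" and gap: "ennreal \<kappa> * variance_integral M (f \<circ> p) \<le> jump_energy (f \<circ> p)"
  shows "\<kappa> / (cell_ratio ^ 3 * (card S + 1)) / n * total_variance {..<n} f
    \<le> dirichlet_energy (parcs net_graph) f"
proof -
  let ?q = cell_ratio and ?T = "total_variance {..<n} f" and ?D = "dirichlet_energy (parcs net_graph) f"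
  have n: "0 < real n" and q: "0 < ?q" using n_pos cell_ratio_ge_1 by auto
  have D: "0 \<le> ?D" by (rule dirichlet_energy_nonneg)
  let ?Z = "\<Sum>i<n. \<Sum>j<n. measure M (cell i) * measure M (cell j) * (norm (f i - f j))\<^sup>2"
  have "(1 / (?q * n)) * (1 / (?q * n)) * ?T
      \<le> (\<Sum>i<n. \<Sum>j<n. measure M (cell i) * measure M (cell j) * (norm (f i - f j))\<^sup>2)"
    unfolding total_variance_def sum_distrib_left
    using measure_cell_bounds(1) q by (intro sum_mono mult_right_mono mult_mono) auto
  then have "\<kappa> * ((1 / (?q * n)) * (1 / (?q * n)) * ?T) \<le> \<kappa> * ?Z"
    using \<kappa> by (intro mult_left_mono) auto
  then have "ennreal (\<kappa> * ((1 / (?q * n)) * (1 / (?q * n)) * ?T)) \<le> ennreal (\<kappa> * ?Z)"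
    by (rule ennreal_leI)
  also have "\<dots> = ennreal \<kappa> * variance_integral M (f \<circ> p)"
    unfolding variance_integral_step using \<kappa> by (intro ennreal_mult) (auto intro!: sum_nonneg)
  also have "\<dots> \<le> ennreal (card S * (?q / n) * ?D)" using gap jump_energy_step by (rule order_trans)
  finally have "\<kappa> * ((1 / (?q * n)) * (1 / (?q * n)) * ?T) \<le> card S * (?q / n) * ?D"
    using D q by (subst (asm) ennreal_le_iff) auto
  also have "\<dots> \<le> (card S + 1) * (?q / n) * ?D"
    using D q by (intro mult_right_mono) auto
  finally have "(n / (?q * (card S + 1))) * (\<kappa> * ((1 / (?q * n)) * (1 / (?q * n)) * ?T))
      \<le> (n / (?q * (card S + 1))) * ((card S + 1) * (?q / n) * ?D)"
    using q by (intro mult_left_mono) auto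
  moreover have "(n / (?q * (card S + 1))) * ((card S + 1) * (?q / n) * ?D) = ?D"
  proof -
    have "x / (y * w) * (w * (y / x) * v) = v" if "0 < x" "0 < y" "0 < w" for x y w v :: real
      using that by (simp add: field_simps)
    then show ?thesis using n q by simp
  qed
  moreover have "(n / (?q * (card S + 1))) * (\<kappa> * ((1 / (?q * n)) * (1 / (?q * n)) * ?T))
      = \<kappa> / (?q ^ 3 * (card S + 1)) / n * ?T"
    using n q by (simp add: power3_eq_cube)
  ultimately show ?thesis by simp
qed

section \<open>Poincare inequalities inherited from an expander\<close>

text \<open>The bound of \<open>poincare_transfer\<close>, written out because one number has to serve all nets. Here
  \<open>R\<close> bounds the net graph distances that arise from arcs and from composing the quasi-isometry with its
  quasi-inverse, and \<open>N\<close> bounds the fibres of both maps by sizes of balls.\<close>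

definition transfer_constant :: "real \<Rightarrow> real \<Rightarrow> real \<Rightarrow> nat \<Rightarrow> real \<Rightarrow> real" where
  "transfer_constant A B Q k \<eta> =
     (let R = nat \<lceil>2 * (Q * (1 + 2 * B + A)) + 1\<rceil>;
          N = Suc degree_bound ^ nat \<lceil>2 * (Q * A) + 1\<rceil> + Suc k ^ nat \<lceil>2 * Q + A + 2 * B\<rceil>;
          K = real (R * (2 * Suc degree_bound) ^ R)
      in 8 * K + 4 * real N ^ 5 * K / \<eta>)"

text \<open>The restriction of the quasi-isometry to the net points and the nearest-point map of its quasi-inverse satisfy the
  hypotheses of \<open>poincare_transfer\<close>: distances in \<open>H\<close> bound warped distances, which bound distances in the net
  graph by \<open>gdist_le_warped_dist\<close>.\<close>

lemma net_graph_poincare_transfer: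
  fixes f :: "nat \<Rightarrow> 'x::banach" and H :: "'w pair_pre_digraph"
  assumes H: "pair_graph H" "Digraph_Component.connected (with_proj H)"
    and deg: "\<And>v. v \<in> pverts H \<Longrightarrow> card (parcs H `` {v}) \<le> k"
    and qi: "quasi_isometry A B Q (warped_cone S (1/r)) (graph_metric H) \<phi>"
    and AQ: "0 \<le> A" "0 < B" "1 \<le> Q" and \<eta>: "0 < \<eta>"
    and poincare: "\<And>g :: 'w \<Rightarrow> 'x. \<eta> / card (pverts H) * total_variance (pverts H) g
      \<le> dirichlet_energy (parcs H) g"
  shows "total_variance {..<n} f \<le> transfer_constant A B Q k \<eta> * n * dirichlet_energy (parcs net_graph) f"
proof -
  interpret H: pair_graph H by (rule H)
  have t: "0 < 1 / r" using r_pos by simp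
  let ?d = "warped_dist S (1/r)" and ?h = "mdist (graph_metric H)"
  interpret W: Metric_space UNIV ?d by (rule warped_dist_metric(1)[OF t])
  interpret G: Metric_space "pverts H" ?h
    using graph_metric_simps(1)[OF H] by (metis Metric_space_mspace_mdist)
  have \<phi>: "\<phi> x \<in> pverts H" "?d x y / Q - A \<le> ?h (\<phi> x) (\<phi> y)" "?h (\<phi> x) (\<phi> y) \<le> Q * ?d x y + A" for x y
    using qi unfolding quasi_isometry_def warped_cone_simps[OF t] graph_metric_simps(1)[OF H] by auto
  have "\<forall>h\<in>pverts H. \<exists>x. ?h (\<phi> x) h < B"
    using qi unfolding quasi_isometry_def warped_cone_simps[OF t] graph_metric_simps(1)[OF H] by auto
  then obtain \<xi> where \<xi>: "\<And>h. h \<in> pverts H \<Longrightarrow> ?h (\<phi> (\<xi> h)) h < B" by metis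
  have lower: "?d x y \<le> Q * (b + A)" if "?h (\<phi> x) (\<phi> y) \<le> b" for x y b
  proof -
    have "?d x y / Q \<le> b + A" using \<phi>(2)[of x y] that by simp
    then show ?thesis using AQ by (simp add: field_simps)
  qed
  have near: "p y \<in> walk_ball (parcs net_graph) (nat \<lceil>2 * b + 1\<rceil>) (p x)" if "?d x y \<le> b" for x y b
    using gdist_le_warped_dist[of x y] that p_less
    by (intro walk_ball_of_mdist[OF pair_graph_net_graph connected_net_graph]) auto
  have degH: "card (parcs H `` {v}) \<le> k" for v
  proof (cases "v \<in> pverts H")
    case False
    then have "parcs H `` {v} = {}" using H.in_arcsD1 by auto
    then show ?thesis by simp
  qed (rule deg)
  define R where "R = nat \<lceil>2 * (Q * (1 + 2 * B + A)) + 1\<rceil>"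
  define N where "N = Suc degree_bound ^ nat \<lceil>2 * (Q * A) + 1\<rceil> + Suc k ^ nat \<lceil>2 * Q + A + 2 * B\<rceil>"
  have "total_variance {..<n} f \<le> (8 * real (R * (2 * Suc degree_bound) ^ R)
      + 4 * real N ^ 5 * real (R * (2 * Suc degree_bound) ^ R) / \<eta>) * card {..<n} * dirichlet_energy (parcs net_graph) f"
  proof (rule poincare_transfer[where \<phi> = "\<phi> \<circ> z" and \<psi> = "p \<circ> \<xi>" and W = "pverts H" and E' = "parcs H"])
    show "card (parcs net_graph `` {x}) \<le> degree_bound" for x by (rule degree_net_graph)
    show "finite (pverts H)" by (rule H.pair_finite_verts)
    show "parcs H \<subseteq> pverts H \<times> pverts H" using H.in_arcsD1 H.in_arcsD2 by auto
    show "(\<phi> \<circ> z) v \<in> pverts H" for v using \<phi>(1) by simp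
    show "(p \<circ> \<xi>) w \<in> {..<n}" for w using p_less by simp
    show "card {v \<in> {..<n}. (\<phi> \<circ> z) v = w} \<le> N" for w
    proof (cases "{v \<in> {..<n}. (\<phi> \<circ> z) v = w} = {}")
      case False
      then obtain v0 where v0: "v0 < n" "\<phi> (z v0) = w" by auto
      have "{v \<in> {..<n}. (\<phi> \<circ> z) v = w} \<subseteq> walk_ball (parcs net_graph) (nat \<lceil>2 * (Q * A) + 1\<rceil>) v0"
      proof clarify
        fix v assume v: "v < n" "w = (\<phi> \<circ> z) v"
        then have "?h (\<phi> (z v0)) (\<phi> (z v)) \<le> 0" using v0 \<phi>(1) by simp
        then have "?d (z v0) (z v) \<le> Q * A" using lower by fastforce
        then show "v \<in> walk_ball (parcs net_graph) (nat \<lceil>2 * (Q * A) + 1\<rceil>) v0"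
          using near p_net_point v v0 by metis
      qed
      then have "card {v \<in> {..<n}. (\<phi> \<circ> z) v = w} \<le> Suc degree_bound ^ nat \<lceil>2 * (Q * A) + 1\<rceil>"
        using card_walk_ball[OF finite_parcs_net_graph degree_net_graph] card_mono le_trans by metis
      then show ?thesis by (simp add: N_def)
    qed (metis card.empty le0)
    show "card {w \<in> pverts H. (p \<circ> \<xi>) w = v} \<le> N" for v
    proof (cases "{w \<in> pverts H. (p \<circ> \<xi>) w = v} = {}")
      case False
      then obtain w0 where w0: "w0 \<in> pverts H" "p (\<xi> w0) = v" by auto
      have "{w \<in> pverts H. (p \<circ> \<xi>) w = v} \<subseteq> walk_ball (parcs H) (nat \<lceil>2 * Q + A + 2 * B\<rceil>) w0"
      proof clarify
        fix w assume w: "w \<in> pverts H" "v = (p \<circ> \<xi>) w"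
        have "?d (\<xi> w0) (\<xi> w) \<le> 2"
          using warped_dist_net_point[of "\<xi> w0"] warped_dist_net_point[of "\<xi> w"] w0 w
            W.triangle[of "\<xi> w0" "z v" "\<xi> w"] W.commute[of "\<xi> w" "z v"] by simp
        then have "Q * ?d (\<xi> w0) (\<xi> w) \<le> Q * 2" using AQ by (intro mult_left_mono) auto
        then have "?h (\<phi> (\<xi> w0)) (\<phi> (\<xi> w)) \<le> 2 * Q + A"
          using \<phi>(3)[of "\<xi> w0" "\<xi> w"] by simp
        then have "?h w0 w \<le> 2 * Q + A + 2 * B"
          using \<xi>[OF w0(1)] \<xi>[OF w(1)] \<phi>(1) w0 w G.triangle[of w0 "\<phi> (\<xi> w0)" w]
            G.triangle[of "\<phi> (\<xi> w0)" "\<phi> (\<xi> w)" w] G.commute[of w0 "\<phi> (\<xi> w0)"] by simp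
        then show "w \<in> walk_ball (parcs H) (nat \<lceil>2 * Q + A + 2 * B\<rceil>) w0"
          by (intro walk_ball_of_mdist[OF H w0(1) w(1)])
      qed
      then have "card {w \<in> pverts H. (p \<circ> \<xi>) w = v} \<le> Suc k ^ nat \<lceil>2 * Q + A + 2 * B\<rceil>"
        using card_walk_ball[OF H.pair_finite_arcs degH] card_mono le_trans by metis
      then show ?thesis by (simp add: N_def)
    qed (metis card.empty le0)
    show "(p \<circ> \<xi>) w' \<in> walk_ball (parcs net_graph) R ((p \<circ> \<xi>) w)" if "(w, w') \<in> parcs H" for w w'
    proof -
      have ww: "w \<in> pverts H" "w' \<in> pverts H" using that H.in_arcsD1 H.in_arcsD2 by auto
      have "?h w w' \<le> 1" using graph_dist_walk(2)[OF H ww, of 1] that by simp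
      then have "?h (\<phi> (\<xi> w)) (\<phi> (\<xi> w')) \<le> 1 + 2 * B"
        using \<xi>[OF ww(1)] \<xi>[OF ww(2)] \<phi>(1) ww G.triangle[of "\<phi> (\<xi> w)" w "\<phi> (\<xi> w')"]
          G.triangle[of w w' "\<phi> (\<xi> w')"] G.commute[of w' "\<phi> (\<xi> w')"] by simp
      from near[OF lower[OF this]] show ?thesis by (simp add: R_def)
    qed
    show "(p \<circ> \<xi>) ((\<phi> \<circ> z) v) \<in> walk_ball (parcs net_graph) R v" if "v \<in> {..<n}" for v
    proof -
      have "?h (\<phi> (z v)) (\<phi> (\<xi> (\<phi> (z v)))) \<le> 1 + 2 * B"
        using \<xi>[OF \<phi>(1), of "z v"] \<phi>(1) AQ G.commute[of "\<phi> (z v)" "\<phi> (\<xi> (\<phi> (z v)))"] by simp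
      from near[OF lower[OF this]] show ?thesis using that by (simp add: R_def p_net_point)
    qed
    show "\<eta> / card (pverts H) * total_variance (pverts H) (f \<circ> (p \<circ> \<xi>)) \<le> dirichlet_energy (parcs H) (f \<circ> (p \<circ> \<xi>))"
      by (rule poincare)
  qed (simp_all add: parcs_net_graph_subset sym_net_graph \<eta>)
  then show ?thesis by (simp add: transfer_constant_def R_def N_def Let_def)
qed

end

context warped_system
begin

section \<open>Sampling Lipschitz functions at net points\<close>

lemma S_continuous: "s \<in> S \<Longrightarrow> continuous_on (dom s) (\<lambda>x. the (s x))"
  using S_lipschitz by (rule lipschitz_on_continuous_on)

lemma S_inverse_lipschitz:
  assumes s: "s \<in> S"
  shows "L-lipschitz_on ((\<lambda>x. the (s x)) ` dom s) (\<lambda>x. the (partial_inv s x))"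
proof -
  have "(\<lambda>x. the (s x)) ` dom s = dom (partial_inv s)"
    unfolding dom_partial_inv by (force simp: ran_def)
  then show ?thesis using S_lipschitz[OF S_inv[OF s]] by simp
qed

definition push_constant :: real where "push_constant = C * (2 * L) powr m"

lemma push_constant_nonneg: "0 \<le> push_constant"
  using constants by (simp add: push_constant_def)

lemma nn_integral_jump_le:
  assumes s: "s \<in> S" and h: "h \<in> borel_measurable M"
  shows "(\<integral>\<^sup>+x\<in>dom s. h (the (s x)) \<partial>M) \<le> ennreal push_constant * (\<integral>\<^sup>+x. h x \<partial>M)"
  unfolding push_constant_def
proof (rule nn_integral_partial_vimage_le[OF S_closed[OF s] S_continuous[OF s] _ S_inverse_lipschitz[OF s] _ h])
  show "the (partial_inv s (the (s x))) = x" if "x \<in> dom s" for x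
    using that partial_inv_eq[OF s] by force
qed (use L_ge_1 in simp)

lemma jump_difference_measurable:
  fixes F G :: "'y \<Rightarrow> 'x::real_normed_vector"
  assumes s: "s \<in> S" and F: "strongly_measurable M F" and G: "strongly_measurable M G"
  shows "(\<lambda>u. ennreal ((norm (F u - G (the (s u))))\<^sup>2) * indicator (dom s) u) \<in> borel_measurable M"
proof -
  let ?R = "restrict_space M (dom s)"
  have "strongly_measurable ?R (\<lambda>u. F u)"
    by (rule strongly_measurable_compose[OF F]) (rule measurable_restrict_space1, simp)
  moreover have "strongly_measurable ?R (\<lambda>u. G (the (s u)))"
    by (rule strongly_measurable_compose[OF G]) (rule partial_map_measurable[OF S_continuous[OF s]])
  ultimately have "(\<lambda>u. norm (F u - G (the (s u)))) \<in> borel_measurable ?R"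
    by (intro strongly_measurable_norm strongly_measurable_diff)
  then have "(\<lambda>u. ennreal ((norm (F u - G (the (s u))))\<^sup>2)) \<in> borel_measurable ?R" by simp
  then show ?thesis
    using S_closed[OF s] by (subst (asm) borel_measurable_restrict_space_iff_ennreal) (auto simp: sets_M)
qed

end

context warped_net
begin

definition frontier_zone :: "('y \<rightharpoonup> 'y) \<Rightarrow> 'y set" where
  "frontier_zone s = (\<Union>x\<in>frontier (dom s). ball x (4 * r))"

lemma frontier_zone_sets [measurable]: "frontier_zone s \<in> sets M"
  by (auto simp: frontier_zone_def sets_M intro!: borel_open open_UN)

lemma dist_same_cell: "p y = p u \<Longrightarrow> dist y u < 2 * r"
  using p_close[of y] p_close[of u] dist_triangle2[of y u "z (p u)"] by simp

text \<open>A geodesic from \<open>y\<close> to a point of the cell outside \<open>dom s\<close> has length less than \<open>2 * r\<close> and meets the boundary.\<close>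

lemma straddling_cell_in_frontier_zone:
  assumes y: "y \<in> dom s" "p y = i" and u: "u \<in> cell i" and straddle: "\<not> cell i \<subseteq> dom s"
  shows "u \<in> frontier_zone s"
proof -
  obtain w where w: "p w = i" "w \<notin> dom s" using straddle by (auto simp: cell_def)
  obtain \<gamma> where \<gamma>: "\<gamma> 0 = y" "\<gamma> (dist y w) = w"
    "\<And>a b. a \<in> {0..dist y w} \<Longrightarrow> b \<in> {0..dist y w} \<Longrightarrow> dist (\<gamma> a) (\<gamma> b) = \<bar>a - b\<bar>"
    using geodesic unfolding geodesic_set_def by (metis UNIV_I)
  have "1-lipschitz_on {0..dist y w} \<gamma>"
    using \<gamma>(3) by (intro lipschitz_onI) (auto simp: dist_real_def)
  then have "Topological_Spaces.connected (\<gamma> ` {0..dist y w})"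
    by (intro connected_continuous_image lipschitz_on_continuous_on) auto
  moreover have "y \<in> \<gamma> ` {0..dist y w}" "w \<in> \<gamma> ` {0..dist y w}"
    using \<gamma>(1,2) by (force intro: image_eqI[of _ _ 0], force intro: image_eqI[of _ _ "dist y w"])
  ultimately have "\<gamma> ` {0..dist y w} \<inter> frontier (dom s) \<noteq> {}"
    using y(1) w(2) by (intro connected_Int_frontier) auto
  then obtain a where a: "a \<in> {0..dist y w}" "\<gamma> a \<in> frontier (dom s)" by blast
  have "dist y (\<gamma> a) = a" using \<gamma>(3)[of 0 a] a(1) \<gamma>(1) by simp
  also have "a \<le> dist y w" using a by simp
  also have "\<dots> < 2 * r" using dist_same_cell y w by simp
  finally have "dist (\<gamma> a) u < 4 * r"
    using dist_same_cell[of y u] y u dist_triangle3[of "\<gamma> a" u y] by (simp add: cell_def)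
  then show ?thesis using a(2) by (auto simp: frontier_zone_def)
qed

definition majorant_constant :: real where
  "majorant_constant = 13 + 4 * (2 * L + 1)\<^sup>2"

text \<open>The first summand covers the oscillation of \<open>h\<close> over a few cells, the others arise for arcs created by \<open>s\<close>. The arcs see
  the Lipschitz function \<open>h\<close>, whereas the final estimate concerns the jumps of \<open>F\<close>; the last two norms account
  for the difference.\<close>

definition majorant :: "('y \<Rightarrow> 'x::real_normed_vector) \<Rightarrow> ('y \<Rightarrow> 'x) \<Rightarrow> real \<Rightarrow> real \<Rightarrow> 'y \<Rightarrow> ennreal" where
  "majorant F h \<Lambda> b u = ennreal (majorant_constant * (\<Lambda> * r)\<^sup>2) +
     (\<Sum>s\<in>S. ennreal (4 * b\<^sup>2) * indicator (frontier_zone s) u +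
       ennreal 16 * (ennreal ((norm (F u - F (the (s u))))\<^sup>2) * indicator (dom s) u
         + ennreal ((norm (h u - F u))\<^sup>2) * indicator (dom s) u
         + ennreal ((norm (F (the (s u)) - h (the (s u))))\<^sup>2) * indicator (dom s) u))"

text \<open>An arc between nearby cells is controlled by the Lipschitz constant. For an arc coming from \<open>s y = Some y'\<close>
  the pair \<open>(y, y')\<close> may be replaced by \<open>(u, s u)\<close> if the whole cell lies in \<open>dom s\<close>. Otherwise \<open>u\<close> is close
  to the boundary of \<open>dom s\<close>, and the trivial bound by \<open>2 * b\<close> suffices, as such points are rare.\<close>

lemma arc_difference_le_majorant:
  fixes F h :: "'y \<Rightarrow> 'x::real_normed_vector" and b w \<Lambda> \<delta> :: real
  assumes h: "\<Lambda>-lipschitz_on UNIV h" and b: "\<And>y. norm (h y) \<le> b"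
    and arc: "(i, j) \<in> parcs net_graph" and u: "u \<in> cell i"
  shows "ennreal ((norm (h (z i) - h (z j)))\<^sup>2) \<le> majorant F h \<Lambda> b u"
proof -
  have lip: "norm (h x - h y) \<le> \<Lambda> * dist x y" for x y
    using h by (auto simp: lipschitz_on_def dist_norm)
  have \<Lambda>: "0 \<le> \<Lambda>" using h by (rule lipschitz_on_nonneg)
  have lip_sq: "(norm (h x - h y))\<^sup>2 \<le> a\<^sup>2 * (\<Lambda> * r)\<^sup>2" if "dist x y \<le> a * r" for x y a
  proof -
    have "norm (h x - h y) \<le> \<Lambda> * (a * r)" using lip[of x y] that \<Lambda> mult_left_mono order_trans by blast
    then have "(norm (h x - h y))\<^sup>2 \<le> (\<Lambda> * (a * r))\<^sup>2" by (intro power_mono) auto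
    then show ?thesis by (simp add: power_mult_distrib mult_ac)
  qed
  let ?c = "majorant_constant * (\<Lambda> * r)\<^sup>2"
  let ?T = "\<lambda>s. ennreal (4 * b\<^sup>2) * indicator (frontier_zone s) u +
       ennreal 16 * (ennreal ((norm (F u - F (the (s u))))\<^sup>2) * indicator (dom s) u
         + ennreal ((norm (h u - F u))\<^sup>2) * indicator (dom s) u
         + ennreal ((norm (F (the (s u)) - h (the (s u))))\<^sup>2) * indicator (dom s) u)"
  have c: "0 \<le> ?c" by (simp add: majorant_constant_def)
  have single: ?thesis if "s \<in> S" "ennreal ((norm (h (z i) - h (z j)))\<^sup>2) \<le> ennreal ?c + ?T s" for s
  proof -
    have "?T s \<le> (\<Sum>s\<in>S. ?T s)"
      using finite_S that(1) by (intro member_le_sum) auto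
    then show ?thesis unfolding majorant_def using that(2) by (meson add_left_mono order_trans)
  qed
  obtain y y' where y: "p y = i" "p y' = j" "linked y y'" using arc by (auto simp: parcs_net_graph)
  show ?thesis
  proof (cases "dist y y' \<le> r")
    case True
    have "dist (z i) (z j) \<le> dist y (z i) + (dist y y' + dist y' (z j))"
      using dist_triangle3[of "z i" "z j" y] dist_triangle[of y "z j" y'] by simp
    then have "dist (z i) (z j) \<le> 3 * r" using True p_close[of y] p_close[of y'] y by simp
    from lip_sq[OF this] have "(norm (h (z i) - h (z j)))\<^sup>2 \<le> ?c"
      by (rule order_trans) (intro mult_right_mono, auto simp: majorant_constant_def)
    then have "ennreal ((norm (h (z i) - h (z j)))\<^sup>2) \<le> ennreal ?c" by (rule ennreal_leI)
    then show ?thesis unfolding majorant_def by (rule order_trans) simp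
  next
    case False
    then obtain s where s: "s \<in> S" "s y = Some y'" using y(3) by (auto simp: linked_def)
    show ?thesis
    proof (rule single[OF s(1)], cases "cell i \<subseteq> dom s")
      case True
      then obtain w where w: "s u = Some w" using u by auto
      have "dist (z i) u \<le> 1 * r" using u p_close[of u] by (auto simp: cell_def dist_commute)
      note d1 = lip_sq[OF this]
      have "dist y' w \<le> L * dist y u" by (rule S_dist_le[OF s w])
      also have "\<dots> \<le> L * (2 * r)"
        using dist_same_cell[of y u] y u L_ge_1 by (intro mult_left_mono) (auto simp: cell_def)
      finally have "dist w (z j) \<le> (2 * L + 1) * r"
        using p_close[of y'] y dist_triangle3[of w "z j" y'] by (simp add: algebra_simps)
      note d2 = lip_sq[OF this]
      have e1: "(norm (h (z i) - h (z j)))\<^sup>2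
          \<le> 4 * (norm (h (z i) - h u))\<^sup>2 + 4 * (norm (h u - h w))\<^sup>2 + 4 * (norm (h w - h (z j)))\<^sup>2"
        by (rule power2_norm_diff_le3)
      have e2: "(norm (h u - h w))\<^sup>2 \<le> 4 * (norm (h u - F u))\<^sup>2 + 4 * (norm (F u - F w))\<^sup>2 + 4 * (norm (F w - h w))\<^sup>2"
        by (rule power2_norm_diff_le3)
      have e3: "(norm (h (z i) - h (z j)))\<^sup>2 \<le> 4 * (1\<^sup>2 * (\<Lambda> * r)\<^sup>2) + 4 * ((2 * L + 1)\<^sup>2 * (\<Lambda> * r)\<^sup>2)
          + 16 * ((norm (F u - F w))\<^sup>2 + (norm (h u - F u))\<^sup>2 + (norm (F w - h w))\<^sup>2)"
        using d1 d2 e1 e2 by (simp only: distrib_left)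
      have e4: "4 * (1\<^sup>2 * (\<Lambda> * r)\<^sup>2) + 4 * ((2 * L + 1)\<^sup>2 * (\<Lambda> * r)\<^sup>2) \<le> ?c"
        unfolding majorant_constant_def distrib_right by (simp add: mult.assoc)
      have "ennreal ((norm (h (z i) - h (z j)))\<^sup>2)
          \<le> ennreal (?c + 16 * ((norm (F u - F w))\<^sup>2 + (norm (h u - F u))\<^sup>2 + (norm (F w - h w))\<^sup>2))"
        using e3 e4 by (intro ennreal_leI) linarith
      also have "\<dots> = ennreal ?c + ennreal 16 * (ennreal ((norm (F u - F w))\<^sup>2)
          + ennreal ((norm (h u - F u))\<^sup>2) + ennreal ((norm (F w - h w))\<^sup>2))"
        using c by (simp add: ennreal_mult ennreal_plus distrib_left add.assoc del: ennreal_numeral)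
      also have "\<dots> \<le> ennreal ?c + ?T s"
        using w by (intro add_left_mono) (auto simp: domI)
      finally show "ennreal ((norm (h (z i) - h (z j)))\<^sup>2) \<le> ennreal ?c + ?T s" .
    next
      case False
      then have zone: "u \<in> frontier_zone s"
        using s y u by (intro straddling_cell_in_frontier_zone[of y]) auto
      have "norm (h (z i) - h (z j)) \<le> 2 * b"
        using b[of "z i"] b[of "z j"] norm_triangle_ineq4[of "h (z i)" "h (z j)"] by simp
      then have "(norm (h (z i) - h (z j)))\<^sup>2 \<le> (2 * b)\<^sup>2" by (intro power_mono) auto
      then have "ennreal ((norm (h (z i) - h (z j)))\<^sup>2) \<le> ennreal (4 * b\<^sup>2)"
        by (intro ennreal_leI) (simp add: power_mult_distrib)
      also have "\<dots> = ennreal (4 * b\<^sup>2) * indicator (frontier_zone s) u" using zone by simp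
      also have "\<dots> \<le> ennreal ?c + ?T s" by (simp add: add_increasing)
      finally show "ennreal ((norm (h (z i) - h (z j)))\<^sup>2) \<le> ennreal ?c + ?T s" .
    qed
  qed
qed

lemma majorant_parts_measurable:
  fixes F h :: "'y \<Rightarrow> 'x::real_normed_vector" and b w \<Lambda> \<delta> :: real
  assumes F: "strongly_measurable M F" and h: "strongly_measurable M h"
  shows "(\<lambda>u. ennreal ((norm (F u - h u))\<^sup>2)) \<in> borel_measurable M"
    and "(\<lambda>u. a * indicator (frontier_zone s) u :: ennreal) \<in> borel_measurable M"
    and "s \<in> S \<Longrightarrow> (\<lambda>u. ennreal ((norm (F u - F (the (s u))))\<^sup>2) * indicator (dom s) u) \<in> borel_measurable M"
    and "s \<in> S \<Longrightarrow> (\<lambda>u. ennreal ((norm (h u - F u))\<^sup>2) * indicator (dom s) u) \<in> borel_measurable M"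
    and "s \<in> S \<Longrightarrow> (\<lambda>u. ennreal ((norm (F (the (s u)) - h (the (s u))))\<^sup>2) * indicator (dom s) u)
      \<in> borel_measurable M"
proof -
  show Fh: "(\<lambda>u. ennreal ((norm (F u - h u))\<^sup>2)) \<in> borel_measurable M"
    using strongly_measurable_norm[OF strongly_measurable_diff[OF F h]] by measurable
  show "(\<lambda>u. a * indicator (frontier_zone s) u :: ennreal) \<in> borel_measurable M" by measurable
  assume s: "s \<in> S"
  show "(\<lambda>u. ennreal ((norm (F u - F (the (s u))))\<^sup>2) * indicator (dom s) u) \<in> borel_measurable M"
    by (rule jump_difference_measurable[OF s F F])
  show "(\<lambda>u. ennreal ((norm (h u - F u))\<^sup>2) * indicator (dom s) u) \<in> borel_measurable M"
    using Fh S_closed[OF s] sets_M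
    by (intro borel_measurable_times_ennreal borel_measurable_indicator) (auto simp: norm_minus_commute)
  have "strongly_measurable M (\<lambda>u. 0 :: 'x)" by (intro strongly_measurable_simple) simp
  from jump_difference_measurable[OF s this strongly_measurable_diff[OF F h]]
  show "(\<lambda>u. ennreal ((norm (F (the (s u)) - h (the (s u))))\<^sup>2) * indicator (dom s) u) \<in> borel_measurable M"
    by (simp add: norm_minus_commute)
qed

lemma majorant_summand_measurable:
  fixes F h :: "'y \<Rightarrow> 'x::real_normed_vector" and b w \<Lambda> \<delta> :: real
  assumes Fh: "strongly_measurable M F" "strongly_measurable M h" and s: "s \<in> S"
  shows "(\<lambda>u. ennreal (4 * b\<^sup>2) * indicator (frontier_zone s) u +
       ennreal 16 * (ennreal ((norm (F u - F (the (s u))))\<^sup>2) * indicator (dom s) u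
         + ennreal ((norm (h u - F u))\<^sup>2) * indicator (dom s) u
         + ennreal ((norm (F (the (s u)) - h (the (s u))))\<^sup>2) * indicator (dom s) u)) \<in> borel_measurable M"
proof -
  note parts = majorant_parts_measurable[OF Fh]
  have "(\<lambda>u. ennreal ((norm (F u - F (the (s u))))\<^sup>2) * indicator (dom s) u
         + ennreal ((norm (h u - F u))\<^sup>2) * indicator (dom s) u
         + ennreal ((norm (F (the (s u)) - h (the (s u))))\<^sup>2) * indicator (dom s) u) \<in> borel_measurable M"
    by (rule borel_measurable_add[OF borel_measurable_add[OF parts(3)[OF s] parts(4)[OF s]] parts(5)[OF s]])
  from borel_measurable_add[OF parts(2) borel_measurable_times_ennreal[OF borel_measurable_const this]]
  show ?thesis .
qed

lemma majorant_measurable: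
  fixes F h :: "'y \<Rightarrow> 'x::real_normed_vector" and b w \<Lambda> \<delta> :: real
  assumes "strongly_measurable M F" "strongly_measurable M h"
  shows "majorant F h \<Lambda> b \<in> borel_measurable M"
  unfolding majorant_def[abs_def]
  by (rule borel_measurable_add, simp, rule borel_measurable_sum)
    (rule majorant_summand_measurable[OF assms])

text \<open>The distance of \<open>F\<close> and \<open>h\<close> enters at \<open>u\<close> and at \<open>s u\<close>; the second integral is bounded by the first since
  \<open>s\<close> changes the measure by at most the factor \<open>push_constant\<close>.\<close>

lemma nn_integral_majorant_le:
  fixes F h :: "'y \<Rightarrow> 'x::real_normed_vector" and b w \<Lambda> \<delta> :: real
  assumes F: "strongly_measurable M F" and h: "strongly_measurable M h"
    and zones: "\<And>s. s \<in> S \<Longrightarrow> measure M (frontier_zone s) \<le> w"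
    and \<delta>: "(\<integral>\<^sup>+u. ennreal ((norm (F u - h u))\<^sup>2) \<partial>M) \<le> ennreal \<delta>" "0 \<le> \<delta>"
  shows "(\<integral>\<^sup>+u. majorant F h \<Lambda> b u \<partial>M)
    \<le> ennreal (majorant_constant * (\<Lambda> * r)\<^sup>2 + card S * (4 * b\<^sup>2 * w) + 16 * (card S * ((1 + push_constant) * \<delta>)))
      + ennreal 16 * jump_energy F"
proof -
  let ?c = "majorant_constant * (\<Lambda> * r)\<^sup>2"
  let ?I = "\<lambda>s u. ennreal (4 * b\<^sup>2) * indicator (frontier_zone s) u"
  let ?P = "\<lambda>s u. ennreal ((norm (F u - F (the (s u))))\<^sup>2) * indicator (dom s) u"
  let ?Q = "\<lambda>s u. ennreal ((norm (h u - F u))\<^sup>2) * indicator (dom s) u"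
  let ?R = "\<lambda>s u. ennreal ((norm (F (the (s u)) - h (the (s u))))\<^sup>2) * indicator (dom s) u"
  have c: "0 \<le> ?c" by (simp add: majorant_constant_def)
  note parts = majorant_parts_measurable[OF F h]
  note Fh = parts(1) and I = parts(2) and P = parts(3) and Q = parts(4) and R = parts(5)
  note term_measurable = majorant_summand_measurable[OF F h]
  have bound: "(\<integral>\<^sup>+u. ?I s u + ennreal 16 * (?P s u + ?Q s u + ?R s u) \<partial>M)
      \<le> ennreal (4 * b\<^sup>2 * w + 16 * ((1 + push_constant) * \<delta>)) + ennreal 16 * (\<integral>\<^sup>+u. ?P s u \<partial>M)"
    if s: "s \<in> S" for s
  proof -
    have 1: "(\<integral>\<^sup>+u. ?I s u \<partial>M) \<le> ennreal (4 * b\<^sup>2 * w)"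
    proof -
      have "(\<integral>\<^sup>+u. ?I s u \<partial>M) = ennreal (4 * b\<^sup>2 * measure M (frontier_zone s))"
        by (simp add: nn_integral_cmult_indicator emeasure_eq_measure ennreal_mult)
      also have "\<dots> \<le> ennreal (4 * b\<^sup>2 * w)"
        using zones[OF s] by (intro ennreal_leI mult_left_mono) auto
      finally show ?thesis .
    qed
    have "(\<integral>\<^sup>+u. ?Q s u \<partial>M) \<le> (\<integral>\<^sup>+u. ennreal ((norm (F u - h u))\<^sup>2) \<partial>M)"
      by (intro nn_integral_mono) (auto simp: indicator_def norm_minus_commute)
    then have 2: "(\<integral>\<^sup>+u. ?Q s u \<partial>M) \<le> ennreal \<delta>" using \<delta>(1) by (rule order_trans)
    have "(\<integral>\<^sup>+u. ?R s u \<partial>M) \<le> ennreal push_constant * (\<integral>\<^sup>+u. ennreal ((norm (F u - h u))\<^sup>2) \<partial>M)"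
      by (rule nn_integral_jump_le[OF s Fh])
    also have "\<dots> \<le> ennreal push_constant * ennreal \<delta>" using \<delta>(1) by (rule mult_left_mono) simp
    finally have 3: "(\<integral>\<^sup>+u. ?R s u \<partial>M) \<le> ennreal (push_constant * \<delta>)"
      using push_constant_nonneg \<delta>(2) by (simp add: ennreal_mult)
    have "(\<integral>\<^sup>+u. ?I s u + ennreal 16 * (?P s u + ?Q s u + ?R s u) \<partial>M)
        = (\<integral>\<^sup>+u. ?I s u \<partial>M) + ennreal 16 * ((\<integral>\<^sup>+u. ?P s u \<partial>M) + (\<integral>\<^sup>+u. ?Q s u \<partial>M) + (\<integral>\<^sup>+u. ?R s u \<partial>M))"
      using I P[OF s] Q[OF s] R[OF s] by (simp add: nn_integral_add nn_integral_cmult del: ennreal_numeral)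
    also have "\<dots> \<le> ennreal (4 * b\<^sup>2 * w) + ennreal 16 * ((\<integral>\<^sup>+u. ?P s u \<partial>M) + ennreal \<delta> + ennreal (push_constant * \<delta>))"
      using 1 2 3 by (intro add_mono mult_left_mono order_refl) auto
    also have "\<dots> = ennreal (4 * b\<^sup>2 * w + 16 * ((1 + push_constant) * \<delta>)) + ennreal 16 * (\<integral>\<^sup>+u. ?P s u \<partial>M)"
    proof -
      have w: "0 \<le> w" using zones[OF s] measure_nonneg order_trans by blast
      have "ennreal 16 * (ennreal \<delta> + ennreal (push_constant * \<delta>)) = ennreal (16 * ((1 + push_constant) * \<delta>))"
        using push_constant_nonneg \<delta>(2)
        by (simp add: distrib_right flip: ennreal_mult ennreal_plus del: ennreal_numeral)
      moreover have "ennreal (4 * b\<^sup>2 * w + 16 * ((1 + push_constant) * \<delta>))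
          = ennreal (4 * b\<^sup>2 * w) + ennreal (16 * ((1 + push_constant) * \<delta>))"
        using push_constant_nonneg \<delta>(2) w by (intro ennreal_plus) auto
      ultimately show ?thesis by (simp add: distrib_left ac_simps del: ennreal_numeral)
    qed
    finally show ?thesis .
  qed
  have "(\<integral>\<^sup>+u. majorant F h \<Lambda> b u \<partial>M)
      = ennreal ?c + (\<Sum>s\<in>S. \<integral>\<^sup>+u. ?I s u + ennreal 16 * (?P s u + ?Q s u + ?R s u) \<partial>M)"
    unfolding majorant_def
    using term_measurable
    by (simp add: nn_integral_add nn_integral_sum emeasure_space_1[simplified] borel_measurable_sum del: ennreal_numeral)
  also have "\<dots> \<le> ennreal ?c + (\<Sum>s\<in>S. ennreal (4 * b\<^sup>2 * w + 16 * ((1 + push_constant) * \<delta>))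
      + ennreal 16 * (\<integral>\<^sup>+u. ?P s u \<partial>M))"
    using bound by (intro add_left_mono sum_mono)
  also have "\<dots> = ennreal ?c + ennreal (card S * (4 * b\<^sup>2 * w + 16 * ((1 + push_constant) * \<delta>)))
      + ennreal 16 * jump_energy F"
    by (simp add: sum.distrib jump_energy_def sum_distrib_left ennreal_mult' ennreal_of_nat_eq_real_of_nat
        add.assoc del: ennreal_numeral)
  also have "ennreal ?c + ennreal (card S * (4 * b\<^sup>2 * w + 16 * ((1 + push_constant) * \<delta>)))
      = ennreal (?c + card S * (4 * b\<^sup>2 * w) + 16 * (card S * ((1 + push_constant) * \<delta>)))"
  proof (cases "S = {}")
    case False
    then obtain s where "s \<in> S" by auto
    then have "0 \<le> w" using zones measure_nonneg order_trans by blast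
    then show ?thesis
      using c push_constant_nonneg \<delta>(2)
      by (subst ennreal_plus[symmetric]) (auto simp: algebra_simps)
  qed (use c in simp)
  finally show ?thesis .
qed

text \<open>The difference across an arc is bounded by the majorant at each point of the cell where the arc starts, so it can be averaged
  over this cell, which has measure at least \<open>1 / (cell_ratio * n)\<close>.\<close>

lemma dirichlet_energy_le_majorant:
  fixes F h :: "'y \<Rightarrow> 'x::real_normed_vector" and b w \<Lambda> \<delta> :: real
  assumes F: "strongly_measurable M F" and h: "\<Lambda>-lipschitz_on UNIV h" and b: "\<And>y. norm (h y) \<le> b"
  shows "ennreal (dirichlet_energy (parcs net_graph) (h \<circ> z))
    \<le> ennreal (cell_ratio * n * degree_bound) * (\<integral>\<^sup>+u. majorant F h \<Lambda> b u \<partial>M)"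
proof -
  let ?E = "parcs net_graph"
  define a where "a i = (\<Sum>j\<in>?E `` {i}. (norm ((h \<circ> z) i - (h \<circ> z) j))\<^sup>2)" for i
  have a: "0 \<le> a i" for i unfolding a_def by (intro sum_nonneg) auto
  have q: "0 < cell_ratio * n" using cell_ratio_ge_1 n_pos by simp
  have "ennreal (a (p u)) \<le> ennreal degree_bound * majorant F h \<Lambda> b u" for u
  proof -
    have "ennreal (a (p u)) = (\<Sum>j\<in>?E `` {p u}. ennreal ((norm (h (z (p u)) - h (z j)))\<^sup>2))"
      unfolding a_def by (simp add: sum_ennreal)
    also have "\<dots> \<le> (\<Sum>j\<in>?E `` {p u}. majorant F h \<Lambda> b u)"
      by (intro sum_mono arc_difference_le_majorant[OF h b]) (auto simp: cell_def)
    also have "\<dots> = of_nat (card (?E `` {p u})) * majorant F h \<Lambda> b u" by simp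
    also have "\<dots> \<le> of_nat degree_bound * majorant F h \<Lambda> b u"
      using degree_net_graph by (intro mult_right_mono) auto
    finally show ?thesis by (simp add: ennreal_of_nat_eq_real_of_nat)
  qed
  then have le: "(\<integral>\<^sup>+u. ennreal (a (p u)) \<partial>M) \<le> (\<integral>\<^sup>+u. ennreal degree_bound * majorant F h \<Lambda> b u \<partial>M)"
    by (rule nn_integral_mono)
  have "dirichlet_energy ?E (h \<circ> z) = (\<Sum>i<n. a i)" by (simp add: dirichlet_energy_eq_sum a_def)
  also have "\<dots> \<le> (\<Sum>i<n. (cell_ratio * n) * (measure M (cell i) * a i))"
  proof (intro sum_mono)
    fix i assume "i \<in> {..<n}"
    then have "1 \<le> (cell_ratio * n) * measure M (cell i)"
      using measure_cell_bounds(1)[of i] q by (simp add: field_simps)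
    from mult_right_mono[OF this a] show "a i \<le> (cell_ratio * n) * (measure M (cell i) * a i)"
      by (simp add: mult.assoc)
  qed
  also have "\<dots> = (cell_ratio * n) * (\<Sum>i<n. measure M (cell i) * a i)" by (simp add: sum_distrib_left)
  finally have "ennreal (dirichlet_energy ?E (h \<circ> z)) \<le> ennreal (cell_ratio * n) * ennreal (\<Sum>i<n. measure M (cell i) * a i)"
    using q a by (subst ennreal_mult[symmetric]) (auto intro!: ennreal_leI sum_nonneg)
  also have "\<dots> = ennreal (cell_ratio * n) * (\<integral>\<^sup>+u. ennreal (a (p u)) \<partial>M)"
    using a by (simp add: nn_integral_step)
  also have "\<dots> \<le> ennreal (cell_ratio * n) * (\<integral>\<^sup>+u. ennreal degree_bound * majorant F h \<Lambda> b u \<partial>M)"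
    using le by (rule mult_left_mono) simp
  also have "(\<integral>\<^sup>+u. ennreal degree_bound * majorant F h \<Lambda> b u \<partial>M) = ennreal degree_bound * (\<integral>\<^sup>+u. majorant F h \<Lambda> b u \<partial>M)"
    by (rule nn_integral_cmult[OF majorant_measurable[OF F strongly_measurable_lipschitz[OF h]]])
  finally show ?thesis
    unfolding ennreal_mult[OF less_imp_le[OF q] of_nat_0_le_iff] by (simp only: mult.assoc)
qed

end

context warped_net
begin

section \<open>From expanders to a spectral gap\<close>

lemma variance_le_step_variance:
  fixes F h :: "'y \<Rightarrow> 'x::real_normed_vector"
  assumes F: "strongly_measurable M F" and h: "\<Lambda>-lipschitz_on UNIV h"
    and \<delta>: "(\<integral>\<^sup>+u. ennreal ((norm (F u - h u))\<^sup>2) \<partial>M) \<le> ennreal \<delta>" "0 \<le> \<delta>"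
  shows "variance_integral M F \<le> ennreal (8 * \<delta> + 32 * (\<Lambda> * r)\<^sup>2) + ennreal 16 * variance_integral M (h \<circ> z \<circ> p)"
proof -
  let ?G = "\<lambda>u. ennreal ((norm (F u - h u))\<^sup>2)"
  let ?D = "\<lambda>u v. ennreal ((norm ((h \<circ> z \<circ> p) u - (h \<circ> z \<circ> p) v))\<^sup>2)"
  let ?c = "32 * (\<Lambda> * r)\<^sup>2"
  have G[measurable]: "?G \<in> borel_measurable M"
    using strongly_measurable_norm[OF strongly_measurable_diff[OF F strongly_measurable_lipschitz[OF h]]]
    by measurable
  have step[measurable]: "(\<lambda>u. a (p u)) \<in> borel_measurable M" for a :: "nat \<Rightarrow> ennreal"
    by (rule measurable_compose[OF nearest_measurable[OF sets_M net]]) simp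
  have close: "(norm (h u - h (z (p u))))\<^sup>2 \<le> (\<Lambda> * r)\<^sup>2" for u
  proof -
    have "norm (h u - h (z (p u))) \<le> \<Lambda> * dist u (z (p u))"
      using h by (auto simp: lipschitz_on_def dist_norm)
    also have "\<dots> \<le> \<Lambda> * r"
      by (rule mult_left_mono[OF less_imp_le[OF p_close] lipschitz_on_nonneg[OF h]])
    finally show ?thesis by (intro power_mono) auto
  qed
  have pointwise: "ennreal ((norm (F u - F v))\<^sup>2)
      \<le> ennreal 4 * ?G u + ennreal ?c + (ennreal 4 * ?G v + ennreal 16 * ?D u v)" for u v
  proof -
    have "(norm (F u - F v))\<^sup>2 \<le> 4 * (norm (F u - h u))\<^sup>2 + 4 * (norm (h u - h v))\<^sup>2 + 4 * (norm (F v - h v))\<^sup>2"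
      using power2_norm_diff_le3[of "F u" "F v" "h u" "h v"] by (simp add: norm_minus_commute)
    moreover have "(norm (h u - h v))\<^sup>2 \<le> 4 * (\<Lambda> * r)\<^sup>2 + 4 * (norm (h (z (p u)) - h (z (p v))))\<^sup>2 + 4 * (\<Lambda> * r)\<^sup>2"
      using power2_norm_diff_le3[of "h u" "h v" "h (z (p u))" "h (z (p v))"] close[of u] close[of v]
      by (simp add: norm_minus_commute)
    ultimately have "(norm (F u - F v))\<^sup>2 \<le> 4 * (norm (F u - h u))\<^sup>2 + ?c
        + (4 * (norm (F v - h v))\<^sup>2 + 16 * (norm (h (z (p u)) - h (z (p v))))\<^sup>2)"
      by linarith
    then have "ennreal ((norm (F u - F v))\<^sup>2) \<le> ennreal (4 * (norm (F u - h u))\<^sup>2 + ?c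
        + (4 * (norm (F v - h v))\<^sup>2 + 16 * (norm (h (z (p u)) - h (z (p v))))\<^sup>2))"
      by (rule ennreal_leI)
    also have "\<dots> = ennreal 4 * ?G u + ennreal ?c + (ennreal 4 * ?G v + ennreal 16 * ?D u v)"
      by (simp add: ennreal_plus ennreal_mult del: ennreal_numeral)
    finally show ?thesis .
  qed
  have D_meas: "(\<lambda>v. ?D u v) \<in> borel_measurable M" for u
    using step[of "\<lambda>j. ennreal ((norm ((h \<circ> z) (p u) - (h \<circ> z) j))\<^sup>2)"] by (simp add: o_def)
  have inner_meas: "(\<lambda>u. \<integral>\<^sup>+v. ?D u v \<partial>M) \<in> borel_measurable M"
    using step[of "\<lambda>i. \<integral>\<^sup>+v. ennreal ((norm ((h \<circ> z) i - (h \<circ> z \<circ> p) v))\<^sup>2) \<partial>M"] by (simp add: o_def)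
  have inner: "(\<integral>\<^sup>+v. ennreal ((norm (F u - F v))\<^sup>2) \<partial>M)
      \<le> ennreal 4 * ?G u + ennreal ?c + (ennreal 4 * ennreal \<delta> + ennreal 16 * (\<integral>\<^sup>+v. ?D u v \<partial>M))" for u
  proof -
    have "(\<integral>\<^sup>+v. ennreal ((norm (F u - F v))\<^sup>2) \<partial>M)
        \<le> (\<integral>\<^sup>+v. (ennreal 4 * ?G u + ennreal ?c) + (ennreal 4 * ?G v + ennreal 16 * ?D u v) \<partial>M)"
      by (intro nn_integral_mono pointwise)
    also have "\<dots> = (ennreal 4 * ?G u + ennreal ?c) + (\<integral>\<^sup>+v. ennreal 4 * ?G v + ennreal 16 * ?D u v \<partial>M)"
      using G D_meas
      by (subst nn_integral_add) (auto simp: emeasure_space_1[simplified] simp del: ennreal_numeral)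
    also have "(\<integral>\<^sup>+v. ennreal 4 * ?G v + ennreal 16 * ?D u v \<partial>M)
        = ennreal 4 * (\<integral>\<^sup>+v. ?G v \<partial>M) + ennreal 16 * (\<integral>\<^sup>+v. ?D u v \<partial>M)"
      by (rule nn_integral_add_cmult[OF G D_meas])
    also have "ennreal 4 * ?G u + ennreal ?c + (ennreal 4 * (\<integral>\<^sup>+v. ?G v \<partial>M) + ennreal 16 * (\<integral>\<^sup>+v. ?D u v \<partial>M))
        \<le> ennreal 4 * ?G u + ennreal ?c + (ennreal 4 * ennreal \<delta> + ennreal 16 * (\<integral>\<^sup>+v. ?D u v \<partial>M))"
      by (intro add_left_mono add_right_mono mult_left_mono \<delta>(1)) simp
    finally show ?thesis .
  qed
  have "variance_integral M F
      \<le> (\<integral>\<^sup>+u. (ennreal ?c + ennreal 4 * ennreal \<delta>) + (ennreal 4 * ?G u + ennreal 16 * (\<integral>\<^sup>+v. ?D u v \<partial>M)) \<partial>M)"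
    unfolding variance_integral_def
    using inner by (intro nn_integral_mono) (simp add: ac_simps del: ennreal_numeral)
  also have "\<dots> = (ennreal ?c + ennreal 4 * ennreal \<delta>)
      + (\<integral>\<^sup>+u. ennreal 4 * ?G u + ennreal 16 * (\<integral>\<^sup>+v. ?D u v \<partial>M) \<partial>M)"
    using G inner_meas
    by (subst nn_integral_add) (auto simp: emeasure_space_1[simplified] simp del: ennreal_numeral)
  also have "(\<integral>\<^sup>+u. ennreal 4 * ?G u + ennreal 16 * (\<integral>\<^sup>+v. ?D u v \<partial>M) \<partial>M)
      = ennreal 4 * (\<integral>\<^sup>+u. ?G u \<partial>M) + ennreal 16 * variance_integral M (h \<circ> z \<circ> p)"
    unfolding variance_integral_def by (rule nn_integral_add_cmult[OF G inner_meas])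
  also have "(ennreal ?c + ennreal 4 * ennreal \<delta>) + (ennreal 4 * (\<integral>\<^sup>+u. ?G u \<partial>M) + ennreal 16 * variance_integral M (h \<circ> z \<circ> p))
      \<le> (ennreal ?c + ennreal 4 * ennreal \<delta>) + (ennreal 4 * ennreal \<delta> + ennreal 16 * variance_integral M (h \<circ> z \<circ> p))"
    using \<delta>(1) by (intro add_left_mono add_right_mono mult_left_mono) auto
  also have "\<dots> = ennreal (8 * \<delta> + ?c) + ennreal 16 * variance_integral M (h \<circ> z \<circ> p)"
  proof -
    have "ennreal (8 * \<delta> + ?c) = ennreal (?c + 4 * \<delta> + 4 * \<delta>)" by (rule arg_cong[of _ _ ennreal]) simp
    also have "\<dots> = ennreal ?c + ennreal (4 * \<delta>) + ennreal (4 * \<delta>)"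
      using \<delta>(2) by (subst ennreal_plus, simp, simp)+ simp
    also have "ennreal (4 * \<delta>) = ennreal 4 * ennreal \<delta>"
      using \<delta>(2) by (intro ennreal_mult) auto
    finally show ?thesis by (simp add: ac_simps del: ennreal_numeral)
  qed
  finally show ?thesis .
qed

lemma variance_le_majorant:
  fixes F h :: "'y \<Rightarrow> 'x::real_normed_vector" and K :: real
  assumes F: "strongly_measurable M F" and h: "\<Lambda>-lipschitz_on UNIV h" and b: "\<And>y. norm (h y) \<le> b"
    and K: "0 \<le> K" "total_variance {..<n} (h \<circ> z) \<le> K * n * dirichlet_energy (parcs net_graph) (h \<circ> z)"
  shows "variance_integral M (h \<circ> z \<circ> p)
    \<le> ennreal (cell_ratio ^ 3 * K * degree_bound) * (\<integral>\<^sup>+u. majorant F h \<Lambda> b u \<partial>M)"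
proof -
  let ?q = cell_ratio and ?D = "dirichlet_energy (parcs net_graph) (h \<circ> z)"
  have n: "0 < real n" and q: "0 < ?q" using n_pos cell_ratio_ge_1 by auto
  have "(\<Sum>i<n. \<Sum>j<n. measure M (cell i) * measure M (cell j) * (norm ((h \<circ> z) i - (h \<circ> z) j))\<^sup>2)
      \<le> (\<Sum>i<n. \<Sum>j<n. (?q / n) * (?q / n) * (norm ((h \<circ> z) i - (h \<circ> z) j))\<^sup>2)"
    using measure_cell_bounds(2) q by (intro sum_mono mult_right_mono mult_mono) auto
  also have "\<dots> = (?q / n) * (?q / n) * total_variance {..<n} (h \<circ> z)"
    by (simp add: total_variance_def sum_distrib_left)
  also have "\<dots> \<le> (?q / n) * (?q / n) * (K * n * ?D)"
    using K q by (intro mult_left_mono) auto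
  also have "\<dots> = (?q\<^sup>2 * K / n) * ?D" using n by (simp add: power2_eq_square)
  finally have "variance_integral M (h \<circ> z \<circ> p) \<le> ennreal ((?q\<^sup>2 * K / n) * ?D)"
    unfolding variance_integral_step by (rule ennreal_leI)
  also have "\<dots> = ennreal (?q\<^sup>2 * K / n) * ennreal ?D"
    using K(1) dirichlet_energy_nonneg by (intro ennreal_mult) auto
  also have "\<dots> \<le> ennreal (?q\<^sup>2 * K / n) * (ennreal (?q * n * degree_bound) * (\<integral>\<^sup>+u. majorant F h \<Lambda> b u \<partial>M))"
    by (intro mult_left_mono dirichlet_energy_le_majorant F h b) simp
  also have "\<dots> = ennreal (?q ^ 3 * K * degree_bound) * (\<integral>\<^sup>+u. majorant F h \<Lambda> b u \<partial>M)"
  proof -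
    have "ennreal (?q\<^sup>2 * K / n) * ennreal (?q * n * degree_bound) = ennreal ((?q\<^sup>2 * K / n) * (?q * n * degree_bound))"
      using K(1) q by (intro ennreal_mult[symmetric]) auto
    also have "(?q\<^sup>2 * K / n) * (?q * n * degree_bound) = ?q ^ 3 * K * degree_bound"
      using n by (simp add: power2_eq_square power3_eq_cube)
    finally show ?thesis by (simp add: mult.assoc[symmetric])
  qed
  finally show ?thesis .
qed

end

context warped_system
begin

lemma lipschitz_bounded:
  fixes h :: "'y \<Rightarrow> 'x::real_normed_vector"
  assumes "\<Lambda>-lipschitz_on UNIV h"
  shows "\<exists>b\<ge>0. \<forall>y. norm (h y) \<le> b"
proof -
  have "compact (h ` UNIV)"
    using assms compact_space by (intro compact_continuous_image lipschitz_on_continuous_on)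
  then have "bounded (range h)" by (rule compact_imp_bounded)
  then obtain b where b: "\<And>y. norm (h y) \<le> b" unfolding bounded_iff by blast
  moreover have "0 \<le> b" using b[of undefined] norm_ge_zero order_trans by blast
  ultimately show ?thesis by blast
qed

lemma small_frontier_scale:
  assumes \<epsilon>: "0 < \<epsilon>"
  shows "\<exists>r0>0. \<forall>r s. 0 < r \<longrightarrow> r \<le> r0 \<longrightarrow> s \<in> S \<longrightarrow> measure M (\<Union>x\<in>frontier (dom s). ball x (4 * r)) \<le> \<epsilon>"
proof -
  have "\<exists>\<delta>>0. measure M (\<Union>x\<in>frontier (dom s). ball x \<delta>) \<le> \<epsilon>" if s: "s \<in> S" for s
  proof -
    let ?F = "frontier (dom s)"
    obtain \<delta> where \<delta>: "0 < \<delta>" "measure M ((\<Union>x\<in>?F. ball x \<delta>) - ?F) < \<epsilon>"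
      using closed_neighbourhood_measure[OF finite_measure_axioms sets_M frontier_closed \<epsilon>] by blast
    have sets: "?F \<in> sets M" "(\<Union>x\<in>?F. ball x \<delta>) \<in> sets M"
      by (auto simp: sets_M frontier_closed intro!: borel_open open_UN)
    have "measure M (\<Union>x\<in>?F. ball x \<delta>) \<le> measure M (((\<Union>x\<in>?F. ball x \<delta>) - ?F) \<union> ?F)"
      using sets by (intro finite_measure_mono) auto
    also have "\<dots> \<le> measure M ((\<Union>x\<in>?F. ball x \<delta>) - ?F) + measure M ?F"
      using sets by (intro measure_Un_le) auto
    finally show ?thesis using \<delta> S_frontier[OF s] by (intro exI[of _ \<delta>]) auto
  qed
  then obtain \<delta> where \<delta>: "\<And>s. s \<in> S \<Longrightarrow> 0 < \<delta> s"
    "\<And>s. s \<in> S \<Longrightarrow> measure M (\<Union>x\<in>frontier (dom s). ball x (\<delta> s)) \<le> \<epsilon>" by metis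
  define r0 where "r0 = Min (insert 1 ((\<lambda>s. \<delta> s / 4) ` S))"
  have "0 < r0" unfolding r0_def using finite_S \<delta>(1) by (subst Min_gr_iff) auto
  moreover have "measure M (\<Union>x\<in>frontier (dom s). ball x (4 * r)) \<le> \<epsilon>" if "r \<le> r0" "s \<in> S" for r s
  proof -
    have "r0 \<le> \<delta> s / 4" unfolding r0_def using finite_S that(2) by (intro Min_le) auto
    then have sub: "ball x (4 * r) \<subseteq> ball x (\<delta> s)" for x :: 'y using that(1) by (intro subset_ball) auto
    have "(\<Union>x\<in>frontier (dom s). ball x (4 * r)) \<subseteq> (\<Union>x\<in>frontier (dom s). ball x (\<delta> s))"
      using sub by blast
    moreover have "(\<Union>x\<in>frontier (dom s). ball x (\<delta> s)) \<in> sets M"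
      by (auto simp: sets_M intro!: borel_open open_UN)
    ultimately have "measure M (\<Union>x\<in>frontier (dom s). ball x (4 * r)) \<le> measure M (\<Union>x\<in>frontier (dom s). ball x (\<delta> s))"
      by (rule finite_measure_mono)
    then show ?thesis using \<delta>(2)[OF that(2)] by simp
  qed
  ultimately show ?thesis by blast
qed

text \<open>Passing from \<open>F\<close> to sampled values of \<open>h\<close> costs a factor \<open>16\<close> in the variance, and another \<open>16\<close> is
  the factor of the jumps of \<open>F\<close> in the majorant.\<close>

definition gap_constant :: "real \<Rightarrow> real" where
  "gap_constant K = 256 * (cell_ratio ^ 3 * K * degree_bound)"

text \<open>The Lipschitz approximation \<open>h\<close> has to be chosen before the scale \<open>r\<close>, since the remaining errors
  involve the Lipschitz constant and the supremum of \<open>h\<close>. All constants in front of the errors are independent of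
  the net.\<close>

lemma variance_le_jump_energy:
  fixes F :: "'y \<Rightarrow> 'x::real_normed_vector"
  assumes K: "0 \<le> K"
    and poincare: "\<And>z n r (f :: nat \<Rightarrow> 'x). warped_net M c m C S L z n r \<Longrightarrow>
      total_variance {..<n} f \<le> K * n * dirichlet_energy (parcs (warped_net.net_graph S z n r)) f"
    and F: "strongly_measurable M F" and fin: "(\<integral>\<^sup>+u. ennreal ((norm (F u))\<^sup>2) \<partial>M) < \<infinity>"
  shows "variance_integral M F \<le> ennreal (gap_constant K) * jump_energy F"
proof (rule ennreal_le_epsilon)
  fix e :: real assume e: "0 < e"
  define A where "A = cell_ratio ^ 3 * K * degree_bound"
  have A: "0 \<le> A" using K cell_ratio_ge_1 by (simp add: A_def)
  define mc where "mc = 13 + 4 * (2 * L + 1)\<^sup>2"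
  have mc: "0 < mc" by (simp add: mc_def add_pos_nonneg)
  \<comment> \<open>\<open>B1\<close>, \<open>B2\<close>, \<open>B3\<close> are the total coefficients of the errors caused by \<open>F - h\<close>, by the boundary zones and
    by the oscillation of \<open>h\<close> in a cell; each kind may use a third of \<open>e\<close>.\<close>
  define B1 where "B1 = 8 + 256 * A * (card S * (1 + push_constant))"
  have B1: "0 < B1" using A push_constant_nonneg by (simp add: B1_def add_pos_nonneg)
  define \<delta> where "\<delta> = e / 3 / B1"
  have \<delta>: "0 < \<delta>" using e B1 by (simp add: \<delta>_def)
  obtain h \<Lambda> where h: "\<Lambda>-lipschitz_on UNIV h" "(\<integral>\<^sup>+u. ennreal ((norm (F u - h u))\<^sup>2) \<partial>M) < ennreal \<delta>"
    using lipschitz_L2_dense[OF F fin \<delta>] by blast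
  obtain b where b: "0 \<le> b" "\<And>y. norm (h y) \<le> b" using lipschitz_bounded[OF h(1)] by blast
  have \<Lambda>: "0 \<le> \<Lambda>" using h(1) by (rule lipschitz_on_nonneg)
  define B2 where "B2 = 64 * A * card S * b\<^sup>2 + 1"
  have B2: "0 < B2" using A by (simp add: B2_def add_nonneg_pos)
  define w where "w = e / 3 / B2"
  have w: "0 < w" using e B2 by (simp add: w_def)
  obtain r0 where r0: "0 < r0"
    "\<And>r s. 0 < r \<Longrightarrow> r \<le> r0 \<Longrightarrow> s \<in> S \<Longrightarrow> measure M (\<Union>x\<in>frontier (dom s). ball x (4 * r)) \<le> w"
    using small_frontier_scale[OF w] by blast
  define B3 where "B3 = 32 + 16 * A * mc"
  have B3: "0 < B3" using A mc by (simp add: B3_def add_pos_nonneg)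
  define r where "r = min r0 (sqrt (e / 3 / B3) / (\<Lambda> + 1))"
  have r: "0 < r" "r \<le> r0" using r0 e B3 \<Lambda> by (auto simp: r_def)
  have "\<Lambda> * r \<le> (\<Lambda> + 1) * r" using r by (intro mult_right_mono) auto
  also have "\<dots> \<le> (\<Lambda> + 1) * (sqrt (e / 3 / B3) / (\<Lambda> + 1))" using \<Lambda> by (intro mult_left_mono) (auto simp: r_def)
  also have "\<dots> = sqrt (e / 3 / B3)" using \<Lambda> by simp
  finally have "(\<Lambda> * r)\<^sup>2 \<le> (sqrt (e / 3 / B3))\<^sup>2" using \<Lambda> r by (intro power_mono) auto
  then have scale: "(\<Lambda> * r)\<^sup>2 \<le> e / 3 / B3" using e B3 by simp
  obtain z n where net: "separated_net (UNIV :: 'y set) r z n"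
    using separated_net_exists[OF compact_space r(1)] by blast
  interpret N: warped_net M c m C S L z n r
    by unfold_locales (use r net in auto)
  have zones: "measure M (N.frontier_zone s) \<le> w" if "s \<in> S" for s
    unfolding N.frontier_zone_def using r0(2)[OF r that] .
  have D: "(\<integral>\<^sup>+u. ennreal ((norm (F u - h u))\<^sup>2) \<partial>M) \<le> ennreal \<delta>" using h(2) by simp
  let ?E = "mc * (\<Lambda> * r)\<^sup>2 + card S * (4 * b\<^sup>2 * w) + 16 * (card S * ((1 + push_constant) * \<delta>))"
  have E: "0 \<le> ?E" using mc w push_constant_nonneg \<delta> by simp
  have discretise: "variance_integral M F \<le> ennreal (8 * \<delta> + 32 * (\<Lambda> * r)\<^sup>2)
      + ennreal 16 * variance_integral M (h \<circ> z \<circ> N.p)"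
    using \<delta> by (intro N.variance_le_step_variance F h D) simp
  have "variance_integral M (h \<circ> z \<circ> N.p) \<le> ennreal A * (\<integral>\<^sup>+u. N.majorant F h \<Lambda> b u \<partial>M)"
    unfolding A_def by (rule N.variance_le_majorant[OF F h(1) b(2) K poincare[OF N.warped_net_axioms]])
  also have "\<dots> \<le> ennreal A * (ennreal ?E + ennreal 16 * jump_energy F)"
    using N.nn_integral_majorant_le[OF F strongly_measurable_lipschitz[OF h(1)] zones D] \<delta>
    by (intro mult_left_mono) (simp_all add: N.majorant_constant_def mc_def del: ennreal_numeral)
  finally have step: "variance_integral M (h \<circ> z \<circ> N.p) \<le> ennreal A * (ennreal ?E + ennreal 16 * jump_energy F)" .
  have "variance_integral M F \<le> ennreal (8 * \<delta> + 32 * (\<Lambda> * r)\<^sup>2)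
      + ennreal 16 * (ennreal A * (ennreal ?E + ennreal 16 * jump_energy F))"
    by (rule order_trans[OF discretise]) (intro add_left_mono mult_left_mono step, simp)
  also have "\<dots> = ennreal (8 * \<delta> + 32 * (\<Lambda> * r)\<^sup>2 + 16 * (A * ?E)) + ennreal (gap_constant K) * jump_energy F"
  proof -
    have 1: "ennreal 16 * (ennreal A * ennreal ?E) = ennreal (16 * (A * ?E))"
      using A E by (simp only: ennreal_mult[symmetric] mult_nonneg_nonneg zero_le_numeral)
    have 2: "ennreal 16 * (ennreal A * (ennreal 16 * j)) = ennreal (gap_constant K) * j" for j
    proof -
      have "ennreal (gap_constant K) = ennreal (16 * (A * 16))" by (simp add: gap_constant_def A_def mult_ac)
      also have "\<dots> = ennreal 16 * (ennreal A * ennreal 16)"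
        using A by (simp only: ennreal_mult mult_nonneg_nonneg zero_le_numeral)
      finally show ?thesis by (simp only: mult.assoc)
    qed
    have 3: "ennreal (8 * \<delta> + 32 * (\<Lambda> * r)\<^sup>2 + 16 * (A * ?E)) = ennreal (8 * \<delta> + 32 * (\<Lambda> * r)\<^sup>2) + ennreal (16 * (A * ?E))"
      using \<delta> A E by (intro ennreal_plus) auto
    have 4: "x * (y * (u + v * j)) = x * (y * u) + x * (y * (v * j))" for x y u v j :: ennreal
      by (simp only: distrib_left)
    show ?thesis unfolding 3 4 1 2 by (simp only: add.assoc)
  qed
  finally have total: "variance_integral M F \<le> ennreal (8 * \<delta> + 32 * (\<Lambda> * r)\<^sup>2 + 16 * (A * ?E))
      + ennreal (gap_constant K) * jump_energy F" .
  have "ennreal (8 * \<delta> + 32 * (\<Lambda> * r)\<^sup>2 + 16 * (A * ?E)) \<le> ennreal e"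
  proof (rule ennreal_leI)
    have "8 * \<delta> + 32 * (\<Lambda> * r)\<^sup>2 + 16 * (A * ?E)
        = B1 * \<delta> + B3 * (\<Lambda> * r)\<^sup>2 + (64 * A * card S * b\<^sup>2) * w"
      by (simp add: B1_def B3_def algebra_simps)
    also have "\<dots> \<le> B1 * \<delta> + B3 * (e / 3 / B3) + B2 * w"
      using scale B1 B3 w by (intro add_mono mult_left_mono mult_right_mono) (auto simp: B2_def)
    also have "\<dots> = e" using B1 B2 B3 by (simp add: \<delta>_def w_def)
    finally show "8 * \<delta> + 32 * (\<Lambda> * r)\<^sup>2 + 16 * (A * ?E) \<le> e" .
  qed
  then show "variance_integral M F \<le> ennreal (gap_constant K) * jump_energy F + ennreal e"
    by (subst add.commute) (rule order_trans[OF total add_right_mono])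
qed

text \<open>Square-integrable functions agree only almost everywhere with strongly measurable ones, so both sides of the gap
  inequality have to be insensitive to null sets. For the jump energy this needs the maps in \<open>S\<close> to pull null
  sets back to null sets.\<close>

lemma variance_integral_cong_AE:
  assumes "AE x in M. f x = g x"
  shows "variance_integral M f = variance_integral M g"
  unfolding variance_integral_def
proof (rule nn_integral_cong_AE)
  show "AE u in M. (\<integral>\<^sup>+v. ennreal ((norm (f u - f v))\<^sup>2) \<partial>M) = (\<integral>\<^sup>+v. ennreal ((norm (g u - g v))\<^sup>2) \<partial>M)"
    using assms
  proof eventually_elim
    case (elim u)
    show ?case
      by (rule nn_integral_cong_AE) (use assms in \<open>eventually_elim, simp add: elim\<close>)
  qed
qed

lemma jump_energy_cong_AE:
  assumes eq: "AE x in M. f x = g x"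
  shows "jump_energy f = jump_energy g"
  unfolding jump_energy_def
proof (rule sum.cong[OF refl], rule nn_integral_cong_AE)
  fix s assume s: "s \<in> S"
  obtain N where N: "{x \<in> space M. f x \<noteq> g x} \<subseteq> N" "emeasure M N = 0" "N \<in> sets M"
    using eq by (rule AE_E)
  have "(\<integral>\<^sup>+u\<in>dom s. indicator N (the (s u)) \<partial>M) \<le> ennreal push_constant * (\<integral>\<^sup>+u. indicator N u \<partial>M)"
    using N by (intro nn_integral_jump_le[OF s]) auto
  also have "\<dots> = 0" using N by simp
  finally have zero: "(\<integral>\<^sup>+u\<in>dom s. indicator N (the (s u)) \<partial>M) = 0" by simp
  have "(\<lambda>u. indicator N (the (s u)) * indicator (dom s) u :: ennreal) \<in> borel_measurable M"
  proof -
    have "(\<lambda>u. indicator N (the (s u)) :: ennreal) \<in> borel_measurable (restrict_space M (dom s))"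
      by (rule measurable_compose[OF partial_map_measurable[OF S_continuous[OF s]]]) (use N in simp)
    then show ?thesis
      using S_closed[OF s] by (subst (asm) borel_measurable_restrict_space_iff_ennreal) (auto simp: sets_M)
  qed
  then have "AE u in M. indicator N (the (s u)) * indicator (dom s) u = (0::ennreal)"
    using zero by (simp add: nn_integral_0_iff_AE)
  with eq show "AE u in M. ennreal ((norm (f u - f (the (s u))))\<^sup>2) * indicator (dom s) u =
      ennreal ((norm (g u - g (the (s u))))\<^sup>2) * indicator (dom s) u"
  proof eventually_elim
    case (elim u)
    show ?case
    proof (cases "u \<in> dom s")
      case True
      then have "the (s u) \<notin> N" using elim(2) by (auto simp: indicator_def split: if_splits)
      then have "f (the (s u)) = g (the (s u))" using N(1) by auto
      then show ?thesis using elim(1) by simp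
    qed simp
  qed
qed

lemma spectral_gap_of_net_poincare:
  assumes K: "0 \<le> K"
    and poincare: "\<And>z n r (f :: nat \<Rightarrow> 'x::banach). warped_net M c m C S L z n r \<Longrightarrow>
      total_variance {..<n} f \<le> K * n * dirichlet_energy (parcs (warped_net.net_graph S z n r)) f"
  shows "has_spectral_gap TYPE('x) M S"
  unfolding has_spectral_gap_altdef
proof (intro exI conjI allI impI)
  let ?g = "gap_constant K"
  have g: "0 \<le> ?g" using K cell_ratio_ge_1 by (simp add: gap_constant_def)
  show "0 < 1 / (?g + 1)" using g by simp
  fix f :: "'y \<Rightarrow> 'x" assume f: "f \<in> L2_functions M"
  then have "bochner_measurable M f" by (simp add: L2_functions_def)
  then obtain F where F: "strongly_measurable M F" "AE x in M. f x = F x"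
    using bochner_measurable_imp_strongly_measurable by blast
  have "(\<integral>\<^sup>+u. ennreal ((norm (F u))\<^sup>2) \<partial>M) = (\<integral>\<^sup>+u. ennreal ((norm (f u))\<^sup>2) \<partial>M)"
    using F(2) by (intro nn_integral_cong_AE) (auto elim!: eventually_mono)
  also have "\<dots> < \<infinity>" using f by (simp add: L2_functions_def)
  finally have "variance_integral M F \<le> ennreal ?g * jump_energy F"
    by (intro variance_le_jump_energy[OF K poincare F(1)])
  then have le: "variance_integral M f \<le> ennreal ?g * jump_energy f"
    using variance_integral_cong_AE[OF F(2)] jump_energy_cong_AE[OF F(2)] by simp
  have "ennreal (1 / (?g + 1)) * variance_integral M f \<le> ennreal (1 / (?g + 1)) * (ennreal ?g * jump_energy f)"
    using le by (rule mult_left_mono) simp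
  also have "\<dots> = ennreal (1 / (?g + 1) * ?g) * jump_energy f"
    using g by (subst ennreal_mult) (auto simp: mult.assoc)
  also have "\<dots> \<le> ennreal 1 * jump_energy f"
    using g by (intro mult_right_mono ennreal_leI) auto
  finally show "ennreal (1 / (?g + 1)) * variance_integral M f \<le> jump_energy f" by simp
qed

lemma spectral_gap_of_expander:
  fixes G :: "real \<Rightarrow> 'w pair_pre_digraph"
  assumes exp: "expander_wrt TYPE('x::banach) {0<..} G"
    and conn: "\<And>t. 0 < t \<Longrightarrow> Digraph_Component.connected (with_proj (G t))"
    and qi: "quasi_isometric_families {0<..} (warped_cone S) (\<lambda>t. graph_metric (G t))"
  shows "has_spectral_gap TYPE('x) M S"
proof -
  obtain A B Q where AQ: "0 \<le> A" "0 < B" "1 \<le> Q"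
    and qi: "\<And>t. 0 < t \<Longrightarrow> \<exists>f. quasi_isometry A B Q (warped_cone S t) (graph_metric (G t)) f"
    using qi by (auto simp: quasi_isometric_families_def)
  from exp[unfolded expander_wrt_altdef] obtain k \<eta>
    where G: "\<forall>t\<in>{0<..}. pair_graph (G t)"
      and k: "\<forall>t\<in>{0<..}. \<forall>v\<in>pverts (G t). card (parcs (G t) `` {v}) \<le> k"
      and \<eta>: "0 < \<eta>" "\<forall>t\<in>{0<..}. \<forall>f :: 'w \<Rightarrow> 'x.
        \<eta> / card (pverts (G t)) * total_variance (pverts (G t)) f \<le> dirichlet_energy (parcs (G t)) f"
    by (elim conjE exE)
  define K where "K = warped_net.transfer_constant m C S L A B Q k \<eta>"
  show ?thesis
  proof (rule spectral_gap_of_net_poincare)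
    obtain z n where "separated_net (UNIV :: 'y set) 1 z n"
      using separated_net_exists[OF compact_space, of 1] by auto
    then interpret N: warped_net M c m C S L z n 1 by unfold_locales auto
    show "0 \<le> K" using \<eta>(1) by (simp add: K_def N.transfer_constant_def Let_def)
  next
    fix z n r and f :: "nat \<Rightarrow> 'x"
    assume "warped_net M c m C S L z n r"
    then interpret N: warped_net M c m C S L z n r .
    have t: "0 < 1 / r" using N.r_pos by simp
    obtain \<phi> where "quasi_isometry A B Q (warped_cone S (1 / r)) (graph_metric (G (1 / r))) \<phi>"
      using qi[OF t] by blast
    then show "total_variance {..<n} f \<le> K * n * dirichlet_energy (parcs N.net_graph) f"
      unfolding K_def
      using G k \<eta> AQ conn[OF t] t by (intro N.net_graph_poincare_transfer[where H = "G (1 / r)" and \<phi> = \<phi>]) auto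
  qed
qed

lemma expander_of_spectral_gap:
  assumes "has_spectral_gap TYPE('x::banach) M S"
  shows "\<exists>G :: real \<Rightarrow> nat pair_pre_digraph.
    expander_wrt TYPE('x) {0<..} G \<and>
    (\<forall>t>0. Digraph_Component.connected (with_proj (G t))) \<and>
    quasi_isometric_families {0<..} (warped_cone S) (\<lambda>t. graph_metric (G t))"
proof -
  obtain \<kappa> where \<kappa>: "0 < \<kappa>"
    and gap: "\<And>f :: 'y \<Rightarrow> 'x. f \<in> L2_functions M \<Longrightarrow> ennreal \<kappa> * variance_integral M f \<le> jump_energy f"
    using assms unfolding has_spectral_gap_altdef by blast
  have "\<exists>z n. separated_net (UNIV :: 'y set) (1 / t) z n" if "0 < t" for t
    using separated_net_exists[OF compact_space, of "1 / t"] that by simp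
  then obtain z n where zn: "\<And>t. 0 < t \<Longrightarrow> separated_net (UNIV :: 'y set) (1 / t) (z t) (n t)" by metis
  have net: "warped_net M c m C S L (z t) (n t) (1 / t)" if "0 < t" for t
    using that zn by unfold_locales auto
  define G where "G t = warped_net.net_graph S (z t) (n t) (1 / t)" for t
  have "expander_wrt TYPE('x) {0<..} G"
    unfolding expander_wrt_altdef
  proof (intro conjI exI[of _ degree_bound] exI[of _ "\<kappa> / (cell_ratio ^ 3 * (card S + 1))"] ballI allI)
    fix t :: real assume "t \<in> {0<..}"
    then interpret N: warped_net M c m C S L "z t" "n t" "1 / t" using net by simp
    show "pair_graph (G t)" unfolding G_def by (rule N.pair_graph_net_graph)
    show "card (parcs (G t) `` {v}) \<le> degree_bound" for v unfolding G_def by (rule N.degree_net_graph)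
    show "\<kappa> / (cell_ratio ^ 3 * (card S + 1)) / card (pverts (G t)) * total_variance (pverts (G t)) f
        \<le> dirichlet_energy (parcs (G t)) f" for f :: "nat \<Rightarrow> 'x"
      using N.net_graph_poincare_of_gap[OF \<kappa> gap[OF N.step_function_L2], of f] by (simp add: G_def)
  next
    show "0 < \<kappa> / (cell_ratio ^ 3 * (card S + 1))" using \<kappa> cell_ratio_ge_1 by simp
  next
    fix N :: nat
    \<comment> \<open>At this scale a cell has measure at most \<open>1 / (N + 1)\<close>.\<close>
    define r where "r = (1 / (C * c * (real N + 1))) powr (1 / m)"
    have C: "0 < C * c * (real N + 1)" using constants by simp
    have r: "0 < r" using C constants by (simp add: r_def)
    have rm: "C * c * r powr m = 1 / (real N + 1)"
      using C constants by (simp add: r_def powr_powr)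
    have t: "0 < 1 / r" using r by simp
    interpret N: warped_net M c m C S L "z (1 / r)" "n (1 / r)" "1 / (1 / r)" by (rule net[OF t])
    have "1 \<le> n (1 / r) * (1 / (real N + 1))" using N.card_net_lower rm by simp
    then have "real N + 1 \<le> n (1 / r)" by (simp add: field_simps)
    then have "N < n (1 / r)" by linarith
    then have "N < card (pverts (G (1 / r)))"
      by (simp only: G_def N.pverts_net_graph card_lessThan)
    then show "\<exists>i\<in>{0<..}. N < card (pverts (G i))" using t by (intro bexI[of _ "1 / r"]) auto
  qed
  moreover have "\<forall>t>0. Digraph_Component.connected (with_proj (G t))"
    using warped_net.connected_net_graph[OF net] by (simp add: G_def)
  moreover have "quasi_isometric_families {0<..} (warped_cone S) (\<lambda>t. graph_metric (G t))"
    unfolding quasi_isometric_families_def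
  proof (rule exI[of _ 2], rule exI[of _ 1], rule exI[of _ 3], intro conjI ballI)
    fix t :: real assume "t \<in> {0<..}"
    then interpret N: warped_net M c m C S L "z t" "n t" "1 / t" using net by simp
    show "\<exists>f. quasi_isometry 2 1 3 (warped_cone S t) (graph_metric (G t)) f"
      using N.quasi_isometry_net_graph unfolding G_def by auto
  qed auto
  ultimately show ?thesis by blast
qed

end

section \<open>Spectral gaps and expanders\<close>

lemma partial_lipschitz_homeo_inj:
  assumes "partial_lipschitz_homeo s" "s x = Some y" "s x' = Some y"
  shows "x = x'"
proof -
  obtain g where "homeomorphism (dom s) (ran s) (\<lambda>x. the (s x)) g"
    using assms(1) by (auto simp: partial_lipschitz_homeo_def)
  then have g: "g (the (s v)) = v" if "v \<in> dom s" for v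
    using that by (simp add: homeomorphism_def)
  show ?thesis using g[of x] g[of x'] assms(2,3) by (simp add: domI)
qed

lemma uniform_lipschitz_constant:
  assumes "finite S" "\<forall>s\<in>S. partial_lipschitz_homeo s"
  shows "\<exists>L\<ge>1. \<forall>s\<in>S. L-lipschitz_on (dom s) (\<lambda>x. the (s x))"
proof -
  have "\<forall>s\<in>S. \<exists>L. L-lipschitz_on (dom s) (\<lambda>x. the (s x))"
    using assms(2) by (simp add: partial_lipschitz_homeo_def)
  then obtain l where l: "\<And>s. s \<in> S \<Longrightarrow> (l s)-lipschitz_on (dom s) (\<lambda>x. the (s x))" by metis
  let ?L = "Max (insert 1 (l ` S))"
  have "?L-lipschitz_on (dom s) (\<lambda>x. the (s x))" if "s \<in> S" for s
    using assms(1) that by (intro lipschitz_on_mono[OF l[OF that]] Max_ge) auto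
  moreover have "1 \<le> ?L" using assms(1) by (intro Max_ge) auto
  ultimately show ?thesis by blast
qed

lemma ahlfors_regular_imp_locale:
  fixes M :: "'y::metric_space measure"
  assumes comp: "compact (UNIV :: 'y set)" and nontriv: "\<exists>x y :: 'y. x \<noteq> y"
    and M: "prob_space M" "sets M = sets borel" "ahlfors_regular M"
  shows "\<exists>c m C. ahlfors_space M c m C"
proof -
  interpret prob_space M by (rule M(1))
  let ?D = "diameter (UNIV :: 'y set)"
  obtain c m C where cmC: "0 < c" "0 < m" "1 \<le> C"
    and reg: "\<And>y r. 0 < r \<Longrightarrow> r \<le> 2 * ?D \<Longrightarrow>
      ennreal (c * r powr m) \<le> emeasure M (ball y r) \<and> emeasure M (ball y r) \<le> ennreal (C * c * r powr m)"
    using M(3) unfolding ahlfors_regular_def by metis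
  have dist_le: "dist x y \<le> ?D" for x y :: 'y
    by (intro diameter_bounded_bound compact_imp_bounded comp) auto
  obtain x0 y0 :: 'y where "x0 \<noteq> y0" using nontriv by auto
  then have D: "0 < ?D" using dist_le[of x0 y0] zero_less_dist_iff[of x0 y0] by linarith
  have upper: "measure M (ball y r) \<le> C * c * r powr m" if "0 < r" "r \<le> 2 * ?D" for y r
    using reg[OF that, of y] cmC by (simp add: emeasure_eq_measure)
  have "ahlfors_space M c m C"
  proof unfold_locales
    show "measure M (ball y r) \<le> C * c * r powr m" if "0 < r" for y r
    proof (cases "r \<le> 2 * ?D")
      case False
      have "ball y r = ball y (2 * ?D)"
      proof -
        have "dist y u < 2 * ?D" "dist y u < r" for u
          using False D dist_le[of y u] by linarith+
        then show ?thesis by (auto simp: ball_def)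
      qed
      then have "measure M (ball y r) \<le> C * c * (2 * ?D) powr m" using upper[of "2 * ?D" y] D by simp
      also have "\<dots> \<le> C * c * r powr m"
        using False D cmC by (intro mult_left_mono powr_mono2) auto
      finally show ?thesis .
    qed (use upper that in simp)
    show "c * r powr m \<le> measure M (ball y r)" if "0 < r" "r \<le> 2 * ?D" for r y
      using reg[OF that, of y] by (simp add: emeasure_eq_measure)
  qed (use comp nontriv M cmC in auto)
  then show ?thesis by blast
qed

theorem theorem4p2:
  fixes M :: "'y::metric_space measure"
    and S :: "('y \<rightharpoonup> 'y) set"
  assumes "compact (UNIV :: 'y set)"
    and "geodesic_set (UNIV :: 'y set)"
    and "\<exists>x y :: 'y. x \<noteq> y"
    and "prob_space M" and "sets M = sets borel"
    and "ahlfors_regular M"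
    and "finite S"
    and "\<forall>s\<in>S. partial_lipschitz_homeo s"
    and "\<forall>s\<in>S. partial_inv s \<in> S"
    and "\<forall>s\<in>S. emeasure M (frontier (dom s)) = 0"
  shows "has_spectral_gap TYPE('x::banach) M S \<longleftrightarrow>
    (\<exists>G :: real \<Rightarrow> nat pair_pre_digraph.
       expander_wrt TYPE('x) {0<..} G \<and>
       (\<forall>t>0. Digraph_Component.connected (with_proj (G t))) \<and>
       quasi_isometric_families {0<..} (warped_cone S) (\<lambda>t. graph_metric (G t)))"
proof -
  obtain c m C where ahlfors: "ahlfors_space M c m C"
    using ahlfors_regular_imp_locale[OF assms(1,3-6)] by blast
  obtain L where L: "1 \<le> L" "\<And>s. s \<in> S \<Longrightarrow> L-lipschitz_on (dom s) (\<lambda>x. the (s x))"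
    using uniform_lipschitz_constant[OF assms(7,8)] by blast
  interpret ahlfors_space M c m C by (rule ahlfors)
  interpret warped_system M c m C S L
  proof unfold_locales
    show "closed (dom s)" if "s \<in> S" for s
      using assms(8) that by (simp add: partial_lipschitz_homeo_def)
    show "x = x'" if "s \<in> S" "s x = Some y" "s x' = Some y" for s x y x'
      using partial_lipschitz_homeo_inj assms(8) that by blast
    show "measure M (frontier (dom s)) = 0" if "s \<in> S" for s
      using assms(10) that by (simp add: measure_def)
  qed (use assms L in auto)
  show ?thesis
    using expander_of_spectral_gap spectral_gap_of_expander by blast
qed

end
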